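(* Let $\lambda>0$, let $\varphi$ be a fixed real polynomial of degree $k\ge1$, let $\xi$ be the Poisson field of independent simple symmetric random walks on $\mathbb Z$ with parameter $\lambda$, and let $\widehat S=(\widehat S_n)_{n\ge0}$ be a simple symmetric random walk on $\mathbb Z$ with $\widehat S_0=0$, independent of $\xi$ and of all particle walks. Put $\widehat Y_{N,\varphi}=\sum_{n=1}^N\varphi(\xi(n,\widehat S_n))$, with variances taken under the joint law of $\xi$ and $\widehat S$. Let $c_{\varphi,\ell}$, $1\le\ell\le k$, be the Poisson--Charlier coefficients of $\varphi$ and let $r_\varphi=\min\{\ell\in\{1,\dots,k\}:c_{\varphi,\ell}\ne0\}$ be its Poisson--Charlier rank. Then, as $N\to\infty$: 1. if $r_\varphi=1$, then $\operatorname{Var}(\widehat Y_{N,\varphi})\sim\dfrac{8\,c_{\varphi,1}^2\,\lambda}{3\sqrt\pi}\,N^{3/2}$; 2. if $r_\varphi=2$, then $\operatorname{Var}(\widehat Y_{N,\varphi})\sim\dfrac{8\,c_{\varphi,2}^2\,\lambda^2}{\pi\sqrt3}\,N\log N$; 3. if $r_\varphi\ge3$, then $\operatorname{Var}(\widehat Y_{N,\varphi})\asymp N$.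
   Context: Poisson field of independent walks: let $\{\xi(0,y):y\in\mathbb Z\}$ be i.i.d. Poisson random variables with mean $\lambda$. Given these, at time $0$ place $\xi(0,y)$ particles at each $y\in\mathbb Z$; the particles perform independent simple symmetric random walks $X^{y,i}=(X^{y,i}_n)_{n\ge0}$ on $\mathbb Z$ with $X^{y,i}_0=y$. Define $\xi(n,x)=\sum_{y\in\mathbb Z}\sum_{i=1}^{\xi(0,y)}\mathbf 1_{\{X_n^{y,i}=x\}}$ for $n\ge0$, $x\in\mathbb Z$. Monic Charlier polynomials $C_r(\cdot;\lambda)$: $C_0\equiv1$, $C_1(x;\lambda)=x-\lambda$, and $(x-\lambda)C_r(x;\lambda)=C_{r+1}(x;\lambda)+rC_r(x;\lambda)+r\lambda C_{r-1}(x;\lambda)$ for $r\ge1$. The Poisson--Charlier coefficients of $\varphi$ are the unique reals with $\varphi(M)-\mathbb E[\varphi(M)]=\sum_{\ell=1}^kc_{\varphi,\ell}C_\ell(M;\lambda)$, where $M\sim\mathrm{Poi}(\lambda)$. $a_N\sim b_N$ means $a_N/b_N\to1$; $a_N\asymp b_N$ means that there are constants $0<c\le C<\infty$ with $c\,b_N\le a_N\le C\,b_N$ for all sufficiently large $N$. *)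

theory Defs
  imports "HOL-Probability.Probability" "HOL-Library.Landau_Symbols"
begin

definition (in prob_space) simple_random_walk :: "int \<Rightarrow> (nat \<Rightarrow> 'a \<Rightarrow> int) \<Rightarrow> bool" where
  "simple_random_walk x W \<longleftrightarrow>
     (\<forall>n. random_variable (count_space UNIV) (W n)) \<and>
     (AE \<omega> in M. W 0 \<omega> = x) \<and>
     indep_vars (\<lambda>_. count_space UNIV) (\<lambda>n \<omega>. W (Suc n) \<omega> - W n \<omega>) UNIV \<and>
     (\<forall>n. distr M (count_space UNIV) (\<lambda>\<omega>. W (Suc n) \<omega> - W n \<omega>)
          = measure_pmf (pmf_of_set {- 1, 1}))"

text \<open>The independent sources of randomness: the number of particles started at a site, the
  trajectory of the particle with a given starting site and label, and the trajectory of the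
  additional walk.\<close>

datatype source = Count int | Particle int nat | Walker

text \<open>The members of the family have different value types, so mutual independence is stated
  for the sigma-algebras they generate. Trajectories are random elements of the product space
  of paths, which makes whole walks (and not just their values at single times) independent.
  There is a walk for every label; only the labels below \<open>\<eta> y\<close> are occupied.\<close>

locale poisson_walks = prob_space M
  for M :: "'a measure" +
  fixes rate :: real
    and \<eta> :: "int \<Rightarrow> 'a \<Rightarrow> nat"
    and X :: "int \<Rightarrow> nat \<Rightarrow> nat \<Rightarrow> 'a \<Rightarrow> int"
    and S :: "nat \<Rightarrow> 'a \<Rightarrow> int"
  assumes count_measurable: "random_variable (count_space UNIV) (\<eta> y)"
    and count_poisson: "distr M (count_space UNIV) (\<eta> y) = measure_pmf (poisson_pmf rate)"
    and particle_walk: "simple_random_walk y (X y i)"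
    and walker_walk: "simple_random_walk 0 S"
    and independent: "indep_sets (\<lambda>s. case s of
          Count y \<Rightarrow> sets (vimage_algebra (space M) (\<eta> y) (count_space UNIV))
        | Particle y i \<Rightarrow> sets (vimage_algebra (space M) (\<lambda>\<omega> n. X y i n \<omega>)
            (\<Pi>\<^sub>M n\<in>(UNIV :: nat set). count_space (UNIV :: int set)))
        | Walker \<Rightarrow> sets (vimage_algebra (space M) (\<lambda>\<omega> n. S n \<omega>)
            (\<Pi>\<^sub>M n\<in>(UNIV :: nat set). count_space (UNIV :: int set)))) UNIV"

text \<open>Labels start at 0. Almost surely only the sites \<open>y\<close> with \<open>\<bar>y - x\<bar> \<le> n\<close> contribute,
  so the sum over \<open>y\<close> is finite outside a null set.\<close>

definition occupation ::
    "(int \<Rightarrow> 'a \<Rightarrow> nat) \<Rightarrow> (int \<Rightarrow> nat \<Rightarrow> nat \<Rightarrow> 'a \<Rightarrow> int) \<Rightarrow> nat \<Rightarrow> int \<Rightarrow> 'a \<Rightarrow> real" where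
  "occupation \<eta> X n x \<omega> = (\<Sum>\<^sub>\<infinity>y\<in>UNIV. \<Sum>i<\<eta> y \<omega>. of_bool (X y i n \<omega> = x))"

definition observed_sum ::
    "real poly \<Rightarrow> (int \<Rightarrow> 'a \<Rightarrow> nat) \<Rightarrow> (int \<Rightarrow> nat \<Rightarrow> nat \<Rightarrow> 'a \<Rightarrow> int) \<Rightarrow> (nat \<Rightarrow> 'a \<Rightarrow> int)
      \<Rightarrow> nat \<Rightarrow> 'a \<Rightarrow> real" where
  "observed_sum \<phi> \<eta> X S N \<omega> = (\<Sum>n=1..N. poly \<phi> (occupation \<eta> X n (S n \<omega>) \<omega>))"

text \<open>The last equation is \<open>(x - rate) C\<^sub>r = C\<^sub>r\<^sub>+\<^sub>1 + r C\<^sub>r + r rate C\<^sub>r\<^sub>-\<^sub>1\<close> at index \<open>Suc r\<close>, solved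
  for the leading term.\<close>

fun charlier :: "real \<Rightarrow> nat \<Rightarrow> real poly" where
  "charlier rate 0 = 1"
| "charlier rate (Suc 0) = [:- rate, 1:]"
| "charlier rate (Suc (Suc r)) =
     [:- rate, 1:] * charlier rate (Suc r) - smult (real (Suc r)) (charlier rate (Suc r))
       - smult (real (Suc r) * rate) (charlier rate r)"

text \<open>Setting the sequence to 0 outside the range from 1 to the degree makes it unique.\<close>

definition charlier_coeff :: "real \<Rightarrow> real poly \<Rightarrow> nat \<Rightarrow> real" where
  "charlier_coeff rate \<phi> = (THE c.
     (\<forall>l. l \<notin> {1..degree \<phi>} \<longrightarrow> c l = 0) \<and>
     (AE m in measure_pmf (poisson_pmf rate).
        poly \<phi> (real m) - measure_pmf.expectation (poisson_pmf rate) (\<lambda>j. poly \<phi> (real j))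
          = (\<Sum>l=1..degree \<phi>. c l * poly (charlier rate l) (real m))))"

definition charlier_rank :: "real \<Rightarrow> real poly \<Rightarrow> nat" where
  "charlier_rank rate \<phi> = Min {l \<in> {1..degree \<phi>}. charlier_coeff rate \<phi> l \<noteq> 0}"

end

theory Submission
  imports Defs "HOL-Real_Asymp.Real_Asymp"
begin

text \<open>Write \<open>\<phi> = c\<^sub>0 + \<Sum>\<^sub>l c\<^sub>l C\<^sub>l\<close>. For \<open>m \<le> n\<close> the occupation numbers \<open>\<xi>(m,a)\<close> and \<open>\<xi>(n,b)\<close> are Poisson variables
  sharing the particles which visit both space-time points; the mean number of these is \<open>rate * p\<close> with
  \<open>p = p\<^sub>n\<^sub>-\<^sub>m(b - a)\<close> the transition probability. The Mecke equation \<open>E[\<xi> h(\<xi>,\<xi>')] = rate (1 - p) E[h(\<xi>+1,\<xi>')] + rate p E[h(\<xi>+1,\<xi>'+1)]\<close> combined with the relations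
  \<open>C\<^sub>j\<^sub>+\<^sub>1(x) = x C\<^sub>j(x-1) - rate C\<^sub>j(x)\<close> and \<open>C\<^sub>l(x+1) - C\<^sub>l(x) = l C\<^sub>l\<^sub>-\<^sub>1(x)\<close> gives by induction
  \<open>E[C\<^sub>j(\<xi>) C\<^sub>l(\<xi>')] = \<delta>\<^sub>j\<^sub>l l! (rate p)\<^sup>l\<close>. Averaging over the independent walk, the variance is
  \<open>\<Sum>\<^sub>l c\<^sub>l\<^sup>2 l! rate\<^sup>l \<Sum>\<^sub>m\<^sub>,\<^sub>n a\<^sub>l(\<bar>m - n\<bar>)\<close> with \<open>a\<^sub>l(n) = \<Sum>\<^sub>x p\<^sub>n(x)\<^bsup>l+1\<^esup>\<close>. Now \<open>a\<^sub>1(n) = (2n choose n) / 4\<^sup>n \<sim> 1 / sqrt (\<pi> n)\<close>,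
  \<open>a\<^sub>2(n) \<sim> 2 / (\<pi> sqrt 3 n)\<close> by a local limit theorem for central binomial ratios, and
  \<open>a\<^sub>l(n) = O(n\<^bsup>-3/2\<^esup>)\<close> is summable for \<open>l \<ge> 3\<close>; the double sums follow by applying the Stolz-Cesaro theorem twice.\<close>

section \<open>Return probabilities of the simple random walk\<close>

text \<open>The Mecke equation replaces an explicit joint law of two occupation numbers: it survives
  independent superposition and Poisson compounding, so it is assembled particle by particle and
  site by site while intensities add up. The walk leaves counting measure invariant, which is why
  the total intensities depend only on \<open>n - m\<close> and \<open>b - a\<close>. The power l +
  1 instead of l arises because the independent walk itself passes from a to b with probability p.

  Two obstacles shape the probabilistic part. Independence is assumed for sigma-algebras of
  differently typed sources, whereas independent variables share one value type; hence every source
  is coded as a pair of naturals. And the occupation number is an infinite sum, finite only almost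
  surely; hence a finite natural-valued version that agrees with it almost surely.

  The local limit uses no Fourier analysis: quotients of neighbouring binomials are squeezed between
  exponentials whose exponents telescope to a Gaussian, and dominated convergence sums its powers.
  In the constants, symmetry in (m,n) gives a factor 2; summing c / sqrt n twice then yields 2 * 2 *
  (2/3) c = 8/3 c, and summing c / n twice yields 2 c.\<close>

fun walk_prob :: "nat \<Rightarrow> int \<Rightarrow> real" where
  "walk_prob 0 x = of_bool (x = 0)"
| "walk_prob (Suc n) x = (walk_prob n (x - 1) + walk_prob n (x + 1)) / 2"

lemma walk_prob_nonneg: "0 \<le> walk_prob n x"
  by (induction n arbitrary: x) auto

lemma walk_prob_eq_0: "int n < \<bar>x\<bar> \<Longrightarrow> walk_prob n x = 0"
  by (induction n arbitrary: x) auto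

lemma walk_prob_odd: "odd (int n + x) \<Longrightarrow> walk_prob n x = 0"
  by (induction n arbitrary: x) auto

text \<open>Here \<open>k\<close> is the number of up-steps, and the recursion of the walk is
  Pascal's rule.\<close>

lemma walk_prob_binomial: "walk_prob n (2 * int k - int n) = real (n choose k) / 2 ^ n"
proof (induction n arbitrary: k)
  case 0
  then show ?case by (cases k) auto
next
  case (Suc n)
  show ?case
  proof (cases k)
    case 0
    have "walk_prob n (- int n - 2) = 0" by (rule walk_prob_eq_0) auto
    with Suc[of 0] 0 show ?thesis by (simp add: algebra_simps)
  next
    case (Suc j)
    have 1: "2 * int k - int (Suc n) - 1 = 2 * int j - int n"
         "2 * int k - int (Suc n) + 1 = 2 * int k - int n" using Suc by auto
    show ?thesis unfolding walk_prob.simps 1 Suc.IH by (simp add: Suc field_simps)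
  qed
qed

text \<open>This is \<open>a_l(n)\<close> of the overview, summed over the number of up-steps
  instead of the endpoint. Of the \<open>Suc l\<close> factors, l come from the Charlier covariance
  and one from the observing walk.\<close>

definition walk_moment :: "nat \<Rightarrow> nat \<Rightarrow> real" where
  "walk_moment l n = (\<Sum>k\<le>n. (real (n choose k) / 2 ^ n) ^ Suc l)"

text \<open>Endpoints outside the parametrised ones are out of range or of the wrong parity.
  Allowing any finite superset A makes translated windows of sites usable later.\<close>

lemma sum_walk_prob_power:
  assumes "finite A" "{- int n..int n} \<subseteq> A"
  shows "(\<Sum>x\<in>A. walk_prob n x ^ Suc l) = walk_moment l n"
proof -
  have inj: "inj_on (\<lambda>k. 2 * int k - int n) {..n}" by (auto simp: inj_on_def)
  have "walk_moment l n = (\<Sum>x\<in>(\<lambda>k. 2 * int k - int n) ` {..n}. walk_prob n x ^ Suc l)"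
    by (subst sum.reindex[OF inj]) (simp add: walk_moment_def walk_prob_binomial)
  also have "\<dots> = (\<Sum>x\<in>A. walk_prob n x ^ Suc l)"
  proof (rule sum.mono_neutral_left[OF assms(1)])
    show "(\<lambda>k. 2 * int k - int n) ` {..n} \<subseteq> A" using assms(2) by force
    show "\<forall>x\<in>A - (\<lambda>k. 2 * int k - int n) ` {..n}. walk_prob n x ^ Suc l = 0"
    proof
      fix x assume x: "x \<in> A - (\<lambda>k. 2 * int k - int n) ` {..n}"
      have "int n < \<bar>x\<bar> \<or> odd (int n + x)"
      proof (rule ccontr)
        assume "\<not> ?thesis"
        then have "\<bar>x\<bar> \<le> int n" "even (int n + x)" by auto
        then have "x = 2 * int (nat ((int n + x) div 2)) - int n" "nat ((int n + x) div 2) \<le> n"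
          by auto
        with x show False by blast
      qed
      then show "walk_prob n x ^ Suc l = 0" using walk_prob_eq_0 walk_prob_odd by auto
    qed
  qed
  finally show ?thesis by simp
qed

lemma walk_moment_nonneg: "0 \<le> walk_moment l n"
  unfolding walk_moment_def by (intro sum_nonneg) auto

lemma walk_moment_at_0: "walk_moment l 0 = 1"
  by (simp add: walk_moment_def)

lemma walk_moment_0: "walk_moment 0 n = 1"
proof -
  have "(\<Sum>k\<le>n. real (n choose k)) = 2 ^ n"
    using choose_row_sum[of n] by (metis of_nat_numeral of_nat_power of_nat_sum)
  then show ?thesis by (simp add: walk_moment_def flip: sum_divide_distrib)
qed

lemma sum_walk_prob:
  assumes "finite A" "{- int n..int n} \<subseteq> A"
  shows "(\<Sum>x\<in>A. walk_prob n x) = 1"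
  using sum_walk_prob_power[OF assms, of 0] by (simp add: walk_moment_0)

lemma walk_prob_le_1: "walk_prob n x \<le> 1"
proof -
  have "walk_prob n x \<le> (\<Sum>z\<in>insert x {- int n..int n}. walk_prob n z)"
    by (rule member_le_sum) (auto simp: walk_prob_nonneg)
  also have "\<dots> = 1" by (rule sum_walk_prob) auto
  finally show ?thesis .
qed

abbreviation central_prob :: "nat \<Rightarrow> real" where
  "central_prob m \<equiv> real ((2 * m) choose m) / 4 ^ m"

text \<open>Vandermonde's identity: two independent walks of n steps meet with the return
  probability at time 2n.\<close>

lemma walk_moment_1: "walk_moment 1 n = central_prob n"
proof -
  have "(\<Sum>k\<le>n. real (n choose k) ^ 2) = real ((2 * n) choose n)"
    by (subst choose_square_sum [symmetric]) simp
  moreover have "(2 ^ n) ^ 2 = (4 ^ n :: real)" 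
    by (simp flip: power_mult) (simp add: power_mult mult.commute[of n])
  ultimately show ?thesis
    by (simp add: walk_moment_def power_divide numeral_2_eq_2 [symmetric] flip: sum_divide_distrib)
qed

text \<open>Both sides start at 1 and satisfy \<open>(n + 1) * u (n + 1) = (n + 1/2) * u n\<close>.
  The generalised binomial form makes Gamma-function asymptotics applicable.\<close>

lemma central_prob_gbinomial: "central_prob n = (-1) ^ n * ((-1/2) gchoose n)"
proof (induction n)
  case (Suc n)
  have 1: "Suc n * ((2 * Suc n) choose Suc n) = 2 * Suc n * (Suc (2 * n) choose n)"
    using Suc_times_binomial[of n "Suc (2 * n)"] by simp
  have 2: "Suc n * (Suc (2 * n) choose n) = Suc (2 * n) * ((2 * n) choose n)"
    using Suc_times_binomial[of n "2 * n"] binomial_symmetric[of n "Suc (2 * n)"]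
    by (simp add: Suc_diff_le mult_2)
  have "real (Suc n * ((2 * Suc n) choose Suc n)) = real (2 * (Suc n * (Suc (2 * n) choose n)))"
    using 1 by (simp only: mult.assoc)
  also have "\<dots> = real (2 * (Suc (2 * n) * ((2 * n) choose n)))" unfolding 2 ..
  finally have c: "real (Suc n) * real ((2 * Suc n) choose Suc n) = 2 * (2 * real n + 1) * real ((2 * n) choose n)"
    by (simp only: of_nat_mult of_nat_Suc) simp
  have "real (Suc n) * central_prob (Suc n) = (real (Suc n) * real ((2 * Suc n) choose Suc n)) / (4 * 4 ^ n)"
    by (simp only: power_Suc times_divide_eq_right)
  also have "\<dots> = (real n + 1 / 2) * central_prob n" unfolding c by (simp add: field_simps)
  also have "\<dots> = (-1) ^ n * ((real n + 1 / 2) * ((-1/2) gchoose n))" unfolding Suc by simp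
  also have "(real n + 1 / 2) * ((-1/2) gchoose n) = - (real (Suc n) * ((-1/2) gchoose Suc n))"
    using gbinomial_mult_1[of "-1/2::real" n] by (simp add: algebra_simps)
  finally have "real (Suc n) * central_prob (Suc n) = real (Suc n) * ((-1) ^ Suc n * ((-1/2) gchoose Suc n))"
    by (simp only: power_Suc) (simp add: algebra_simps)
  then show ?case by (simp only: mult_left_cancel of_nat_eq_0_iff nat.distinct mult_cancel_left) simp
qed simp

text \<open>The limit is 1 / Gamma(1/2), from the asymptotics of \<open>a gchoose n\<close> at a =
  -1/2.\<close>

lemma central_prob_asymp: "(\<lambda>n. central_prob n * sqrt (real n)) \<longlonglongrightarrow> 1 / sqrt pi"
proof -
  have "(\<lambda>n. ((-1/2::real) gchoose n) / ((-1)^n / exp (((-1/2)+1) * of_real (ln (real n)))))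
     \<longlonglongrightarrow> inverse (Gamma (- (-1/2::real)))" by (rule gbinomial_asymptotic)
  also have "inverse (Gamma (- (-1/2::real))) = 1 / sqrt pi"
    by (simp add: Gamma_one_half_real inverse_eq_divide)
  finally have *: "(\<lambda>n. ((-1/2::real) gchoose n) / ((-1)^n / exp (((-1/2)+1) * of_real (ln (real n)))))
     \<longlonglongrightarrow> 1 / sqrt pi" .
  show ?thesis
  proof (rule Lim_transform_eventually[OF *])
    show "\<forall>\<^sub>F n in sequentially. ((-1/2::real) gchoose n) / ((-1)^n / exp (((-1/2)+1) * of_real (ln (real n)))) =
      central_prob n * sqrt (real n)"
      using eventually_gt_at_top[of 0]
    proof eventually_elim
      case (elim n)
      have "((-1/2)+1) * ln (real n) = ln (sqrt (real n))" by (simp add: ln_sqrt)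
      then have "exp (((-1/2)+1) * of_real (ln (real n))) = sqrt (real n)" using elim by simp
      then show ?case unfolding central_prob_gbinomial by (simp only:) (cases "even n"; simp)
    qed
  qed
qed

text \<open>Jensen: one more step replaces the distribution by an average of two translates.\<close>

lemma walk_moment_Suc_le: "walk_moment l (Suc n) \<le> walk_moment l n"
proof -
  have conv: "((u + v) / 2) ^ Suc l \<le> (u ^ Suc l + v ^ Suc l) / 2" if "u \<ge> 0" "v \<ge> 0" for u v :: real
  proof -
    have "convex_on {0..} (\<lambda>x::real. x ^ Suc l)"
      using convex_power_odd[of "Suc l"] convex_on_subset[OF convex_power_even[of "Suc l"], of "{0..}"]
      by (cases "even (Suc l)") (simp_all del: power_Suc)
    from convex_onD[OF this, of "1/2" u v] that show ?thesis by (simp add: field_simps)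
  qed
  have "walk_moment l (Suc n) = (\<Sum>x\<in>{- int n - 1..int n + 1}. walk_prob (Suc n) x ^ Suc l)"
    by (rule sum_walk_prob_power [symmetric]) auto
  also have "\<dots> \<le> (\<Sum>x\<in>{- int n - 1..int n + 1}. (walk_prob n (x - 1) ^ Suc l + walk_prob n (x + 1) ^ Suc l) / 2)"
    unfolding walk_prob.simps by (intro sum_mono conv walk_prob_nonneg)
  also have "\<dots> = ((\<Sum>x\<in>{- int n - 1..int n + 1}. walk_prob n (x - 1) ^ Suc l)
       + (\<Sum>x\<in>{- int n - 1..int n + 1}. walk_prob n (x + 1) ^ Suc l)) / 2"
    by (simp add: sum.distrib flip: sum_divide_distrib)
  also have "(\<Sum>x\<in>{- int n - 1..int n + 1}. walk_prob n (x - 1) ^ Suc l) = (\<Sum>x\<in>{- int n - 2..int n}. walk_prob n x ^ Suc l)"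
    by (rule sum.reindex_bij_witness[of _ "\<lambda>x. x + 1" "\<lambda>x. x - 1"]) auto
  also have "(\<Sum>x\<in>{- int n - 1..int n + 1}. walk_prob n (x + 1) ^ Suc l) = (\<Sum>x\<in>{- int n..int n + 2}. walk_prob n x ^ Suc l)"
    by (rule sum.reindex_bij_witness[of _ "\<lambda>x. x - 1" "\<lambda>x. x + 1"]) auto
  also have "(\<Sum>x\<in>{- int n - 2..int n}. walk_prob n x ^ Suc l) = walk_moment l n"
    by (rule sum_walk_prob_power) auto
  also have "(\<Sum>x\<in>{- int n..int n + 2}. walk_prob n x ^ Suc l) = walk_moment l n"
    by (rule sum_walk_prob_power) auto
  finally show ?thesis by simp
qed

lemma walk_moment_antimono: "m \<le> n \<Longrightarrow> walk_moment l n \<le> walk_moment l m"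
  by (induction rule: dec_induct) (auto intro: order_trans walk_moment_Suc_le)

text \<open>At even times the central binomial coefficient is the largest; at odd times the law
  averages two values from the preceding even time, hence the rounding down.\<close>

lemma binomial_prob_le_central: "real (n choose k) / 2 ^ n \<le> central_prob (n div 2)"
proof -
  have "walk_prob n x \<le> central_prob (n div 2)" for x
  proof -
    have even: "walk_prob (2 * m) x \<le> central_prob m" for m x
    proof (cases "even x \<and> \<bar>x\<bar> \<le> 2 * int m")
      case True
      then have "x = 2 * int (nat (int m + x div 2)) - int (2 * m)" by auto
      then have "walk_prob (2 * m) x = real (2 * m choose nat (int m + x div 2)) / 2 ^ (2 * m)"
        by (metis walk_prob_binomial)
      also have "\<dots> \<le> real (2 * m choose m) / 2 ^ (2 * m)"
        by (intro divide_right_mono) (auto simp: binomial_maximum')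
      finally show ?thesis by (simp add: power_mult)
    next
      case False
      then have "walk_prob (2 * m) x = 0" using walk_prob_eq_0 walk_prob_odd by force
      then show ?thesis by simp
    qed
    show ?thesis
    proof (cases "even n")
      case True
      then show ?thesis using even[of "n div 2" x] by simp
    next
      case False
      then have "n = Suc (2 * (n div 2))" by simp
      then have "walk_prob n x = (walk_prob (2 * (n div 2)) (x - 1) + walk_prob (2 * (n div 2)) (x + 1)) / 2"
        by (metis walk_prob.simps(2))
      then show ?thesis using even[of "n div 2" "x - 1"] even[of "n div 2" "x + 1"] by simp
    qed
  qed
  then show ?thesis unfolding walk_prob_binomial [symmetric] .
qed

lemma binomial_prob_bound: "\<exists>C>0. \<forall>n>0. \<forall>k. real (n choose k) / 2 ^ n \<le> C / sqrt (real n)"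
proof -
  have "Bseq (\<lambda>n. central_prob n * sqrt (real n))"
    using central_prob_asymp convergent_imp_Bseq convergentI by blast
  then obtain C where C: "C > 0" "\<And>n. \<bar>central_prob n * sqrt (real n)\<bar> \<le> C"
    unfolding Bseq_def by auto
  \<comment> \<open>The 2 comes from \<open>n \<le> 4 * (n div 2)\<close> for n at least 2; the
    added 1 covers n = 1, where \<open>n div 2 = 0\<close>.\<close>
  have "real (n choose k) / 2 ^ n \<le> (2 * C + 1) / sqrt (real n)" if "n > 0" for n k
  proof (cases "n = 1")
    case True
    have "real (n choose k) \<le> 1" using True binomial_maximum[of 1 k] by simp
    then show ?thesis using True C by auto
  next
    case False
    with that have n: "n \<ge> 2" by simp
    have "central_prob (n div 2) * sqrt (real (n div 2)) \<le> C" using C(2)[of "n div 2"] by linarith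
    then have "central_prob (n div 2) \<le> C / sqrt (real (n div 2))" using n by (simp add: field_simps)
    also have "\<dots> \<le> C / (sqrt (real n) / 2)"
    proof (rule divide_left_mono)
      have "real n \<le> 4 * real (n div 2)" using n by linarith
      then have "sqrt (real n) \<le> sqrt 4 * sqrt (real (n div 2))"
        by (metis real_sqrt_le_mono real_sqrt_mult)
      then show "sqrt (real n) / 2 \<le> sqrt (real (n div 2))" by simp
    qed (use C n in auto)
    also have "\<dots> \<le> (2 * C + 1) / sqrt (real n)" using n by (simp add: divide_right_mono)
    finally show ?thesis using binomial_prob_le_central[of n k] by linarith
  qed
  with C show ?thesis by (intro exI[of _ "2 * C + 1"]) auto
qed

text \<open>One of the \<open>Suc l\<close> factors is kept as probability mass of total 1, the
  other l are bounded by their supremum. The same C serves every l.\<close>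

lemma walk_moment_bound: "\<exists>C>0. \<forall>l. \<forall>n>0. walk_moment l n \<le> (C / sqrt (real n)) ^ l"
proof -
  obtain C where C: "C > 0" "\<And>n k. n > 0 \<Longrightarrow> real (n choose k) / 2 ^ n \<le> C / sqrt (real n)"
    using binomial_prob_bound by blast
  have "walk_moment l n \<le> (C / sqrt (real n)) ^ l" if "n > 0" for l n
  proof -
    have "walk_moment l n \<le> (\<Sum>k\<le>n. real (n choose k) / 2 ^ n * (C / sqrt (real n)) ^ l)"
      unfolding walk_moment_def power_Suc
      using C that by (intro sum_mono mult_left_mono power_mono) auto
    also have "\<dots> = (C / sqrt (real n)) ^ l * walk_moment 0 n"
      by (simp add: walk_moment_def sum_distrib_left mult.commute)
    finally show ?thesis by (simp add: walk_moment_0)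
  qed
  with C show ?thesis by blast
qed

section \<open>Gaussian limit of central binomial ratios\<close>

lemma sum_atMost_symmetric:
  fixes g :: "nat \<Rightarrow> real"
  assumes "\<And>k. k \<le> m \<Longrightarrow> g (m - k) = g (m + k)"
  shows "(\<Sum>j\<le>2 * m. g j) = 2 * (\<Sum>k\<le>m. g (m + k)) - g m"
proof -
  have "(\<Sum>j\<le>m. g j) = (\<Sum>k\<le>m. g (m - k))"
    by (rule sum.reindex_bij_witness[of _ "\<lambda>k. m - k" "\<lambda>k. m - k"]) auto
  also have "\<dots> = (\<Sum>k\<le>m. g (m + k))" using assms by simp
  finally have 1: "(\<Sum>j\<le>m. g j) = (\<Sum>k\<le>m. g (m + k))" .
  have 2: "(\<Sum>k\<le>m. g (m + k)) = (\<Sum>j\<in>{m..2 * m}. g j)"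
    by (rule sum.reindex_bij_witness[of _ "\<lambda>j. j - m" "\<lambda>k. m + k"]) auto
  have "(\<Sum>j\<le>2 * m. g j) + g m = (\<Sum>j\<le>m. g j) + (\<Sum>j\<in>{m..2 * m}. g j)"
  proof -
    have "{m..2 * m} = insert m {Suc m..2 * m}" "{..2 * m} = {..m} \<union> {Suc m..2 * m}"
      "{..m} \<inter> {Suc m..2 * m} = {}" by auto
    then show ?thesis by (simp add: sum.union_disjoint)
  qed
  with 1 2 show ?thesis by simp
qed

text \<open>The law at time 2m normalised to 1 at the centre, so that its Gaussian limit carries no
  prefactor. It vanishes for k > m.\<close>

definition central_ratio :: "nat \<Rightarrow> nat \<Rightarrow> real" where
  "central_ratio m k = real ((2 * m) choose (m + k)) / real ((2 * m) choose m)"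

lemma central_ratio_nonneg: "0 \<le> central_ratio m k"
  by (simp add: central_ratio_def)

lemma central_ratio_0: "central_ratio m 0 = 1"
  by (simp add: central_ratio_def)

lemma central_ratio_Suc:
  "real (m + k + 1) * central_ratio m (Suc k) = (real m - real k) * central_ratio m k"
proof (cases "k \<le> m")
  case True
  have "Suc (m + k) * ((2 * m) choose Suc (m + k)) = (2 * m - (m + k)) * ((2 * m) choose (m + k))"
    using binomial_absorb_comp[of "2 * m" "m + k"] binomial_absorption[of "m + k" "2 * m"] by simp
  then have "real (Suc (m + k) * ((2 * m) choose Suc (m + k))) = real ((m - k) * ((2 * m) choose (m + k)))"
    using True by (simp only:) simp
  then show ?thesis using True
    by (simp add: central_ratio_def of_nat_diff field_simps)
qed (simp add: central_ratio_def binomial_eq_0)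

text \<open>The quotient of neighbours is \<open>1 - (2 * k + 1) / (m + k + 1)\<close>, and the odd
  numbers below 2k sum to k squared. The bound K freezes the denominator during the induction: K = k
  gives the limit, K = m a domination uniform in k.\<close>

lemma central_ratio_le_exp:
  assumes "k \<le> K" "K \<le> m" "m > 0"
  shows "central_ratio m k \<le> exp (- (real k)\<^sup>2 / real (m + K))"
  using assms(1)
proof (induction k)
  case (Suc k)
  have "central_ratio m (Suc k) = (real m - real k) / real (m + k + 1) * central_ratio m k"
    using central_ratio_Suc[of m k] by (simp add: field_simps)
  also have "(real m - real k) / real (m + k + 1) = 1 + - (2 * real k + 1) / real (m + k + 1)"
    by (simp add: field_simps)
  also have "\<dots> \<le> exp (- (2 * real k + 1) / real (m + k + 1))" by (rule exp_ge_add_one_self)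
  also have "\<dots> \<le> exp (- (2 * real k + 1) / real (m + K))"
  proof -
    have "(2 * real k + 1) / real (m + K) \<le> (2 * real k + 1) / real (m + k + 1)"
      using Suc.prems assms by (intro divide_left_mono) auto
    then show ?thesis by (simp only: minus_divide_left [symmetric] neg_le_iff_le exp_le_cancel_iff)
  qed
  also have "exp (- (2 * real k + 1) / real (m + K)) * central_ratio m k
     \<le> exp (- (2 * real k + 1) / real (m + K)) * exp (- (real k)\<^sup>2 / real (m + K))"
    using Suc by simp
  also have "\<dots> = exp (- (real (Suc k))\<^sup>2 / real (m + K))"
    unfolding exp_add [symmetric] add_divide_distrib [symmetric]
    by (simp add: power2_eq_square algebra_simps)
  finally show ?case by (simp add: central_ratio_nonneg mult_right_mono)
qed (simp add: central_ratio_0)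

text \<open>Now \<open>exp u \<ge> 1 + u\<close> is applied to the reciprocal quotient
  \<open>1 + (2 * k + 1) / (m - k)\<close>. A step from k to k + 1 has k < K, so m - k is at least m
  - K + 1, which stays positive even for K = m.\<close>

lemma central_ratio_ge_exp:
  assumes "k \<le> K" "K \<le> m" "m > 0"
  shows "exp (- (real k)\<^sup>2 / (real m - real K + 1)) \<le> central_ratio m k"
  using assms(1)
proof (induction k)
  case (Suc k)
  have km: "real k < real m" using Suc.prems assms by simp
  have "1 / exp ((2 * real k + 1) / (real m - real K + 1)) \<le> 1 / exp ((2 * real k + 1) / (real m - real k))"
    using Suc.prems assms by (auto intro!: divide_left_mono)
  also have "\<dots> \<le> 1 / (1 + (2 * real k + 1) / (real m - real k))"
    using km by (intro divide_left_mono exp_ge_add_one_self) (auto intro!: mult_pos_pos add_pos_nonneg)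
  also have "\<dots> = (real m - real k) / real (m + k + 1)"
    using km by (simp add: field_simps)
  finally have *: "exp (- (2 * real k + 1) / (real m - real K + 1)) \<le> (real m - real k) / real (m + k + 1)"
    by (simp only: minus_divide_left [symmetric] exp_minus inverse_eq_divide)
  have "exp (- (real (Suc k))\<^sup>2 / (real m - real K + 1))
     = exp (- (2 * real k + 1) / (real m - real K + 1)) * exp (- (real k)\<^sup>2 / (real m - real K + 1))"
    unfolding exp_add [symmetric] add_divide_distrib [symmetric]
    by (simp add: power2_eq_square algebra_simps)
  also have "\<dots> \<le> (real m - real k) / real (m + k + 1) * central_ratio m k"
    using * Suc km by (intro mult_mono) auto
  also have "\<dots> = central_ratio m (Suc k)"
    using central_ratio_Suc[of m k] by (simp add: field_simps)
  finally show ?case .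
qed (simp add: central_ratio_0)

lemma walk_moment_even:
  "walk_moment l (2 * m) = central_prob m ^ Suc l * (2 * (\<Sum>k\<le>m. central_ratio m k ^ Suc l) - 1)"
proof -
  have g: "real ((2 * m) choose (m + k)) / 2 ^ (2 * m) = central_prob m * central_ratio m k" for k
    by (simp add: central_ratio_def power_mult)
  have "walk_moment l (2 * m) = 2 * (\<Sum>k\<le>m. (real ((2 * m) choose (m + k)) / 2 ^ (2 * m)) ^ Suc l)
      - (real ((2 * m) choose m) / 2 ^ (2 * m)) ^ Suc l"
    unfolding walk_moment_def
  proof (rule sum_atMost_symmetric)
    fix k assume "k \<le> m"
    then show "(real (2 * m choose (m - k)) / 2 ^ (2 * m)) ^ Suc l =
         (real (2 * m choose (m + k)) / 2 ^ (2 * m)) ^ Suc l"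
      using binomial_symmetric[of "m + k" "2 * m"] by simp
  qed
  also have "(real ((2 * m) choose m) / 2 ^ (2 * m)) ^ Suc l = central_prob m ^ Suc l"
    by (simp add: power_mult)
  also have "(\<Sum>k\<le>m. (real ((2 * m) choose (m + k)) / 2 ^ (2 * m)) ^ Suc l)
      = central_prob m ^ Suc l * (\<Sum>k\<le>m. central_ratio m k ^ Suc l)"
    unfolding g power_mult_distrib sum_distrib_left ..
  finally show ?thesis by (simp only: right_diff_distrib mult_1_right mult.left_commute)
qed

text \<open>Riemann sums, written as integrals of step functions so that dominated convergence applies.\<close>

definition ratio_step :: "nat \<Rightarrow> nat \<Rightarrow> real \<Rightarrow> real" where
  "ratio_step L m t = (\<Sum>k\<le>m. central_ratio m k ^ L * indicator {real k / sqrt m..<real (Suc k) / sqrt m} t)"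

lemma integral_ratio_step:
  assumes "m > 0"
  shows "integral\<^sup>L lborel (ratio_step L m) = (\<Sum>k\<le>m. central_ratio m k ^ L) / sqrt m"
proof -
  have "integral\<^sup>L lborel (ratio_step L m) =
     (\<Sum>k\<le>m. integral\<^sup>L lborel (\<lambda>t. central_ratio m k ^ L * indicator {real k / sqrt m..<real (Suc k) / sqrt m} t))"
    unfolding ratio_step_def
    by (rule Bochner_Integration.integral_sum) (auto intro!: integrable_mult_right simp: divide_right_mono)
  also have "\<dots> = (\<Sum>k\<le>m. central_ratio m k ^ L * (1 / sqrt m))"
    using assms by (intro sum.cong) (auto simp: divide_right_mono diff_divide_distrib [symmetric])
  finally show ?thesis by (simp add: sum_divide_distrib)
qed

text \<open>The intervals are disjoint and t lies in the one with index floor(t sqrt m). As L > 0,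
  indices beyond m contribute 0 on their own, so no cut-off is visible.\<close>

lemma ratio_step_eq:
  assumes "m > 0" "L > 0"
  shows "ratio_step L m t = (if t < 0 then 0 else central_ratio m (nat \<lfloor>t * sqrt m\<rfloor>) ^ L)"
proof -
  have iff: "t \<in> {real k / sqrt m..<real (Suc k) / sqrt m} \<longleftrightarrow> 0 \<le> t \<and> k = nat \<lfloor>t * sqrt m\<rfloor>" for k
  proof -
    have "t \<in> {real k / sqrt m..<real (Suc k) / sqrt m} \<longleftrightarrow> real k \<le> t * sqrt m \<and> t * sqrt m < real k + 1"
      using assms by (simp add: field_simps)
    also have "\<dots> \<longleftrightarrow> \<lfloor>t * sqrt m\<rfloor> = int k" by (simp add: floor_eq_iff)
    also have "\<dots> \<longleftrightarrow> 0 \<le> t \<and> k = nat \<lfloor>t * sqrt m\<rfloor>"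
    proof -
      have "0 \<le> \<lfloor>t * sqrt m\<rfloor> \<longleftrightarrow> 0 \<le> t" using assms by (simp add: zero_le_mult_iff)
      then show ?thesis by linarith
    qed
    finally show ?thesis .
  qed
  have "ratio_step L m t = (\<Sum>k\<le>m. if k = nat \<lfloor>t * sqrt m\<rfloor> then (if t < 0 then 0 else central_ratio m k ^ L) else 0)"
    unfolding ratio_step_def by (intro sum.cong refl, simp only: indicator_def iff) auto
  also have "\<dots> = (if nat \<lfloor>t * sqrt m\<rfloor> \<le> m then (if t < 0 then 0 else central_ratio m (nat \<lfloor>t * sqrt m\<rfloor>) ^ L) else 0)"
    by (subst sum.delta) auto
  also have "\<dots> = (if t < 0 then 0 else central_ratio m (nat \<lfloor>t * sqrt m\<rfloor>) ^ L)"
    using assms by (auto simp: central_ratio_def)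
  finally show ?thesis .
qed

text \<open>Both exponential bounds are used with K = k. Since k is about t sqrt m, k squared over m
  tends to t squared and k / m to 0.\<close>

lemma central_ratio_tendsto:
  assumes "t \<ge> 0"
  shows "(\<lambda>m. central_ratio m (nat \<lfloor>t * sqrt (real m)\<rfloor>)) \<longlonglongrightarrow> exp (- t\<^sup>2)"
proof -
  define k where "k m = nat \<lfloor>t * sqrt (real m)\<rfloor>" for m :: nat
  have k: "real (k m) = of_int \<lfloor>t * sqrt (real m)\<rfloor>" for m
    using assms by (simp add: k_def)
  have k1: "(\<lambda>m. real (k m) / sqrt (real m)) \<longlonglongrightarrow> t"
    unfolding k by real_asymp
  have k2: "(\<lambda>m. real (k m) / real m) \<longlonglongrightarrow> 0"
    unfolding k by real_asymp
  have up: "(\<lambda>m. exp (- ((real (k m) / sqrt (real m))\<^sup>2 / (1 + real (k m) / real m)))) \<longlonglongrightarrow> exp (- (t\<^sup>2 / (1 + 0)))"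
    by (intro tendsto_intros k1 k2) auto
  have lo: "(\<lambda>m. exp (- ((real (k m) / sqrt (real m))\<^sup>2 / (1 - real (k m) / real m + 1 / real m)))) \<longlonglongrightarrow> exp (- (t\<^sup>2 / (1 - 0 + 0)))"
    by (intro tendsto_intros k1 k2 lim_1_over_n) auto
  have ev: "\<forall>\<^sub>F m in sequentially. 0 < m \<and> k m \<le> m"
  proof -
    have "\<forall>\<^sub>F m in sequentially. real (k m) / real m < 1" using k2 by (rule order_tendstoD) auto
    with eventually_gt_at_top[of 0] show ?thesis by eventually_elim (simp add: field_simps)
  qed
  have "(\<lambda>m. central_ratio m (k m)) \<longlonglongrightarrow> exp (- t\<^sup>2)"
  proof (rule tendsto_sandwich)
    show "\<forall>\<^sub>F m in sequentially. central_ratio m (k m) \<le> exp (- ((real (k m) / sqrt (real m))\<^sup>2 / (1 + real (k m) / real m)))"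
      using ev
    proof eventually_elim
      case (elim m)
      then have "(real (k m) / sqrt (real m))\<^sup>2 / (1 + real (k m) / real m) = (real (k m))\<^sup>2 / real (m + k m)"
        by (simp add: power_divide field_simps)
      with central_ratio_le_exp[of "k m" "k m" m] elim show ?case by simp
    qed
    show "\<forall>\<^sub>F m in sequentially. exp (- ((real (k m) / sqrt (real m))\<^sup>2 / (1 - real (k m) / real m + 1 / real m))) \<le> central_ratio m (k m)"
      using ev
    proof eventually_elim
      case (elim m)
      then have "(real (k m) / sqrt (real m))\<^sup>2 / (1 - real (k m) / real m + 1 / real m) = (real (k m))\<^sup>2 / (real m - real (k m) + 1)"
        by (simp add: power_divide field_simps)
      with central_ratio_ge_exp[of "k m" "k m" m] elim show ?case by simp
    qed
  qed (use up lo in simp_all)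
  then show ?thesis by (simp add: k_def)
qed

text \<open>The dominating function is \<open>exp (1 - (t - 1)\<^sup>2 / 2)\<close>, written with a
  normal density to have its integrability at hand. Rounding costs at most 1: k is at least (t - 1)
  sqrt m. For t up to 1 the factor \<open>exp 1\<close> lifts the bound above 1. The 1/2 in the
  exponent comes from choosing K = m.\<close>

lemma ratio_step_le:
  assumes "m > 0" "L > 0"
  shows "\<bar>ratio_step L m t\<bar> \<le> exp 1 * sqrt (2 * pi) * normal_density 1 1 t"
proof -
  have nd: "exp 1 * sqrt (2 * pi) * normal_density 1 1 t = exp (1 - (t - 1)\<^sup>2 / 2)"
    by (simp add: normal_density_def mult_exp_exp)
  define k where "k = nat \<lfloor>t * sqrt m\<rfloor>"
  show ?thesis
  proof (cases "t < 0 \<or> k > m")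
    case True
    then have "ratio_step L m t = 0" using assms by (auto simp: ratio_step_eq k_def central_ratio_def)
    then show ?thesis by (simp add: nd)
  next
    case False
    then have t: "t \<ge> 0" and km: "k \<le> m" by auto
    have r: "central_ratio m k \<le> exp (- (real k)\<^sup>2 / real (m + m))"
      using assms km by (intro central_ratio_le_exp) auto
    also have le1: "\<dots> \<le> 1" by simp
    finally have "central_ratio m k ^ L \<le> central_ratio m k ^ 1"
      using assms by (intro power_decreasing central_ratio_nonneg) auto
    with r have "central_ratio m k ^ L \<le> exp (- (real k)\<^sup>2 / real (m + m))" by simp
    also have "\<dots> \<le> exp (1 - (t - 1)\<^sup>2 / 2)"
    proof (cases "t \<le> 1")
      case True
      then have "(t - 1)\<^sup>2 \<le> 1" using t by (auto simp: power2_le_iff_abs_le abs_square_le_1)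
      moreover have "0 \<le> (real k)\<^sup>2 / real (m + m)" by simp
      ultimately have "- (real k)\<^sup>2 / real (m + m) \<le> 1 - (t - 1)\<^sup>2 / 2"
        unfolding minus_divide_left [symmetric] by linarith
      then show ?thesis by (simp only: exp_le_cancel_iff)
    next
      case False
      have "t * sqrt m - 1 \<le> real k" unfolding k_def by linarith
      moreover have "1 \<le> sqrt m" using assms by simp
      ultimately have "(t - 1) * sqrt m \<le> real k" unfolding left_diff_distrib by linarith
      then have "((t - 1) * sqrt m)\<^sup>2 \<le> (real k)\<^sup>2" using False by (intro power_mono) auto
      then have "(t - 1)\<^sup>2 * real m \<le> (real k)\<^sup>2" by (simp add: power_mult_distrib)
      then have "(t - 1)\<^sup>2 / 2 \<le> (real k)\<^sup>2 / real (m + m)" using assms by (simp add: field_simps)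
      then show ?thesis by simp
    qed
    finally show ?thesis using t assms by (simp add: ratio_step_eq nd k_def central_ratio_nonneg)
  qed
qed

text \<open>Substituting x = sqrt L * t reduces this to the standard Gaussian half-line
  integral.\<close>

lemma integral_gaussian_half_line:
  assumes "L > 0"
  shows "integral\<^sup>L lborel (\<lambda>t::real. indicator {0..} t * exp (- (t\<^sup>2)) ^ L) = sqrt (pi / real L) / 2"
proof -
  have "integral\<^sup>L lborel (\<lambda>x::real. indicator {0..} x * exp (- x\<^sup>2)) = sqrt pi / 2"
    using gaussian_moment_0 by (simp add: has_bochner_integral_iff)
  moreover have "integral\<^sup>L lborel (\<lambda>x::real. indicator {0..} x * exp (- x\<^sup>2)) =
      sqrt L * integral\<^sup>L lborel (\<lambda>t. indicator {0..} (0 + sqrt L * t) * exp (- (0 + sqrt L * t)\<^sup>2))"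
    using assms lborel_integral_real_affine[of "sqrt L" "\<lambda>x. indicator {0..} x * exp (- x\<^sup>2)" 0] by simp
  moreover have "indicator {0..} (0 + sqrt L * t) * exp (- (0 + sqrt L * t)\<^sup>2) = indicator {0..} t * exp (- (t\<^sup>2)) ^ L" for t :: real
    using assms by (simp add: indicator_def zero_le_mult_iff power_mult_distrib flip: exp_of_nat_mult)
  ultimately have "sqrt L * integral\<^sup>L lborel (\<lambda>t::real. indicator {0..} t * exp (- (t\<^sup>2)) ^ L) = sqrt pi / 2"
    by simp
  then show ?thesis using assms by (simp add: real_sqrt_divide field_simps)
qed

lemma sum_central_ratio_asymp:
  assumes "L > 0"
  shows "(\<lambda>m. (\<Sum>k\<le>m. central_ratio m k ^ L) / sqrt (real m)) \<longlonglongrightarrow> sqrt (pi / real L) / 2"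
proof -
  \<comment> \<open>The index is shifted to \<open>Suc m\<close> because the facts on
    \<open>ratio_step\<close> need a positive m.\<close>
  have "(\<lambda>m. integral\<^sup>L lborel (ratio_step L (Suc m))) \<longlonglongrightarrow> integral\<^sup>L lborel (\<lambda>t::real. indicator {0..} t * exp (- (t\<^sup>2)) ^ L)"
  proof (rule integral_dominated_convergence[where w = "\<lambda>t. exp 1 * sqrt (2 * pi) * normal_density 1 1 t"])
    show "(\<lambda>t::real. indicator {0..} t * exp (- (t\<^sup>2)) ^ L) \<in> borel_measurable lborel" by measurable
    show "ratio_step L (Suc m) \<in> borel_measurable lborel" for m
      unfolding ratio_step_def by measurable
    show "integrable lborel (\<lambda>t. exp 1 * sqrt (2 * pi) * normal_density 1 1 t)"
      by (intro integrable_mult_right integrable_normal_density) auto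
    show "AE t in lborel. (\<lambda>m. ratio_step L (Suc m) t) \<longlonglongrightarrow> indicator {0..} t * exp (- (t\<^sup>2)) ^ L"
    proof (intro AE_I2)
      fix t :: real
      show "(\<lambda>m. ratio_step L (Suc m) t) \<longlonglongrightarrow> indicator {0..} t * exp (- (t\<^sup>2)) ^ L"
      proof (cases "t < 0")
        case False
        have "(\<lambda>m. central_ratio (Suc m) (nat \<lfloor>t * sqrt (real (Suc m))\<rfloor>)) \<longlonglongrightarrow> exp (- t\<^sup>2)"
          using central_ratio_tendsto[of t] False by (subst filterlim_sequentially_Suc) auto
        then have "(\<lambda>m. central_ratio (Suc m) (nat \<lfloor>t * sqrt (real (Suc m))\<rfloor>) ^ L) \<longlonglongrightarrow> exp (- t\<^sup>2) ^ L"
          by (rule tendsto_power)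
        then show ?thesis using False assms by (simp add: ratio_step_eq)
      qed (use assms in \<open>simp add: ratio_step_eq\<close>)
    qed
    show "AE t in lborel. norm (ratio_step L (Suc m) t) \<le> exp 1 * sqrt (2 * pi) * normal_density 1 1 t" for m
      unfolding real_norm_def by (intro AE_I2 ratio_step_le) (use assms in auto)
  qed
  then have "(\<lambda>m. (\<Sum>k\<le>Suc m. central_ratio (Suc m) k ^ L) / sqrt (real (Suc m))) \<longlonglongrightarrow> sqrt (pi / real L) / 2"
    using assms by (simp only: integral_gaussian_half_line integral_ratio_step zero_less_Suc)
  then show ?thesis
    using filterlim_sequentially_Suc[of "\<lambda>m. (\<Sum>k\<le>m. central_ratio m k ^ L) / sqrt (real m)"] by simp
qed

text \<open>Each of the l + 1 central probabilities decays like 1 / sqrt(pi m), while the sum of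
  ratios grows like sqrt m; what remains has order m to the power -l/2. The correction -1 for the
  doubly counted centre vanishes in the limit.\<close>

lemma walk_moment_even_asymp:
  "(\<lambda>m. walk_moment l (2 * m) * sqrt (real m) ^ l) \<longlonglongrightarrow> (1 / sqrt pi) ^ Suc l * sqrt (pi / real (Suc l))"
proof -
  have "(\<lambda>m. (central_prob m * sqrt (real m)) ^ Suc l *
      (2 * ((\<Sum>k\<le>m. central_ratio m k ^ Suc l) / sqrt (real m)) - 1 / sqrt (real m)))
     \<longlonglongrightarrow> (1 / sqrt pi) ^ Suc l * (2 * (sqrt (pi / real (Suc l)) / 2) - 0)"
    by (intro tendsto_intros central_prob_asymp sum_central_ratio_asymp) (simp, real_asymp)
  then have *: "(\<lambda>m. (central_prob m * sqrt (real m)) ^ Suc l *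
      (2 * ((\<Sum>k\<le>m. central_ratio m k ^ Suc l) / sqrt (real m)) - 1 / sqrt (real m)))
     \<longlonglongrightarrow> (1 / sqrt pi) ^ Suc l * sqrt (pi / real (Suc l))" by simp
  show ?thesis
  proof (rule Lim_transform_eventually[OF *])
    show "\<forall>\<^sub>F m in sequentially. (central_prob m * sqrt (real m)) ^ Suc l *
      (2 * ((\<Sum>k\<le>m. central_ratio m k ^ Suc l) / sqrt (real m)) - 1 / sqrt (real m)) =
      walk_moment l (2 * m) * sqrt (real m) ^ l"
      using eventually_gt_at_top[of 0]
    proof eventually_elim
      case (elim m)
      define A where "A = central_prob m ^ Suc l"
      define B where "B = (\<Sum>k\<le>m. central_ratio m k ^ Suc l)"
      have "(central_prob m * sqrt (real m)) ^ Suc l * (2 * (B / sqrt (real m)) - 1 / sqrt (real m))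
        = A * (2 * B - 1) * sqrt (real m) ^ l"
        using elim by (simp add: A_def power_mult_distrib field_simps)
      then show ?case unfolding walk_moment_even A_def B_def .
    qed
  qed
qed

text \<open>Monotonicity squeezes general n between the even times obtained by rounding down and up.
  The factor 2 is the limit of n / (n div 2).\<close>

lemma walk_moment_2_asymp: "(\<lambda>n. walk_moment 2 n * real n) \<longlonglongrightarrow> 2 / (pi * sqrt 3)"
proof -
  have lim: "(\<lambda>m. walk_moment 2 (2 * m) * real m) \<longlonglongrightarrow> 1 / (pi * sqrt 3)"
  proof -
    have "(1 / sqrt pi) ^ Suc 2 * sqrt (pi / real (Suc 2)) = 1 / (pi * sqrt 3)"
      by (simp add: real_sqrt_divide power2_eq_square numeral_3_eq_3 numeral_2_eq_2)
    then show ?thesis using walk_moment_even_asymp[of 2] by simp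
  qed
  have up: "(\<lambda>n. walk_moment 2 (2 * (n div 2)) * real (n div 2) * (real n / real (n div 2))) \<longlonglongrightarrow> 1 / (pi * sqrt 3) * 2"
  proof (rule tendsto_mult)
    have "filterlim (\<lambda>n::nat. n div 2) at_top at_top" by real_asymp
    from filterlim_compose[OF lim this]
    show "(\<lambda>n. walk_moment 2 (2 * (n div 2)) * real (n div 2)) \<longlonglongrightarrow> 1 / (pi * sqrt 3)" .
    show "(\<lambda>n. real n / real (n div 2)) \<longlonglongrightarrow> 2" by real_asymp
  qed
  have lo: "(\<lambda>n. walk_moment 2 (2 * ((n + 1) div 2)) * real ((n + 1) div 2) * (real n / real ((n + 1) div 2))) \<longlonglongrightarrow> 1 / (pi * sqrt 3) * 2"
  proof (rule tendsto_mult)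
    have "filterlim (\<lambda>n::nat. (n + 1) div 2) at_top at_top" by real_asymp
    from filterlim_compose[OF lim this]
    show "(\<lambda>n. walk_moment 2 (2 * ((n + 1) div 2)) * real ((n + 1) div 2)) \<longlonglongrightarrow> 1 / (pi * sqrt 3)" .
    show "(\<lambda>n. real n / real ((n + 1) div 2)) \<longlonglongrightarrow> 2" by real_asymp
  qed
  have "(\<lambda>n. walk_moment 2 n * real n) \<longlonglongrightarrow> 1 / (pi * sqrt 3) * 2"
  proof (rule tendsto_sandwich[OF _ _ lo up])
    show "\<forall>\<^sub>F n in sequentially. walk_moment 2 n * real n \<le> walk_moment 2 (2 * (n div 2)) * real (n div 2) * (real n / real (n div 2))"
      using eventually_ge_at_top[of 2]
    proof eventually_elim
      case (elim n)
      then have "walk_moment 2 n * real n \<le> walk_moment 2 (2 * (n div 2)) * real n"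
        by (intro mult_right_mono walk_moment_antimono) auto
      moreover have "n div 2 \<noteq> 0" using elim by simp
      ultimately show ?case by simp
    qed
    show "\<forall>\<^sub>F n in sequentially. walk_moment 2 (2 * ((n + 1) div 2)) * real ((n + 1) div 2) * (real n / real ((n + 1) div 2)) \<le> walk_moment 2 n * real n"
      using eventually_ge_at_top[of 2]
    proof eventually_elim
      case (elim n)
      then have "walk_moment 2 (2 * ((n + 1) div 2)) * real n \<le> walk_moment 2 n * real n"
        by (intro mult_right_mono walk_moment_antimono) auto
      with elim show ?case by simp
    qed
  qed
  then show ?thesis by simp
qed

section \<open>Sums over pairs of times\<close>

text \<open>With \<open>d = a - L * b\<close>, increments of d are eventually at most
  \<open>e / 2\<close> times those of b. Telescoping bounds d by \<open>e / 2 * b\<close> plus a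
  constant, which b outgrows.\<close>

lemma stolz_cesaro:
  fixes a b :: "nat \<Rightarrow> real"
  assumes mono: "\<forall>\<^sub>F n in sequentially. b n < b (Suc n)"
    and b: "filterlim b at_top sequentially"
    and lim: "(\<lambda>n. (a (Suc n) - a n) / (b (Suc n) - b n)) \<longlonglongrightarrow> L"
  shows "(\<lambda>n. a n / b n) \<longlonglongrightarrow> L"
proof (rule LIMSEQ_I)
  fix e :: real assume e: "e > 0"
  have "\<forall>\<^sub>F n in sequentially. \<bar>(a (Suc n) - a n) / (b (Suc n) - b n) - L\<bar> < e / 2"
    using tendstoD[OF lim, of "e / 2"] e by (simp add: dist_real_def)
  moreover have "\<forall>\<^sub>F n in sequentially. b n \<ge> 0"
    using b by (simp add: filterlim_at_top)
  ultimately have "\<forall>\<^sub>F n in sequentially. b n < b (Suc n) \<and> b n \<ge> 0 \<and> \<bar>(a (Suc n) - a n) / (b (Suc n) - b n) - L\<bar> < e / 2"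
    using mono by eventually_elim auto
  then obtain n0 where n0: "\<And>n. n \<ge> n0 \<Longrightarrow> b n < b (Suc n)" "\<And>n. n \<ge> n0 \<Longrightarrow> b n \<ge> 0"
      "\<And>n. n \<ge> n0 \<Longrightarrow> \<bar>(a (Suc n) - a n) / (b (Suc n) - b n) - L\<bar> < e / 2"
    unfolding eventually_sequentially by blast
  define d where "d n = a n - L * b n" for n
  have step: "\<bar>d (Suc n) - d n\<bar> \<le> e / 2 * (b (Suc n) - b n)" if "n \<ge> n0" for n
  proof -
    have p: "b (Suc n) - b n > 0" using n0(1)[OF that] by simp
    have "d (Suc n) - d n = ((a (Suc n) - a n) / (b (Suc n) - b n) - L) * (b (Suc n) - b n)"
      using p by (simp add: d_def field_simps)
    then have "\<bar>d (Suc n) - d n\<bar> = \<bar>(a (Suc n) - a n) / (b (Suc n) - b n) - L\<bar> * (b (Suc n) - b n)"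
      using p by (simp add: abs_mult)
    also have "\<dots> \<le> e / 2 * (b (Suc n) - b n)"
      using n0(3)[OF that] p by (intro mult_right_mono) auto
    finally show ?thesis .
  qed
  have bound: "\<bar>d n - d n0\<bar> \<le> e / 2 * (b n - b n0)" if "n \<ge> n0" for n
    using that
  proof (induction rule: dec_induct)
    case (step n)
    have "\<bar>d (Suc n) - d n0\<bar> \<le> e / 2 * (b (Suc n) - b n) + e / 2 * (b n - b n0)"
      using step.IH \<open>\<And>n. n \<ge> n0 \<Longrightarrow> \<bar>d (Suc n) - d n\<bar> \<le> _\<close>[OF step.hyps(1)] by linarith
    also have "\<dots> = e / 2 * (b (Suc n) - b n0)" by (simp flip: distrib_left)
    finally show ?case .
  qed simp
  \<comment> \<open>Beyond this threshold the initial error \<open>\<bar>d n0\<bar>\<close> is below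
    \<open>e / 2 * b n\<close>; the telescoped increments use up the other half of e.\<close>
  have "\<forall>\<^sub>F n in sequentially. b n > 2 * \<bar>d n0\<bar> / e + 1"
    using b by (simp add: filterlim_at_top_dense)
  with eventually_ge_at_top[of n0] have "\<forall>\<^sub>F n in sequentially. norm (a n / b n - L) < e"
  proof eventually_elim
    case (elim n)
    have "2 * \<bar>d n0\<bar> / e \<ge> 0" using e by simp
    then have p: "b n > 0" using elim by linarith
    have "2 * \<bar>d n0\<bar> / e < b n" using elim by linarith
    then have 1: "\<bar>d n0\<bar> < e / 2 * b n" using e by (simp add: field_simps)
    have "e / 2 * (b n - b n0) \<le> e / 2 * b n" using e n0(2)[of n0] by simp
    with bound[of n] 1 elim have "\<bar>d n\<bar> < e * b n" by linarith
    moreover have "a n / b n - L = d n / b n" using p by (simp add: d_def field_simps)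
    ultimately show ?case using p by (simp add: field_simps)
  qed
  then show "\<exists>no. \<forall>n\<ge>no. norm (a n / b n - L) < e" by (simp add: eventually_sequentially)
qed

definition toeplitz_sum :: "(nat \<Rightarrow> real) \<Rightarrow> nat \<Rightarrow> real" where
  "toeplitz_sum a N = (\<Sum>m=1..N. \<Sum>n=1..N. a (nat \<bar>int m - int n\<bar>))"

text \<open>A new time adds a corner, a row and an equal column. Increments of increments are thus
  values of 2a, which is what two rounds of Stolz-Cesaro need.\<close>

lemma toeplitz_sum_Suc:
  "toeplitz_sum a (Suc N) = toeplitz_sum a N + (a 0 + 2 * (\<Sum>j=1..N. a j))"
proof -
  have "(\<Sum>m=1..N. a (Suc N - m)) = (\<Sum>j=1..N. a j)"
    by (rule sum.reindex_bij_witness[of _ "\<lambda>j. Suc N - j" "\<lambda>m. Suc N - m"]) auto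
  moreover have "nat \<bar>int m - int (Suc N)\<bar> = Suc N - m" "nat \<bar>int (Suc N) - int m\<bar> = Suc N - m"
    if "m \<in> {1..N}" for m using that by auto
  ultimately have r: "(\<Sum>m=1..N. a (nat \<bar>int m - int (Suc N)\<bar>)) = (\<Sum>j=1..N. a j)"
    and r': "(\<Sum>m=1..N. a (nat \<bar>int (Suc N) - int m\<bar>)) = (\<Sum>j=1..N. a j)"
    by (metis (mono_tags, lifting) sum.cong)+
  have split: "(\<Sum>m=1..Suc N. f m) = (\<Sum>m=1..N. f m) + f (Suc N)" for f :: "nat \<Rightarrow> real" by simp
  show ?thesis unfolding toeplitz_sum_def split sum.distrib r r' by simp
qed

text \<open>Against sqrt n the increments of D give the limit 4c; against n to the power 3/2, whose
  increments are about 3/2 sqrt n, this becomes 4c * 2/3.\<close>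

lemma toeplitz_sum_powr_asymp:
  assumes "(\<lambda>n. a n * sqrt (real n)) \<longlonglongrightarrow> c"
  shows "(\<lambda>N. toeplitz_sum a N / real N powr (3 / 2)) \<longlonglongrightarrow> 8 / 3 * c"
proof -
  define D where "D N = a 0 + 2 * (\<Sum>j=1..N. a j)" for N
  have D: "(\<lambda>N. D N / sqrt (real N)) \<longlonglongrightarrow> 4 * c"
  proof (rule stolz_cesaro)
    show "\<forall>\<^sub>F n in sequentially. sqrt (real n) < sqrt (real (Suc n))" by simp
    show "filterlim (\<lambda>n. sqrt (real n)) at_top sequentially" by real_asymp
    have "(\<lambda>n. 2 * (a (Suc n) * sqrt (real (Suc n))) * (1 / (sqrt (real (Suc n)) * (sqrt (real (Suc n)) - sqrt (real n))))) \<longlonglongrightarrow> 2 * c * 2"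
      by (intro tendsto_mult tendsto_const filterlim_compose[OF assms filterlim_Suc]) real_asymp
    moreover have "2 * (a (Suc n) * sqrt (real (Suc n))) * (1 / (sqrt (real (Suc n)) * (sqrt (real (Suc n)) - sqrt (real n))))
       = (D (Suc n) - D n) / (sqrt (real (Suc n)) - sqrt (real n))" for n
      by (simp add: D_def divide_simps)
    ultimately show "(\<lambda>n. (D (Suc n) - D n) / (sqrt (real (Suc n)) - sqrt (real n))) \<longlonglongrightarrow> 4 * c"
      by (simp add: mult_ac)
  qed
  show ?thesis
  proof (rule stolz_cesaro)
    show "\<forall>\<^sub>F n in sequentially. real n powr (3 / 2) < real (Suc n) powr (3 / 2)"
      by (intro always_eventually allI powr_less_mono2) auto
    show "filterlim (\<lambda>n. real n powr (3 / 2)) at_top sequentially" by real_asymp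
    have "(\<lambda>n. D n / sqrt (real n) * (sqrt (real n) / (real (Suc n) powr (3 / 2) - real n powr (3 / 2)))) \<longlonglongrightarrow> 4 * c * (2 / 3)"
      by (intro tendsto_mult D) real_asymp
    then have "(\<lambda>n. D n / sqrt (real n) * (sqrt (real n) / (real (Suc n) powr (3 / 2) - real n powr (3 / 2)))) \<longlonglongrightarrow> 8 / 3 * c"
      by (simp add: mult_ac)
    moreover have "\<forall>\<^sub>F n in sequentially. D n / sqrt (real n) * (sqrt (real n) / (real (Suc n) powr (3 / 2) - real n powr (3 / 2)))
      = (toeplitz_sum a (Suc n) - toeplitz_sum a n) / (real (Suc n) powr (3 / 2) - real n powr (3 / 2))"
      using eventually_gt_at_top[of 0] by eventually_elim (simp add: toeplitz_sum_Suc D_def)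
    ultimately show "(\<lambda>n. (toeplitz_sum a (Suc n) - toeplitz_sum a n) / (real (Suc n) powr (3 / 2) - real n powr (3 / 2))) \<longlonglongrightarrow> 8 / 3 * c"
      by (rule Lim_transform_eventually)
  qed
qed

text \<open>The increments of ln n are about 1/n, so D is about 2c ln n; the increments of n ln n
  are about ln n, so the second round leaves the constant unchanged.\<close>

lemma toeplitz_sum_log_asymp:
  assumes "(\<lambda>n. a n * real n) \<longlonglongrightarrow> c"
  shows "(\<lambda>N. toeplitz_sum a N / (real N * ln (real N))) \<longlonglongrightarrow> 2 * c"
proof -
  define D where "D N = a 0 + 2 * (\<Sum>j=1..N. a j)" for N
  have D: "(\<lambda>N. D N / ln (real N)) \<longlonglongrightarrow> 2 * c"
  proof (rule stolz_cesaro)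
    show "\<forall>\<^sub>F n in sequentially. ln (real n) < ln (real (Suc n))"
      using eventually_gt_at_top[of 0] by eventually_elim simp
    show "filterlim (\<lambda>n. ln (real n)) at_top sequentially" by real_asymp
    have "(\<lambda>n. 2 * (a (Suc n) * real (Suc n)) * (1 / (real (Suc n) * (ln (real (Suc n)) - ln (real n))))) \<longlonglongrightarrow> 2 * c * 1"
      by (intro tendsto_mult tendsto_const filterlim_compose[OF assms filterlim_Suc]) real_asymp
    moreover have "2 * (a (Suc n) * real (Suc n)) * (1 / (real (Suc n) * (ln (real (Suc n)) - ln (real n))))
       = (D (Suc n) - D n) / (ln (real (Suc n)) - ln (real n))" for n
      by (simp add: D_def divide_simps)
    ultimately show "(\<lambda>n. (D (Suc n) - D n) / (ln (real (Suc n)) - ln (real n))) \<longlonglongrightarrow> 2 * c"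
      by (simp only: mult_1_right)
  qed
  show ?thesis
  proof (rule stolz_cesaro)
    show "\<forall>\<^sub>F n in sequentially. real n * ln (real n) < real (Suc n) * ln (real (Suc n))"
      by real_asymp
    show "filterlim (\<lambda>n. real n * ln (real n)) at_top sequentially" by real_asymp
    have "(\<lambda>n. D n / ln (real n) * (ln (real n) / (real (Suc n) * ln (real (Suc n)) - real n * ln (real n)))) \<longlonglongrightarrow> 2 * c * 1"
      by (intro tendsto_mult D) real_asymp
    moreover have "\<forall>\<^sub>F n in sequentially. D n / ln (real n) * (ln (real n) / (real (Suc n) * ln (real (Suc n)) - real n * ln (real n)))
      = (toeplitz_sum a (Suc n) - toeplitz_sum a n) / (real (Suc n) * ln (real (Suc n)) - real n * ln (real n))"
      using eventually_gt_at_top[of 1] by eventually_elim (simp add: toeplitz_sum_Suc D_def)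
    ultimately show "(\<lambda>n. (toeplitz_sum a (Suc n) - toeplitz_sum a n) / (real (Suc n) * ln (real (Suc n)) - real n * ln (real n))) \<longlonglongrightarrow> 2 * c"
      by (simp add: Lim_transform_eventually)
  qed
qed

text \<open>Only the diagonal is kept, the other entries being nonnegative.\<close>

lemma toeplitz_sum_ge:
  assumes "\<And>n. 0 \<le> a n"
  shows "a 0 * real N \<le> toeplitz_sum a N"
proof (induction N)
  case (Suc N)
  have "0 \<le> (\<Sum>j=1..N. a j)" using assms by (simp add: sum_nonneg)
  with Suc have "a 0 * real N + a 0 \<le> toeplitz_sum a (Suc N)"
    unfolding toeplitz_sum_Suc by linarith
  then show ?case by (simp add: algebra_simps)
qed (simp add: toeplitz_sum_def)

lemma toeplitz_sum_le:
  assumes "\<And>n. 0 \<le> a n" "summable a"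
  shows "toeplitz_sum a N \<le> (a 0 + 2 * suminf a) * real N"
proof (induction N)
  case (Suc N)
  have "(\<Sum>j=1..N. a j) \<le> suminf a" using assms by (intro sum_le_suminf) auto
  with Suc have "toeplitz_sum a (Suc N) \<le> (a 0 + 2 * suminf a) * real N + (a 0 + 2 * suminf a)"
    unfolding toeplitz_sum_Suc by linarith
  then show ?case by (simp add: algebra_simps)
qed (simp add: toeplitz_sum_def)

section \<open>Decay of the higher moments and the three growth rates\<close>

text \<open>One of the l factors C / sqrt n cancels the square root and at least one more remains.
  This makes degrees from 2 on negligible at scale N to the power 3/2.\<close>

lemma walk_moment_sqrt_tendsto_0:
  assumes "l \<ge> 2"
  shows "(\<lambda>n. walk_moment l n * sqrt (real n)) \<longlonglongrightarrow> 0"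
proof -
  obtain C where C: "C > 0" "\<And>l n. n > 0 \<Longrightarrow> walk_moment l n \<le> (C / sqrt (real n)) ^ l"
    using walk_moment_bound by blast
  have "l = Suc (Suc (l - 2))" using assms by simp
  then obtain k where k: "l = Suc (Suc k)" by blast
  have 0: "(\<lambda>n. C / sqrt (real n)) \<longlonglongrightarrow> 0" by real_asymp
  have "(\<lambda>n. C * (C / sqrt (real n)) ^ Suc k) \<longlonglongrightarrow> C * 0 ^ Suc k"
    by (intro tendsto_intros 0)
  then have up: "(\<lambda>n. C * (C / sqrt (real n)) ^ Suc k) \<longlonglongrightarrow> 0" by simp
  show ?thesis
  proof (rule tendsto_sandwich[OF _ _ tendsto_const up])
    show "\<forall>\<^sub>F n in sequentially. walk_moment l n * sqrt (real n) \<le> C * (C / sqrt (real n)) ^ Suc k"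
      using eventually_gt_at_top[of 0]
    proof eventually_elim
      case (elim n)
      have "walk_moment l n * sqrt (real n) \<le> (C / sqrt (real n)) ^ l * sqrt (real n)"
        using C(2)[of n l] elim by (intro mult_right_mono) auto
      also have "\<dots> = (C / sqrt (real n) * sqrt (real n)) * (C / sqrt (real n)) ^ Suc k"
        by (simp only: k power_Suc mult_ac)
      also have "C / sqrt (real n) * sqrt (real n) = C" using elim by simp
      finally show ?case .
    qed
  qed (simp add: walk_moment_nonneg)
qed

text \<open>Three of the l factors C / sqrt n carry the decay, further powers of 1 / sqrt n are at
  most 1. The exponent serves both the summability of the moments and their limit 0 after
  multiplication by n.\<close>

lemma walk_moment_le_powr:
  assumes "l \<ge> 3"
  shows "\<exists>C. \<forall>n>0. walk_moment l n \<le> C * real n powr (- 3 / 2)"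
proof -
  obtain C where C: "C > 0" "\<And>l n. n > 0 \<Longrightarrow> walk_moment l n \<le> (C / sqrt (real n)) ^ l"
    using walk_moment_bound by blast
  have "walk_moment l n \<le> C ^ l * real n powr (- 3 / 2)" if "n > 0" for n
  proof -
    have "(C / sqrt (real n)) ^ l = C ^ l * (1 / sqrt (real n)) ^ l" by (simp add: power_divide)
    also have "\<dots> \<le> C ^ l * (1 / sqrt (real n)) ^ 3"
      using assms C that by (intro mult_left_mono power_decreasing) auto
    also have "1 / sqrt (real n) = real n powr (- 1 / 2)"
      using powr_minus_divide[of "real n" "1 / 2"] by (simp add: powr_half_sqrt)
    also have "\<dots> ^ 3 = real n powr (- 3 / 2)" using that by (simp add: powr_power)
    finally show ?thesis using C(2)[OF that, of l] by linarith
  qed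
  then show ?thesis by blast
qed

lemma walk_moment_1_asymp: "(\<lambda>n. walk_moment 1 n * sqrt (real n)) \<longlonglongrightarrow> 1 / sqrt pi"
  unfolding walk_moment_1 by (rule central_prob_asymp)

lemma summable_walk_moment:
  assumes "l \<ge> 3"
  shows "summable (walk_moment l)"
proof -
  obtain C where C: "\<And>n. n > 0 \<Longrightarrow> walk_moment l n \<le> C * real n powr (- 3 / 2)"
    using walk_moment_le_powr[OF assms] by blast
  show ?thesis
  proof (rule summable_comparison_test_ev)
    show "\<forall>\<^sub>F n in sequentially. norm (walk_moment l n) \<le> C * real n powr (- 3 / 2)"
      using eventually_gt_at_top[of 0] by eventually_elim (use C walk_moment_nonneg in auto)
    show "summable (\<lambda>n. C * real n powr (- 3 / 2))"
      by (intro summable_mult) (simp add: summable_real_powr_iff)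
  qed
qed

lemma walk_moment_mult_tendsto_0:
  assumes "l \<ge> 3"
  shows "(\<lambda>n. walk_moment l n * real n) \<longlonglongrightarrow> 0"
proof -
  obtain C where C: "\<And>n. n > 0 \<Longrightarrow> walk_moment l n \<le> C * real n powr (- 3 / 2)"
    using walk_moment_le_powr[OF assms] by blast
  have "(\<lambda>n::nat. real n powr (- 3 / 2) * real n) \<longlonglongrightarrow> 0" by real_asymp
  from tendsto_mult_left[OF this, of C]
  have up: "(\<lambda>n. C * real n powr (- 3 / 2) * real n) \<longlonglongrightarrow> 0" by (simp add: mult.assoc)
  show ?thesis
  proof (rule tendsto_sandwich[OF _ _ tendsto_const up])
    show "\<forall>\<^sub>F n in sequentially. walk_moment l n * real n \<le> C * real n powr (- 3 / 2) * real n"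
      using eventually_gt_at_top[of 0] by eventually_elim (intro mult_right_mono C, auto)
  qed (simp add: walk_moment_nonneg)
qed

text \<open>At the scale of the leading degree every larger l has limit 0, by the double-sum lemmas
  with c = 0, so one term survives. For the linear order the diagonal of the r-th double sum gives
  the lower bound and summability of the moments the upper one.\<close>

lemma variance_series_asymp:
  fixes w :: "nat \<Rightarrow> real" and k :: nat
  defines "V \<equiv> \<lambda>N. \<Sum>l=1..k. w l * toeplitz_sum (walk_moment l) N"
  assumes "k \<ge> 1"
  shows "(\<lambda>N. V N / real N powr (3 / 2)) \<longlonglongrightarrow> w 1 * (8 / (3 * sqrt pi))"
    and "w 1 = 0 \<Longrightarrow> k \<ge> 2 \<Longrightarrow> (\<lambda>N. V N / (real N * ln (real N))) \<longlonglongrightarrow> w 2 * (4 / (pi * sqrt 3))"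
    and "w 1 = 0 \<Longrightarrow> w 2 = 0 \<Longrightarrow> (\<And>l. w l \<ge> 0) \<Longrightarrow> r \<in> {1..k} \<Longrightarrow> w r > 0 \<Longrightarrow> V \<in> \<Theta>(\<lambda>N. real N)"
proof -
  have "(\<lambda>N. \<Sum>l=1..k. w l * (toeplitz_sum (walk_moment l) N / real N powr (3 / 2))) \<longlonglongrightarrow>
      (\<Sum>l=1..k. w l * (if l = 1 then 8 / 3 * (1 / sqrt pi) else 8 / 3 * 0))"
  proof (intro tendsto_sum tendsto_mult tendsto_const)
    fix l assume "l \<in> {1..k}"
    then show "(\<lambda>N. toeplitz_sum (walk_moment l) N / real N powr (3 / 2)) \<longlonglongrightarrow> (if l = 1 then 8 / 3 * (1 / sqrt pi) else 8 / 3 * 0)"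
      using toeplitz_sum_powr_asymp[OF walk_moment_sqrt_tendsto_0[of l]]
        toeplitz_sum_powr_asymp[OF walk_moment_1_asymp]
      by auto
  qed
  also have "(\<Sum>l=1..k. w l * (if l = 1 then 8 / 3 * (1 / sqrt pi) else 8 / 3 * 0)) = (\<Sum>l=1..k. if l = 1 then w 1 * (8 / (3 * sqrt pi)) else 0)"
    by (intro sum.cong) auto
  also have "\<dots> = w 1 * (8 / (3 * sqrt pi))" using assms by (simp add: sum.delta)
  finally show "(\<lambda>N. V N / real N powr (3 / 2)) \<longlonglongrightarrow> w 1 * (8 / (3 * sqrt pi))"
    by (simp add: V_def sum_divide_distrib)
next
  assume w: "w 1 = 0" and k: "k \<ge> 2"
  have "(\<lambda>N. \<Sum>l=1..k. w l * (toeplitz_sum (walk_moment l) N / (real N * ln (real N)))) \<longlonglongrightarrow>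
      (\<Sum>l=1..k. if l = 2 then w 2 * (2 * (2 / (pi * sqrt 3))) else 0)"
  proof (intro tendsto_sum)
    fix l assume l: "l \<in> {1..k}"
    consider "l = 1" | "l = 2" | "l \<ge> 3" using l by force
    then show "(\<lambda>N. w l * (toeplitz_sum (walk_moment l) N / (real N * ln (real N)))) \<longlonglongrightarrow> (if l = 2 then w 2 * (2 * (2 / (pi * sqrt 3))) else 0)"
    proof cases
      case 2
      then show ?thesis using tendsto_mult_left[OF toeplitz_sum_log_asymp[OF walk_moment_2_asymp], of "w 2"] by simp
    next
      case 3
      then show ?thesis using tendsto_mult_left[OF toeplitz_sum_log_asymp[OF walk_moment_mult_tendsto_0[of l]], of "w l"] by simp
    qed (use w in simp)
  qed
  also have "(\<Sum>l=1..k. if l = 2 then w 2 * (2 * (2 / (pi * sqrt 3))) else 0) = w 2 * (4 / (pi * sqrt 3))"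
    using k by (simp add: sum.delta)
  finally show "(\<lambda>N. V N / (real N * ln (real N))) \<longlonglongrightarrow> w 2 * (4 / (pi * sqrt 3))"
    by (simp add: V_def sum_divide_distrib)
next
  assume w: "w 1 = 0" "w 2 = 0" "\<And>l. w l \<ge> 0" and r: "r \<in> {1..k}" "w r > 0"
  \<comment> \<open>For l = 1 and l = 2 the series diverges and \<open>suminf\<close> is
    meaningless; these entries are cancelled by \<open>w 1 = w 2 = 0\<close>.\<close>
  define K where "K = (\<Sum>l=1..k. w l * (1 + 2 * suminf (walk_moment l)))"
  have up: "V N \<le> K * real N" for N
    unfolding V_def K_def sum_distrib_right
  proof (intro sum_mono)
    fix l assume l: "l \<in> {1..k}"
    then consider "l = 1" | "l = 2" | "l \<ge> 3" by force
    then show "w l * toeplitz_sum (walk_moment l) N \<le> w l * (1 + 2 * suminf (walk_moment l)) * real N"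
      unfolding mult.assoc
    proof cases
      case 3
      then show "w l * toeplitz_sum (walk_moment l) N \<le> w l * ((1 + 2 * suminf (walk_moment l)) * real N)"
        using toeplitz_sum_le[of "walk_moment l" N, OF walk_moment_nonneg summable_walk_moment] w(3)
        by (intro mult_left_mono) (auto simp: walk_moment_at_0)
    qed (use w in auto)
  qed
  have t0: "0 \<le> toeplitz_sum (walk_moment l) N" for l N
    unfolding toeplitz_sum_def by (intro sum_nonneg walk_moment_nonneg)
  have lo: "w r * real N \<le> V N" for N
  proof -
    have "r \<noteq> 1" "r \<noteq> 2" using w r by auto
    with r have "r \<ge> 3" by auto
    then have "real N \<le> toeplitz_sum (walk_moment r) N"
      using toeplitz_sum_ge[of "walk_moment r" N, OF walk_moment_nonneg] by (simp add: walk_moment_at_0)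
    then have "w r * real N \<le> w r * toeplitz_sum (walk_moment r) N" using r by simp
    also have "\<dots> \<le> V N" unfolding V_def using r w t0
      by (intro member_le_sum) (auto intro!: mult_nonneg_nonneg)
    finally show ?thesis .
  qed
  have V0: "0 \<le> V N" for N using lo[of N] r by (meson less_imp_le mult_nonneg_nonneg of_nat_0_le_iff order_trans)
  show "V \<in> \<Theta>(\<lambda>N. real N)"
  proof (rule bigthetaI)
    show "V \<in> O(\<lambda>N. real N)" using up V0 by (intro bigoI[of _ K]) auto
    have "real N \<le> 1 / w r * V N" for N using lo[of N] r by (simp add: field_simps)
    then have "(\<lambda>N. real N) \<in> O(V)" using V0 by (intro bigoI[of _ "1 / w r"]) auto
    then show "V \<in> \<Omega>(\<lambda>N. real N)" by (simp add: bigomega_iff_bigo)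
  qed
qed

section \<open>Charlier polynomials and the Mecke equation\<close>

lemma poly_charlier_Suc_Suc:
  "poly (charlier R (Suc (Suc r))) x =
     (x - R - real (Suc r)) * poly (charlier R (Suc r)) x - real (Suc r) * R * poly (charlier R r) x"
  by (simp add: algebra_simps)

text \<open>The forward difference acts on Charlier polynomials like a derivative. At r = 0 the
  truncated \<open>r - 1\<close> is multiplied by 0.\<close>

lemma poly_charlier_shift:
  "poly (charlier R r) (x + 1) = poly (charlier R r) x + real r * poly (charlier R (r - 1)) x"
proof (induction R r rule: charlier.induct)
  case (3 R r)
  show ?case
  proof (cases r)
    case (Suc s)
    \<comment> \<open>After both induction hypotheses the remainder is r + 1 times the recurrence
      one index lower, which this equation provides.\<close>
    have e: "poly (charlier R (Suc r)) x = (x - R - real r) * poly (charlier R r) x - real r * R * poly (charlier R (r - 1)) x"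
      unfolding Suc by (simp add: poly_charlier_Suc_Suc del: charlier.simps)
    show ?thesis
      by (simp only: poly_charlier_Suc_Suc 3 diff_Suc_1 of_nat_Suc) (use e in algebra)
  qed (simp add: algebra_simps)
qed auto

text \<open>The raising relation, in the form \<open>x * h x\<close> with
  \<open>h x = C_r(x - 1)\<close> to which the Mecke equation applies: adding a point turns h back
  into \<open>C_r\<close>.\<close>

lemma poly_charlier_Suc:
  "poly (charlier R (Suc r)) x = x * poly (charlier R r) (x - 1) - R * poly (charlier R r) x"
proof -
  have 1: "poly (charlier R (Suc r)) (y + 1) = (y + 1) * poly (charlier R r) y - R * poly (charlier R r) (y + 1)" for y
  proof (cases r)
    case (Suc s)
    then show ?thesis
      unfolding poly_charlier_shift by (simp add: poly_charlier_Suc_Suc algebra_simps del: charlier.simps)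
  qed (simp add: algebra_simps)
  show ?thesis using 1[of "x - 1"] by simp
qed

lemma coeff_charlier: "coeff (charlier R r) r = 1 \<and> (\<forall>i>r. coeff (charlier R r) i = 0)"
proof (induction R r rule: charlier.induct)
  case (2 R)
  then show ?case by (auto simp: coeff_pCons split: nat.splits)
next
  case (3 R r)
  then show ?case by (auto simp: coeff_pCons split: nat.splits)
qed auto

lemma charlier_expansion:
  assumes "degree p \<le> k"
  shows "\<exists>c. p = (\<Sum>l\<le>k. smult (c l) (charlier R l))"
  using assms
proof (induction k arbitrary: p)
  case 0
  then obtain a where "p = [:a:]" by (metis degree_0_id le_zero_eq degree_eq_zeroE)
  then show ?case by (intro exI[of _ "\<lambda>_. a"]) simp
next
  case (Suc k)
  define q where "q = p - smult (coeff p (Suc k)) (charlier R (Suc k))"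
  have "degree q \<le> k"
  proof (rule degree_le, intro allI impI)
    fix i assume "k < i"
    then consider "i = Suc k" | "i > Suc k" by linarith
    then show "coeff q i = 0"
      using coeff_charlier[of R "Suc k"] Suc.prems
      by cases (auto simp: q_def coeff_eq_0 simp del: charlier.simps)
  qed
  from Suc.IH[OF this] obtain c where c: "q = (\<Sum>l\<le>k. smult (c l) (charlier R l))" by blast
  have "p = q + smult (coeff p (Suc k)) (charlier R (Suc k))" by (simp add: q_def)
  also have "q = (\<Sum>l\<le>k. smult ((c(Suc k := coeff p (Suc k))) l) (charlier R l))"
    unfolding c by (intro sum.cong) auto
  finally have "p = (\<Sum>l\<le>Suc k. smult ((c(Suc k := coeff p (Suc k))) l) (charlier R l))"
    by (simp del: charlier.simps)
  then show ?case by blast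
qed

lemma charlier_lin_indep:
  assumes "(\<Sum>l\<le>k. smult (c l) (charlier R l)) = 0" "l \<le> k"
  shows "c l = 0"
  using assms
proof (induction k arbitrary: l)
  case (Suc k)
  have "coeff (\<Sum>l\<le>Suc k. smult (c l) (charlier R l)) (Suc k) = c (Suc k)"
    using coeff_charlier by (simp add: coeff_sum del: charlier.simps)
  with Suc.prems(1) have 0: "c (Suc k) = 0" by (simp del: charlier.simps)
  with Suc.prems(1) have "(\<Sum>l\<le>k. smult (c l) (charlier R l)) = 0" by (simp del: charlier.simps)
  with Suc.IH Suc.prems(2) 0 show ?case by (cases "l = Suc k") auto
qed simp

text \<open>The Mecke equation for the first component of a sum over Poisson points with values in \<open>{0,1}\<^sup>2\<close>:
  \<open>\<alpha>\<close> and \<open>\<beta>\<close> are the total intensities of the points with value \<open>(1,0)\<close> and \<open>(1,1)\<close>. Points with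
  value \<open>(0,1)\<close> do not enter.\<close>

definition mecke :: "'a measure \<Rightarrow> ('a \<Rightarrow> nat \<times> nat) \<Rightarrow> real \<Rightarrow> real \<Rightarrow> bool" where
  "mecke M T \<alpha> \<beta> \<longleftrightarrow> (\<forall>h :: nat \<times> nat \<Rightarrow> ennreal.
     (\<integral>\<^sup>+\<omega>. of_nat (fst (T \<omega>)) * h (T \<omega>) \<partial>M) =
       ennreal \<alpha> * (\<integral>\<^sup>+\<omega>. h (T \<omega> + (1, 0)) \<partial>M) + ennreal \<beta> * (\<integral>\<^sup>+\<omega>. h (T \<omega> + (1, 1)) \<partial>M))"

lemma mecke_cong_AE:
  assumes "mecke M T \<alpha> \<beta>" "AE \<omega> in M. T \<omega> = T' \<omega>"
  shows "mecke M T' \<alpha> \<beta>"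
proof -
  have "(\<integral>\<^sup>+\<omega>. of_nat (fst (T' \<omega>)) * h (T' \<omega>) \<partial>M) = (\<integral>\<^sup>+\<omega>. of_nat (fst (T \<omega>)) * h (T \<omega>) \<partial>M)"
    "(\<integral>\<^sup>+\<omega>. h (T' \<omega> + z) \<partial>M) = (\<integral>\<^sup>+\<omega>. h (T \<omega> + z) \<partial>M)" for h :: "nat \<times> nat \<Rightarrow> ennreal" and z
    using assms(2) by (auto intro!: nn_integral_cong_AE)
  then show ?thesis using assms(1) unfolding mecke_def by simp
qed

text \<open>The nonnegative case is applied to the positive and negative parts of h. Integrability
  of the left side is part of the conclusion, which lets moments be derived from lower ones.\<close>

lemma mecke_real:
  fixes h :: "nat \<times> nat \<Rightarrow> real"
  assumes T[measurable]: "T \<in> M \<rightarrow>\<^sub>M count_space UNIV" and mecke: "mecke M T \<alpha> \<beta>" "\<alpha> \<ge> 0" "\<beta> \<ge> 0"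
    and int: "integrable M (\<lambda>\<omega>. h (T \<omega> + (1, 0)))" "integrable M (\<lambda>\<omega>. h (T \<omega> + (1, 1)))"
  shows "has_bochner_integral M (\<lambda>\<omega>. real (fst (T \<omega>)) * h (T \<omega>))
     (\<alpha> * (\<integral>\<omega>. h (T \<omega> + (1, 0)) \<partial>M) + \<beta> * (\<integral>\<omega>. h (T \<omega> + (1, 1)) \<partial>M))"
proof -
  have pos: "has_bochner_integral M (\<lambda>\<omega>. real (fst (T \<omega>)) * g (T \<omega>))
     (\<alpha> * (\<integral>\<omega>. g (T \<omega> + (1, 0)) \<partial>M) + \<beta> * (\<integral>\<omega>. g (T \<omega> + (1, 1)) \<partial>M))"
    if g: "\<And>x. g x \<ge> 0" and gi: "integrable M (\<lambda>\<omega>. g (T \<omega> + (1, 0)))" "integrable M (\<lambda>\<omega>. g (T \<omega> + (1, 1)))"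
    for g :: "nat \<times> nat \<Rightarrow> real"
  proof (rule has_bochner_integral_nn_integral)
    show "(\<lambda>\<omega>. real (fst (T \<omega>)) * g (T \<omega>)) \<in> borel_measurable M"
      by (rule measurable_compose[OF T]) simp
    have "(\<integral>\<^sup>+\<omega>. ennreal (real (fst (T \<omega>)) * g (T \<omega>)) \<partial>M) = (\<integral>\<^sup>+\<omega>. of_nat (fst (T \<omega>)) * ennreal (g (T \<omega>)) \<partial>M)"
      by (simp add: ennreal_mult g ennreal_of_nat_eq_real_of_nat)
    also have "\<dots> = ennreal \<alpha> * (\<integral>\<^sup>+\<omega>. ennreal (g (T \<omega> + (1, 0))) \<partial>M) + ennreal \<beta> * (\<integral>\<^sup>+\<omega>. ennreal (g (T \<omega> + (1, 1))) \<partial>M)"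
      using mecke(1)[unfolded mecke_def, rule_format, of "\<lambda>x. ennreal (g x)"] .
    also have "(\<integral>\<^sup>+\<omega>. ennreal (g (T \<omega> + (1, 0))) \<partial>M) = ennreal (\<integral>\<omega>. g (T \<omega> + (1, 0)) \<partial>M)"
      by (rule nn_integral_eq_integral[OF gi(1)]) (simp add: g)
    also have "(\<integral>\<^sup>+\<omega>. ennreal (g (T \<omega> + (1, 1))) \<partial>M) = ennreal (\<integral>\<omega>. g (T \<omega> + (1, 1)) \<partial>M)"
      by (rule nn_integral_eq_integral[OF gi(2)]) (simp add: g)
    also have "ennreal \<alpha> * ennreal (\<integral>\<omega>. g (T \<omega> + (1, 0)) \<partial>M) + ennreal \<beta> * ennreal (\<integral>\<omega>. g (T \<omega> + (1, 1)) \<partial>M)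
      = ennreal (\<alpha> * (\<integral>\<omega>. g (T \<omega> + (1, 0)) \<partial>M) + \<beta> * (\<integral>\<omega>. g (T \<omega> + (1, 1)) \<partial>M))"
      using mecke(2,3) by (simp add: g ennreal_mult ennreal_plus integral_nonneg_AE)
    finally show "(\<integral>\<^sup>+\<omega>. ennreal (real (fst (T \<omega>)) * g (T \<omega>)) \<partial>M) =
       ennreal (\<alpha> * (\<integral>\<omega>. g (T \<omega> + (1, 0)) \<partial>M) + \<beta> * (\<integral>\<omega>. g (T \<omega> + (1, 1)) \<partial>M))" .
  qed (use mecke in \<open>auto intro!: g integral_nonneg_AE add_nonneg_nonneg mult_nonneg_nonneg\<close>)
  define p where "p x = max 0 (h x)" for x
  define n where "n x = max 0 (- h x)" for x
  have hpn: "h x = p x - n x" for x by (auto simp: p_def n_def)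
  have ip: "integrable M (\<lambda>\<omega>. p (T \<omega> + z))" "integrable M (\<lambda>\<omega>. n (T \<omega> + z))" if "z = (1, 0) \<or> z = (1, 1)" for z
    using that int unfolding p_def n_def by (auto intro!: integrable_max)
  have "has_bochner_integral M (\<lambda>\<omega>. real (fst (T \<omega>)) * p (T \<omega>) - real (fst (T \<omega>)) * n (T \<omega>))
     ((\<alpha> * (\<integral>\<omega>. p (T \<omega> + (1, 0)) \<partial>M) + \<beta> * (\<integral>\<omega>. p (T \<omega> + (1, 1)) \<partial>M))
      - (\<alpha> * (\<integral>\<omega>. n (T \<omega> + (1, 0)) \<partial>M) + \<beta> * (\<integral>\<omega>. n (T \<omega> + (1, 1)) \<partial>M)))"
    by (intro has_bochner_integral_diff pos ip) (auto simp: p_def n_def)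
  also have "(\<lambda>\<omega>. real (fst (T \<omega>)) * p (T \<omega>) - real (fst (T \<omega>)) * n (T \<omega>)) = (\<lambda>\<omega>. real (fst (T \<omega>)) * h (T \<omega>))"
    by (simp add: hpn right_diff_distrib)
  also have "(\<alpha> * (\<integral>\<omega>. p (T \<omega> + (1, 0)) \<partial>M) + \<beta> * (\<integral>\<omega>. p (T \<omega> + (1, 1)) \<partial>M))
      - (\<alpha> * (\<integral>\<omega>. n (T \<omega> + (1, 0)) \<partial>M) + \<beta> * (\<integral>\<omega>. n (T \<omega> + (1, 1)) \<partial>M))
    = \<alpha> * (\<integral>\<omega>. h (T \<omega> + (1, 0)) \<partial>M) + \<beta> * (\<integral>\<omega>. h (T \<omega> + (1, 1)) \<partial>M)"
  proof -
    have d: "(\<integral>\<omega>. p (T \<omega> + z) - n (T \<omega> + z) \<partial>M) = (\<integral>\<omega>. p (T \<omega> + z) \<partial>M) - (\<integral>\<omega>. n (T \<omega> + z) \<partial>M)"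
      if "z = (1, 0) \<or> z = (1, 1)" for z
      by (rule Bochner_Integration.integral_diff[OF ip[OF that]])
    show ?thesis
      unfolding hpn d[OF disjI1[OF refl]] d[OF disjI2[OF refl]] right_diff_distrib by linarith
  qed
  finally show ?thesis .
qed

lemma integrable_poly_of_moments:
  fixes f :: "'a \<Rightarrow> real"
  assumes "\<And>i. integrable M (\<lambda>\<omega>. f \<omega> ^ i)"
  shows "integrable M (\<lambda>\<omega>. poly p (f \<omega>))"
  unfolding poly_altdef by (intro Bochner_Integration.integrable_sum integrable_mult_right assms)

text \<open>Taking h(x) as the power j of the first coordinate expresses moment j + 1 through
  moments up to order j of a variable increased by 1.\<close>

lemma mecke_integrable_poly:
  assumes "prob_space M" and T: "T \<in> M \<rightarrow>\<^sub>M count_space UNIV" and mecke: "mecke M T \<alpha> \<beta>" "\<alpha> \<ge> 0" "\<beta> \<ge> 0"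
  shows "integrable M (\<lambda>\<omega>. poly p (real (fst (T \<omega>))))"
proof (rule integrable_poly_of_moments)
  interpret prob_space M by fact
  fix i show "integrable M (\<lambda>\<omega>. real (fst (T \<omega>)) ^ i)"
  proof (induction i rule: less_induct)
    case (less i)
    show ?case
    proof (cases i)
      case (Suc j)
      have "integrable M (\<lambda>\<omega>. (real (fst (T \<omega>)) + 1) ^ j)"
        unfolding binomial_ring
        by (intro Bochner_Integration.integrable_sum integrable_mult_left integrable_mult_right less.IH) (simp add: Suc)
      then have "integrable M (\<lambda>\<omega>. real (fst (T \<omega> + (1, 0))) ^ j)" "integrable M (\<lambda>\<omega>. real (fst (T \<omega> + (1, 1))) ^ j)"
        by (simp_all add: add.commute)
      from mecke_real[OF T mecke this] show ?thesis
        by (simp add: Suc has_bochner_integral_iff)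
    qed simp
  qed
qed

lemma integrable_mult_of_squares:
  fixes f g :: "'a \<Rightarrow> real"
  assumes [measurable]: "f \<in> borel_measurable M" "g \<in> borel_measurable M"
    and "integrable M (\<lambda>\<omega>. (f \<omega>)\<^sup>2)" "integrable M (\<lambda>\<omega>. (g \<omega>)\<^sup>2)"
  shows "integrable M (\<lambda>\<omega>. f \<omega> * g \<omega>)"
proof (rule Bochner_Integration.integrable_bound)
  show "integrable M (\<lambda>\<omega>. (f \<omega>)\<^sup>2 + (g \<omega>)\<^sup>2)" using assms by simp
  show "AE \<omega> in M. norm (f \<omega> * g \<omega>) \<le> norm ((f \<omega>)\<^sup>2 + (g \<omega>)\<^sup>2)"
  proof (intro AE_I2)
    fix \<omega>
    have "0 \<le> (\<bar>f \<omega>\<bar> - \<bar>g \<omega>\<bar>)\<^sup>2" "0 \<le> \<bar>f \<omega>\<bar> * \<bar>g \<omega>\<bar>" by simp_all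
    then have "\<bar>f \<omega>\<bar> * \<bar>g \<omega>\<bar> \<le> (f \<omega>)\<^sup>2 + (g \<omega>)\<^sup>2"
      unfolding power2_diff power2_abs by linarith
    then show "norm (f \<omega> * g \<omega>) \<le> norm ((f \<omega>)\<^sup>2 + (g \<omega>)\<^sup>2)"
      by (simp add: abs_mult)
  qed
qed measurable

text \<open>The Mecke equation controls only the first coordinate, so moments of the second are
  assumed here; they come later from pairs with equal coordinates.\<close>

lemma mecke_integrable_poly_mult:
  assumes "prob_space M" and T: "T \<in> M \<rightarrow>\<^sub>M count_space UNIV" and mecke: "mecke M T \<alpha> \<beta>" "\<alpha> \<ge> 0" "\<beta> \<ge> 0"
    and snd: "\<And>p. integrable M (\<lambda>\<omega>. poly p (real (snd (T \<omega>))))"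
  shows "integrable M (\<lambda>\<omega>. poly p (real (fst (T \<omega>))) * poly q (real (snd (T \<omega>))))"
proof (rule integrable_mult_of_squares)
  show "(\<lambda>\<omega>. poly p (real (fst (T \<omega>)))) \<in> borel_measurable M" "(\<lambda>\<omega>. poly q (real (snd (T \<omega>)))) \<in> borel_measurable M"
    by (rule measurable_compose[OF T]; simp)+
  show "integrable M (\<lambda>\<omega>. (poly p (real (fst (T \<omega>))))\<^sup>2)"
    using mecke_integrable_poly[OF assms(1-5), of "p ^ 2"] by (simp add: power2_eq_square)
  show "integrable M (\<lambda>\<omega>. (poly q (real (snd (T \<omega>))))\<^sup>2)"
    using snd[of "q ^ 2"] by (simp add: power2_eq_square)
qed

text \<open>The raising relation and the Mecke equation produce
  \<open>(\<alpha> + \<beta>) E\<close> from the unshifted second factor, which cancels against the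
  subtracted term. What is left is \<beta> times the forward difference of the second
  polynomial.\<close>

lemma mecke_charlier_step:
  assumes "prob_space M" and T: "T \<in> M \<rightarrow>\<^sub>M count_space UNIV" and mecke: "mecke M T \<alpha> \<beta>" "\<alpha> \<ge> 0" "\<beta> \<ge> 0"
    and snd: "\<And>p. integrable M (\<lambda>\<omega>. poly p (real (snd (T \<omega>))))"
  shows "(\<integral>\<omega>. poly (charlier (\<alpha> + \<beta>) (Suc j)) (real (fst (T \<omega>))) * poly (charlier (\<alpha> + \<beta>) l) (real (snd (T \<omega>))) \<partial>M)
    = \<beta> * real l * (\<integral>\<omega>. poly (charlier (\<alpha> + \<beta>) j) (real (fst (T \<omega>))) * poly (charlier (\<alpha> + \<beta>) (l - 1)) (real (snd (T \<omega>))) \<partial>M)"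
proof -
  define R where "R = \<alpha> + \<beta>"
  define E where "E j l = (\<integral>\<omega>. poly (charlier R j) (real (fst (T \<omega>))) * poly (charlier R l) (real (snd (T \<omega>))) \<partial>M)" for j l
  define h where "h = (\<lambda>x. poly (charlier R j) (real (fst x) - 1) * poly (charlier R l) (real (snd x)) :: real)"
  have int: "integrable M (\<lambda>\<omega>. poly p (real (fst (T \<omega>))) * poly q (real (snd (T \<omega>))))" for p q
    by (rule mecke_integrable_poly_mult[OF assms])
  have h1: "h (T \<omega> + (1, 0)) = poly (charlier R j) (real (fst (T \<omega>))) * poly (charlier R l) (real (snd (T \<omega>)))" for \<omega>
    by (simp add: h_def)
  have h2: "h (T \<omega> + (1, 1)) = poly (charlier R j) (real (fst (T \<omega>))) * poly (charlier R l) (real (snd (T \<omega>)))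
      + real l * (poly (charlier R j) (real (fst (T \<omega>))) * poly (charlier R (l - 1)) (real (snd (T \<omega>))))" for \<omega>
    using poly_charlier_shift[of R l "real (snd (T \<omega>))"] by (simp add: h_def algebra_simps)
  have "has_bochner_integral M (\<lambda>\<omega>. real (fst (T \<omega>)) * h (T \<omega>))
     (\<alpha> * (\<integral>\<omega>. h (T \<omega> + (1, 0)) \<partial>M) + \<beta> * (\<integral>\<omega>. h (T \<omega> + (1, 1)) \<partial>M))"
    unfolding h1 h2 by (rule mecke_real[OF T mecke, of h, unfolded h1 h2])
      (intro Bochner_Integration.integrable_add integrable_mult_right int)+
  also have "\<alpha> * (\<integral>\<omega>. h (T \<omega> + (1, 0)) \<partial>M) + \<beta> * (\<integral>\<omega>. h (T \<omega> + (1, 1)) \<partial>M) = R * E j l + \<beta> * real l * E j (l - 1)"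
    unfolding h1 h2 E_def R_def using int by (simp add: algebra_simps)
  finally have 1: "has_bochner_integral M (\<lambda>\<omega>. real (fst (T \<omega>)) * h (T \<omega>)) (R * E j l + \<beta> * real l * E j (l - 1))" .
  have "E (Suc j) l = (\<integral>\<omega>. real (fst (T \<omega>)) * h (T \<omega>)
      - R * (poly (charlier R j) (real (fst (T \<omega>))) * poly (charlier R l) (real (snd (T \<omega>)))) \<partial>M)"
    unfolding E_def poly_charlier_Suc h_def
    by (intro Bochner_Integration.integral_cong refl) (simp add: algebra_simps)
  also have "\<dots> = \<beta> * real l * E j (l - 1)"
    using 1 int by (simp add: has_bochner_integral_iff E_def)
  finally show ?thesis by (simp add: E_def R_def)
qed

lemma mecke_charlier_mean:
  assumes "prob_space M" and T: "T \<in> M \<rightarrow>\<^sub>M count_space UNIV" and mecke: "mecke M T \<alpha> \<beta>" "\<alpha> \<ge> 0" "\<beta> \<ge> 0"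
    and "l \<ge> 1"
  shows "(\<integral>\<omega>. poly (charlier (\<alpha> + \<beta>) l) (real (fst (T \<omega>))) \<partial>M) = 0"
proof -
  let ?R = "\<alpha> + \<beta>"
  obtain j where l: "l = Suc j" using assms(6) by (cases l) auto
  have int: "integrable M (\<lambda>\<omega>. poly p (real (fst (T \<omega>))))" for p
    by (rule mecke_integrable_poly[OF assms(1-5)])
  have eq: "poly (charlier ?R j) (real (fst (T \<omega> + (1, 0))) - 1) = poly (charlier ?R j) (real (fst (T \<omega>)))"
    "poly (charlier ?R j) (real (fst (T \<omega> + (1, 1))) - 1) = poly (charlier ?R j) (real (fst (T \<omega>)))" for \<omega>
    by simp_all
  have 1: "has_bochner_integral M (\<lambda>\<omega>. real (fst (T \<omega>)) * poly (charlier ?R j) (real (fst (T \<omega>)) - 1))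
    (\<alpha> * (\<integral>\<omega>. poly (charlier ?R j) (real (fst (T \<omega>))) \<partial>M) + \<beta> * (\<integral>\<omega>. poly (charlier ?R j) (real (fst (T \<omega>))) \<partial>M))"
    by (rule mecke_real[OF T mecke, of "\<lambda>x. poly (charlier ?R j) (real (fst x) - 1)", unfolded eq]) (rule int)+
  have "(\<integral>\<omega>. poly (charlier ?R l) (real (fst (T \<omega>))) \<partial>M) =
     (\<integral>\<omega>. real (fst (T \<omega>)) * poly (charlier ?R j) (real (fst (T \<omega>)) - 1) - ?R * poly (charlier ?R j) (real (fst (T \<omega>))) \<partial>M)"
    unfolding l poly_charlier_Suc ..
  also have "\<dots> = 0" using 1 int by (simp add: has_bochner_integral_iff algebra_simps)
  finally show ?thesis .
qed

text \<open>Each step lowers both indices and collects a factor \<beta> l. If l runs out first the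
  factor 0 ends the descent; if j does, the zero mean of the remaining polynomial in the second
  coordinate ends it.\<close>

lemma mecke_charlier_cov:
  assumes "prob_space M" and T: "T \<in> M \<rightarrow>\<^sub>M count_space UNIV" and mecke: "mecke M T \<alpha> \<beta>" "\<alpha> \<ge> 0" "\<beta> \<ge> 0"
    and snd: "\<And>p. integrable M (\<lambda>\<omega>. poly p (real (snd (T \<omega>))))"
    and snd_mean: "\<And>l. l \<ge> 1 \<Longrightarrow> (\<integral>\<omega>. poly (charlier (\<alpha> + \<beta>) l) (real (snd (T \<omega>))) \<partial>M) = 0"
  shows "(\<integral>\<omega>. poly (charlier (\<alpha> + \<beta>) j) (real (fst (T \<omega>))) * poly (charlier (\<alpha> + \<beta>) l) (real (snd (T \<omega>))) \<partial>M)
    = (if j = l then fact l * \<beta> ^ l else 0)"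
proof (induction j arbitrary: l)
  case 0
  interpret prob_space M by fact
  show ?case using snd_mean[of l] by (cases l) (simp_all add: prob_space)
next
  case (Suc j)
  show ?case
  proof (cases l)
    case (Suc i)
    then show ?thesis
      unfolding mecke_charlier_step[OF assms(1-6)] Suc.IH by (simp add: mult_ac)
  next
    case 0
    show ?thesis unfolding mecke_charlier_step[OF assms(1-6)] by (simp add: 0)
  qed
qed

section \<open>Mecke equations of Poisson, superposed and compound Poisson variables\<close>

text \<open>Poisson weights satisfy \<open>(k + 1) * P(k + 1) = R * P(k)\<close>; the term k = 0
  vanishes, so the sum can be reindexed.\<close>

lemma nn_integral_poisson_mecke:
  assumes "R > 0"
  shows "(\<integral>\<^sup>+k. of_nat k * h k \<partial>poisson_pmf R) = ennreal R * (\<integral>\<^sup>+k. h (Suc k) \<partial>poisson_pmf R)"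
proof -
  have "(\<integral>\<^sup>+k. of_nat k * h k \<partial>poisson_pmf R) = (\<Sum>k. ennreal (pmf (poisson_pmf R) k) * (of_nat k * h k))"
    by (simp add: nn_integral_measure_pmf nn_integral_count_space_nat)
  also have "\<dots> = (\<Sum>k. ennreal (pmf (poisson_pmf R) (Suc k)) * (of_nat (Suc k) * h (Suc k)))"
    using sums_Suc[OF summable_sums[OF summableI], of "\<lambda>k. ennreal (pmf (poisson_pmf R) k) * (of_nat k * h k)"]
    by (simp add: sums_iff)
  also have "\<dots> = (\<Sum>k. ennreal R * (ennreal (pmf (poisson_pmf R) k) * h (Suc k)))"
  proof (intro suminf_cong)
    fix k
    have "pmf (poisson_pmf R) (Suc k) * real (Suc k) = R * pmf (poisson_pmf R) k"
      using assms by (simp add: fact_Suc del: of_nat_Suc)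
    then have "ennreal (pmf (poisson_pmf R) (Suc k)) * of_nat (Suc k) = ennreal R * ennreal (pmf (poisson_pmf R) k)"
      using assms by (metis ennreal_mult ennreal_of_nat_eq_real_of_nat less_imp_le of_nat_0_le_iff pmf_nonneg)
    then show "ennreal (pmf (poisson_pmf R) (Suc k)) * (of_nat (Suc k) * h (Suc k)) = ennreal R * (ennreal (pmf (poisson_pmf R) k) * h (Suc k))"
      by (simp only: mult.assoc [symmetric])
  qed
  also have "\<dots> = ennreal R * (\<integral>\<^sup>+k. h (Suc k) \<partial>poisson_pmf R)"
    by (simp add: nn_integral_measure_pmf nn_integral_count_space_nat ennreal_suminf_cmult)
  finally show ?thesis .
qed

text \<open>With equal coordinates no point has value (1,0). This gives moments and zero Charlier
  means under the Poisson law itself, on which \<open>charlier_coeff\<close> rests.\<close>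

lemma mecke_poisson: "R > 0 \<Longrightarrow> mecke (poisson_pmf R) (\<lambda>k. (k, k)) 0 R"
  by (simp add: mecke_def nn_integral_poisson_mecke)

lemma measurable_compose_discrete:
  assumes "T \<in> M \<rightarrow>\<^sub>M count_space UNIV" "space N = UNIV"
  shows "(\<lambda>\<omega>. f (T \<omega>)) \<in> M \<rightarrow>\<^sub>M N"
  by (rule measurable_compose[OF assms(1)]) (simp add: assms(2))

lemma measurable_compose_discrete2:
  fixes f :: "'b \<Rightarrow> 'c::countable \<Rightarrow> 'd"
  assumes "T \<in> M \<rightarrow>\<^sub>M count_space UNIV" "U \<in> M \<rightarrow>\<^sub>M count_space UNIV" "space N = UNIV"
  shows "(\<lambda>\<omega>. f (T \<omega>) (U \<omega>)) \<in> M \<rightarrow>\<^sub>M N"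
  by (rule measurable_compose_countable[OF measurable_compose_discrete[OF assms(1,3)] assms(2)])

lemma measurable_sum_discrete:
  fixes f :: "'i \<Rightarrow> 'a \<Rightarrow> 'b::{countable, comm_monoid_add}"
  assumes "\<And>i. i \<in> A \<Longrightarrow> f i \<in> M \<rightarrow>\<^sub>M count_space UNIV"
  shows "(\<lambda>\<omega>. \<Sum>i\<in>A. f i \<omega>) \<in> M \<rightarrow>\<^sub>M count_space UNIV"
  using assms by (induction A rule: infinite_finite_induct) (auto intro!: measurable_compose_discrete2)

lemma nn_integral_linear2:
  assumes "f \<in> borel_measurable M" "g \<in> borel_measurable M"
  shows "(\<integral>\<^sup>+\<omega>. a * f \<omega> + b * g \<omega> \<partial>M) = a * (\<integral>\<^sup>+\<omega>. f \<omega> \<partial>M) + b * (\<integral>\<^sup>+\<omega>. g \<omega> \<partial>M)"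
  using assms by (simp add: nn_integral_add nn_integral_cmult)

context prob_space
begin

text \<open>Countability makes the product of the discrete sigma-algebras discrete, so Tonelli's
  theorem applies to every F, in both orders.\<close>

lemma nn_integral_indep:
  fixes A B :: "'a \<Rightarrow> 'b::countable"
  assumes "indep_var (count_space UNIV) A (count_space UNIV) B"
  shows "(\<integral>\<^sup>+\<omega>. F (A \<omega>) (B \<omega>) \<partial>M) = (\<integral>\<^sup>+\<omega>. (\<integral>\<^sup>+\<omega>'. F (A \<omega>) (B \<omega>') \<partial>M) \<partial>M)"
    and "(\<integral>\<^sup>+\<omega>. F (A \<omega>) (B \<omega>) \<partial>M) = (\<integral>\<^sup>+\<omega>'. (\<integral>\<^sup>+\<omega>. F (A \<omega>) (B \<omega>') \<partial>M) \<partial>M)"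
proof -
  let ?CA = "count_space (UNIV :: 'b set)" and ?CB = "count_space (UNIV :: 'b set)"
  have A[measurable]: "A \<in> M \<rightarrow>\<^sub>M ?CA" and B[measurable]: "B \<in> M \<rightarrow>\<^sub>M ?CB"
    and d: "distr M ?CA A \<Otimes>\<^sub>M distr M ?CB B = distr M (?CA \<Otimes>\<^sub>M ?CB) (\<lambda>\<omega>. (A \<omega>, B \<omega>))"
    using assms by (auto simp: indep_var_distribution_eq)
  have cs: "?CA \<Otimes>\<^sub>M ?CB = count_space UNIV"
    by (subst pair_measure_countable) auto
  interpret PA: prob_space "distr M ?CA A" by (rule prob_space_distr) fact
  interpret PB: prob_space "distr M ?CB B" by (rule prob_space_distr) fact
  interpret P: pair_sigma_finite "distr M ?CA A" "distr M ?CB B" ..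
  have m: "case_prod F \<in> borel_measurable (distr M ?CA A \<Otimes>\<^sub>M distr M ?CB B)"
    unfolding d by (simp add: cs)
  have 0: "(\<integral>\<^sup>+\<omega>. F (A \<omega>) (B \<omega>) \<partial>M) = integral\<^sup>N (distr M ?CA A \<Otimes>\<^sub>M distr M ?CB B) (case_prod F)"
    unfolding d by (subst nn_integral_distr) (simp_all add: cs)
  show "(\<integral>\<^sup>+\<omega>. F (A \<omega>) (B \<omega>) \<partial>M) = (\<integral>\<^sup>+\<omega>. (\<integral>\<^sup>+\<omega>'. F (A \<omega>) (B \<omega>') \<partial>M) \<partial>M)"
    unfolding 0 PB.nn_integral_fst[OF m, symmetric] by (simp add: nn_integral_distr)
  show "(\<integral>\<^sup>+\<omega>. F (A \<omega>) (B \<omega>) \<partial>M) = (\<integral>\<^sup>+\<omega>'. (\<integral>\<^sup>+\<omega>. F (A \<omega>) (B \<omega>') \<partial>M) \<partial>M)"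
    unfolding 0 P.nn_integral_snd[OF m, symmetric] by (simp add: nn_integral_distr)
qed

text \<open>The weight splits as \<open>fst A + fst B\<close>. In each part the other summand is
  frozen by independence and absorbed into a translate of h.\<close>

lemma mecke_add:
  assumes ind: "indep_var (count_space UNIV) A (count_space UNIV) B"
    and A: "mecke M A \<alpha> \<beta>" and B: "mecke M B \<alpha>' \<beta>'"
    and nonneg: "\<alpha> \<ge> 0" "\<beta> \<ge> 0" "\<alpha>' \<ge> 0" "\<beta>' \<ge> 0"
  shows "mecke M (\<lambda>\<omega>. A \<omega> + B \<omega>) (\<alpha> + \<alpha>') (\<beta> + \<beta>')"
  unfolding mecke_def
proof
  fix h :: "nat \<times> nat \<Rightarrow> ennreal"
  have [measurable]: "A \<in> M \<rightarrow>\<^sub>M count_space UNIV" "B \<in> M \<rightarrow>\<^sub>M count_space UNIV"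
    using ind by (auto simp: indep_var_distribution_eq)
  note I = nn_integral_indep[OF ind]
  have "(\<integral>\<^sup>+\<omega>. of_nat (fst (A \<omega>)) * h (A \<omega> + B \<omega>) \<partial>M)
    = (\<integral>\<^sup>+\<omega>'. (\<integral>\<^sup>+\<omega>. of_nat (fst (A \<omega>)) * h (A \<omega> + B \<omega>') \<partial>M) \<partial>M)"
    by (rule I(2)[of "\<lambda>a b. of_nat (fst a) * h (a + b)"])
  also have "\<dots> = (\<integral>\<^sup>+\<omega>'. ennreal \<alpha> * (\<integral>\<^sup>+\<omega>. h (A \<omega> + (1, 0) + B \<omega>') \<partial>M) + ennreal \<beta> * (\<integral>\<^sup>+\<omega>. h (A \<omega> + (1, 1) + B \<omega>') \<partial>M) \<partial>M)"
    by (intro nn_integral_cong A[unfolded mecke_def, rule_format, of "\<lambda>a. h (a + B _)"])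
  also have "\<dots> = ennreal \<alpha> * (\<integral>\<^sup>+\<omega>'. (\<integral>\<^sup>+\<omega>. h (A \<omega> + (1, 0) + B \<omega>') \<partial>M) \<partial>M) + ennreal \<beta> * (\<integral>\<^sup>+\<omega>'. (\<integral>\<^sup>+\<omega>. h (A \<omega> + (1, 1) + B \<omega>') \<partial>M) \<partial>M)"
    by (intro nn_integral_linear2 measurable_compose_discrete[OF \<open>B \<in> _\<close> space_borel])
  also have "(\<integral>\<^sup>+\<omega>'. (\<integral>\<^sup>+\<omega>. h (A \<omega> + (1, 0) + B \<omega>') \<partial>M) \<partial>M) = (\<integral>\<^sup>+\<omega>. h (A \<omega> + B \<omega> + (1, 0)) \<partial>M)"
    using I(2)[of "\<lambda>a b. h (a + (1, 0) + b)"] by (simp add: add_ac)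
  also have "(\<integral>\<^sup>+\<omega>'. (\<integral>\<^sup>+\<omega>. h (A \<omega> + (1, 1) + B \<omega>') \<partial>M) \<partial>M) = (\<integral>\<^sup>+\<omega>. h (A \<omega> + B \<omega> + (1, 1)) \<partial>M)"
    using I(2)[of "\<lambda>a b. h (a + (1, 1) + b)"] by (simp add: add_ac)
  finally have 1: "(\<integral>\<^sup>+\<omega>. of_nat (fst (A \<omega>)) * h (A \<omega> + B \<omega>) \<partial>M) =
     ennreal \<alpha> * (\<integral>\<^sup>+\<omega>. h (A \<omega> + B \<omega> + (1, 0)) \<partial>M) + ennreal \<beta> * (\<integral>\<^sup>+\<omega>. h (A \<omega> + B \<omega> + (1, 1)) \<partial>M)" .
  have "(\<integral>\<^sup>+\<omega>. of_nat (fst (B \<omega>)) * h (A \<omega> + B \<omega>) \<partial>M)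
    = (\<integral>\<^sup>+\<omega>'. (\<integral>\<^sup>+\<omega>. of_nat (fst (B \<omega>)) * h (A \<omega>' + B \<omega>) \<partial>M) \<partial>M)"
    by (rule I(1)[of "\<lambda>a b. of_nat (fst b) * h (a + b)"])
  also have "\<dots> = (\<integral>\<^sup>+\<omega>'. ennreal \<alpha>' * (\<integral>\<^sup>+\<omega>. h (A \<omega>' + (B \<omega> + (1, 0))) \<partial>M) + ennreal \<beta>' * (\<integral>\<^sup>+\<omega>. h (A \<omega>' + (B \<omega> + (1, 1))) \<partial>M) \<partial>M)"
    by (intro nn_integral_cong B[unfolded mecke_def, rule_format, of "\<lambda>b. h (A _ + b)"])
  also have "\<dots> = ennreal \<alpha>' * (\<integral>\<^sup>+\<omega>'. (\<integral>\<^sup>+\<omega>. h (A \<omega>' + (B \<omega> + (1, 0))) \<partial>M) \<partial>M) + ennreal \<beta>' * (\<integral>\<^sup>+\<omega>'. (\<integral>\<^sup>+\<omega>. h (A \<omega>' + (B \<omega> + (1, 1))) \<partial>M) \<partial>M)"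
    by (intro nn_integral_linear2 measurable_compose_discrete[OF \<open>A \<in> _\<close> space_borel])
  also have "(\<integral>\<^sup>+\<omega>'. (\<integral>\<^sup>+\<omega>. h (A \<omega>' + (B \<omega> + (1, 0))) \<partial>M) \<partial>M) = (\<integral>\<^sup>+\<omega>. h (A \<omega> + B \<omega> + (1, 0)) \<partial>M)"
    using I(1)[of "\<lambda>a b. h (a + (b + (1, 0)))"] by (simp add: add_ac)
  also have "(\<integral>\<^sup>+\<omega>'. (\<integral>\<^sup>+\<omega>. h (A \<omega>' + (B \<omega> + (1, 1))) \<partial>M) \<partial>M) = (\<integral>\<^sup>+\<omega>. h (A \<omega> + B \<omega> + (1, 1)) \<partial>M)"
    using I(1)[of "\<lambda>a b. h (a + (b + (1, 1)))"] by (simp add: add_ac)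
  finally have 2: "(\<integral>\<^sup>+\<omega>. of_nat (fst (B \<omega>)) * h (A \<omega> + B \<omega>) \<partial>M) =
     ennreal \<alpha>' * (\<integral>\<^sup>+\<omega>. h (A \<omega> + B \<omega> + (1, 0)) \<partial>M) + ennreal \<beta>' * (\<integral>\<^sup>+\<omega>. h (A \<omega> + B \<omega> + (1, 1)) \<partial>M)" .
  have m: "(\<lambda>\<omega>. of_nat (fst (A \<omega>)) * h (A \<omega> + B \<omega>)) \<in> borel_measurable M"
    "(\<lambda>\<omega>. of_nat (fst (B \<omega>)) * h (A \<omega> + B \<omega>)) \<in> borel_measurable M"
    using measurable_compose_discrete2[OF \<open>A \<in> _\<close> \<open>B \<in> _\<close> space_borel, of "\<lambda>a b. of_nat (fst a) * h (a + b)"]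
      measurable_compose_discrete2[OF \<open>A \<in> _\<close> \<open>B \<in> _\<close> space_borel, of "\<lambda>a b. of_nat (fst b) * h (a + b)"]
    by simp_all
  have "(\<integral>\<^sup>+\<omega>. of_nat (fst (A \<omega> + B \<omega>)) * h (A \<omega> + B \<omega>) \<partial>M) =
    (\<integral>\<^sup>+\<omega>. of_nat (fst (A \<omega>)) * h (A \<omega> + B \<omega>) \<partial>M) + (\<integral>\<^sup>+\<omega>. of_nat (fst (B \<omega>)) * h (A \<omega> + B \<omega>) \<partial>M)"
    using m by (subst nn_integral_add [symmetric]) (simp_all add: distrib_right)
  then show "(\<integral>\<^sup>+\<omega>. of_nat (fst (A \<omega> + B \<omega>)) * h (A \<omega> + B \<omega>) \<partial>M) =
    ennreal (\<alpha> + \<alpha>') * (\<integral>\<^sup>+\<omega>. h (A \<omega> + B \<omega> + (1, 0)) \<partial>M) + ennreal (\<beta> + \<beta>') * (\<integral>\<^sup>+\<omega>. h (A \<omega> + B \<omega> + (1, 1)) \<partial>M)"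
    unfolding 1 2 using nonneg by (simp add: ennreal_plus algebra_simps)
qed

text \<open>Each of the k points contributes the same term: the counted point becomes deterministic
  and k - 1 others remain.\<close>

lemma nn_integral_partial_sum_mecke:
  fixes Z :: "nat \<Rightarrow> 'a \<Rightarrow> nat \<times> nat"
  assumes ind: "\<And>k. indep_var (count_space UNIV) (\<lambda>\<omega>. \<Sum>i<k. Z i \<omega>) (count_space UNIV) (Z k)"
    and iid: "\<And>k l (g :: nat \<times> nat \<Rightarrow> ennreal). (\<integral>\<^sup>+\<omega>. g (Z k \<omega>) \<partial>M) = (\<integral>\<^sup>+\<omega>. g (Z l \<omega>) \<partial>M)"
    and law: "\<And>k g. (\<integral>\<^sup>+\<omega>. of_nat (fst (Z k \<omega>)) * g (Z k \<omega>) \<partial>M) = ennreal p * g (1, 0) + ennreal q * g (1, 1)"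
  shows "(\<integral>\<^sup>+\<omega>. of_nat (fst (\<Sum>i<k. Z i \<omega>)) * h (\<Sum>i<k. Z i \<omega>) \<partial>M) =
    of_nat k * (ennreal p * (\<integral>\<^sup>+\<omega>. h ((\<Sum>i<k - 1. Z i \<omega>) + (1, 0)) \<partial>M) + ennreal q * (\<integral>\<^sup>+\<omega>. h ((\<Sum>i<k - 1. Z i \<omega>) + (1, 1)) \<partial>M))"
proof (induction k arbitrary: h)
  case (Suc k)
  define T where "T k \<omega> = (\<Sum>i<k. Z i \<omega>)" for k \<omega>
  note I = nn_integral_indep[OF ind[folded T_def]]
  have [measurable]: "T k \<in> M \<rightarrow>\<^sub>M count_space UNIV" "Z k \<in> M \<rightarrow>\<^sub>M count_space UNIV" for k
    using ind by (auto simp: indep_var_distribution_eq T_def [abs_def])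
  \<comment> \<open>The induction hypothesis leaves the points below k - 1 together with point k.
    Equality in law trades the latter for point k - 1, and independence reassembles the sum of the
    first k.\<close>
  have shift: "(\<integral>\<^sup>+\<omega>'. (\<integral>\<^sup>+\<omega>. h (T (k - 1) \<omega> + z + Z k \<omega>') \<partial>M) \<partial>M) = (\<integral>\<^sup>+\<omega>. h (T k \<omega> + z) \<partial>M)" if "k > 0" for z
  proof -
    obtain j where j: "k = Suc j" using \<open>k > 0\<close> by (cases k) auto
    have "(\<integral>\<^sup>+\<omega>'. (\<integral>\<^sup>+\<omega>. h (T (k - 1) \<omega> + z + Z k \<omega>') \<partial>M) \<partial>M) = (\<integral>\<^sup>+\<omega>'. (\<integral>\<^sup>+\<omega>. h (T j \<omega> + z + Z j \<omega>') \<partial>M) \<partial>M)"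
      unfolding j diff_Suc_1 by (rule iid[of "\<lambda>x. \<integral>\<^sup>+\<omega>. h (T j \<omega> + z + x) \<partial>M"])
    also have "\<dots> = (\<integral>\<^sup>+\<omega>. h (T k \<omega> + z) \<partial>M)"
      using I(2)[of "\<lambda>a b. h (a + z + b)" j] by (simp add: T_def j add_ac)
    finally show ?thesis .
  qed
  have "(\<integral>\<^sup>+\<omega>. of_nat (fst (T k \<omega>)) * h (T k \<omega> + Z k \<omega>) \<partial>M) =
     (\<integral>\<^sup>+\<omega>'. (\<integral>\<^sup>+\<omega>. of_nat (fst (T k \<omega>)) * h (T k \<omega> + Z k \<omega>') \<partial>M) \<partial>M)"
    by (rule I(2)[of "\<lambda>a b. of_nat (fst a) * h (a + b)"])
  also have "\<dots> = (\<integral>\<^sup>+\<omega>'. of_nat k * (ennreal p * (\<integral>\<^sup>+\<omega>. h (T (k - 1) \<omega> + (1, 0) + Z k \<omega>') \<partial>M) + ennreal q * (\<integral>\<^sup>+\<omega>. h (T (k - 1) \<omega> + (1, 1) + Z k \<omega>') \<partial>M)) \<partial>M)"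
    by (intro nn_integral_cong Suc.IH[folded T_def, of "\<lambda>a. h (a + Z k _)"])
  also have "\<dots> = of_nat k * (ennreal p * (\<integral>\<^sup>+\<omega>'. (\<integral>\<^sup>+\<omega>. h (T (k - 1) \<omega> + (1, 0) + Z k \<omega>') \<partial>M) \<partial>M) + ennreal q * (\<integral>\<^sup>+\<omega>'. (\<integral>\<^sup>+\<omega>. h (T (k - 1) \<omega> + (1, 1) + Z k \<omega>') \<partial>M) \<partial>M))"
  proof -
    have Zk: "Z k \<in> M \<rightarrow>\<^sub>M count_space UNIV" by simp
    note m = measurable_compose_discrete[OF Zk space_borel]
    show ?thesis
      by (subst nn_integral_cmult) (intro borel_measurable_add borel_measurable_times m borel_measurable_const,
        subst nn_integral_linear2, intro m, intro m, rule refl)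
  qed
  \<comment> \<open>For k = 0 the truncated \<open>k - 1\<close> does no harm, as the prefactor
    vanishes.\<close>
  also have "\<dots> = of_nat k * (ennreal p * (\<integral>\<^sup>+\<omega>. h (T k \<omega> + (1, 0)) \<partial>M) + ennreal q * (\<integral>\<^sup>+\<omega>. h (T k \<omega> + (1, 1)) \<partial>M))"
    by (cases "k > 0") (simp_all only: shift, simp)
  finally have 1: "(\<integral>\<^sup>+\<omega>. of_nat (fst (T k \<omega>)) * h (T k \<omega> + Z k \<omega>) \<partial>M) =
    of_nat k * (ennreal p * (\<integral>\<^sup>+\<omega>. h (T k \<omega> + (1, 0)) \<partial>M) + ennreal q * (\<integral>\<^sup>+\<omega>. h (T k \<omega> + (1, 1)) \<partial>M))" .
  have "(\<integral>\<^sup>+\<omega>. of_nat (fst (Z k \<omega>)) * h (T k \<omega> + Z k \<omega>) \<partial>M) =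
     (\<integral>\<^sup>+\<omega>'. (\<integral>\<^sup>+\<omega>. of_nat (fst (Z k \<omega>)) * h (T k \<omega>' + Z k \<omega>) \<partial>M) \<partial>M)"
    by (rule I(1)[of "\<lambda>a b. of_nat (fst b) * h (a + b)"])
  also have "\<dots> = (\<integral>\<^sup>+\<omega>'. ennreal p * h (T k \<omega>' + (1, 0)) + ennreal q * h (T k \<omega>' + (1, 1)) \<partial>M)"
    by (intro nn_integral_cong law)
  also have "\<dots> = ennreal p * (\<integral>\<^sup>+\<omega>. h (T k \<omega> + (1, 0)) \<partial>M) + ennreal q * (\<integral>\<^sup>+\<omega>. h (T k \<omega> + (1, 1)) \<partial>M)"
  proof -
    have Tk: "T k \<in> M \<rightarrow>\<^sub>M count_space UNIV" by simp
    show ?thesis by (intro nn_integral_linear2 measurable_compose_discrete[OF Tk space_borel])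
  qed
  finally have 2: "(\<integral>\<^sup>+\<omega>. of_nat (fst (Z k \<omega>)) * h (T k \<omega> + Z k \<omega>) \<partial>M) =
    ennreal p * (\<integral>\<^sup>+\<omega>. h (T k \<omega> + (1, 0)) \<partial>M) + ennreal q * (\<integral>\<^sup>+\<omega>. h (T k \<omega> + (1, 1)) \<partial>M)" .
  have m: "(\<lambda>\<omega>. of_nat (fst (T k \<omega>)) * h (T k \<omega> + Z k \<omega>)) \<in> borel_measurable M"
    "(\<lambda>\<omega>. of_nat (fst (Z k \<omega>)) * h (T k \<omega> + Z k \<omega>)) \<in> borel_measurable M"
    using measurable_compose_discrete2[of "T k" M "Z k" borel "\<lambda>a b. of_nat (fst a) * h (a + b)"]
      measurable_compose_discrete2[of "T k" M "Z k" borel "\<lambda>a b. of_nat (fst b) * h (a + b)"]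
    by simp_all
  have "(\<integral>\<^sup>+\<omega>. of_nat (fst (T (Suc k) \<omega>)) * h (T (Suc k) \<omega>) \<partial>M) =
    (\<integral>\<^sup>+\<omega>. of_nat (fst (T k \<omega>)) * h (T k \<omega> + Z k \<omega>) \<partial>M) + (\<integral>\<^sup>+\<omega>. of_nat (fst (Z k \<omega>)) * h (T k \<omega> + Z k \<omega>) \<partial>M)"
    using m by (subst nn_integral_add [symmetric]) (simp_all add: distrib_right T_def)
  also have "\<dots> = of_nat (Suc k) * (ennreal p * (\<integral>\<^sup>+\<omega>. h (T k \<omega> + (1, 0)) \<partial>M) + ennreal q * (\<integral>\<^sup>+\<omega>. h (T k \<omega> + (1, 1)) \<partial>M))"
    unfolding 1 2 of_nat_Suc distrib_right by (simp add: add.commute)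
  finally show ?case by (simp add: T_def)
qed simp

text \<open>Splitting over the values of K replaces the random index by fixed ones. K is padded to a
  pair since both variables of \<open>indep_var\<close> have one value type.\<close>

lemma nn_integral_random_index:
  fixes K :: "'a \<Rightarrow> nat" and T :: "nat \<Rightarrow> 'a \<Rightarrow> nat \<times> nat"
  assumes ind: "\<And>k. indep_var (count_space UNIV) (\<lambda>\<omega>. (K \<omega>, 0)) (count_space UNIV) (T k)"
    and K: "distr M (count_space UNIV) K = measure_pmf P"
  shows "(\<integral>\<^sup>+\<omega>. f (T (K \<omega>) \<omega>) \<partial>M) = (\<integral>\<^sup>+k. (\<integral>\<^sup>+\<omega>. f (T k \<omega>) \<partial>M) \<partial>P)"
proof -
  have "(\<lambda>\<omega>. (K \<omega>, 0 :: nat)) \<in> M \<rightarrow>\<^sub>M count_space UNIV" and [measurable]: "T k \<in> M \<rightarrow>\<^sub>M count_space UNIV" for k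
    using ind by (auto simp: indep_var_distribution_eq)
  from measurable_compose[OF this(1), of fst "count_space UNIV"]
  have [measurable]: "K \<in> M \<rightarrow>\<^sub>M count_space UNIV" by simp
  have "(\<integral>\<^sup>+\<omega>. f (T (K \<omega>) \<omega>) \<partial>M) = (\<integral>\<^sup>+\<omega>. (\<Sum>k. if k = K \<omega> then f (T k \<omega>) else 0) \<partial>M)"
    by (intro nn_integral_cong sums_unique[OF sums_single])
  also have "\<dots> = (\<Sum>k. \<integral>\<^sup>+\<omega>. (if k = K \<omega> then f (T k \<omega>) else 0) \<partial>M)"
  proof (rule nn_integral_suminf)
    fix k
    have "(\<lambda>\<omega>. f (T k \<omega>)) \<in> borel_measurable M" by (rule measurable_compose_discrete) simp_all
    then show "(\<lambda>\<omega>. if k = K \<omega> then f (T k \<omega>) else 0) \<in> borel_measurable M" by measurable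
  qed
  also have "\<dots> = (\<Sum>k. ennreal (pmf P k) * (\<integral>\<^sup>+\<omega>. f (T k \<omega>) \<partial>M))"
  proof (intro suminf_cong)
    fix k
    have "(\<integral>\<^sup>+\<omega>. (if k = K \<omega> then f (T k \<omega>) else 0) \<partial>M) = (\<integral>\<^sup>+\<omega>. (\<integral>\<^sup>+\<omega>'. (if k = K \<omega> then f (T k \<omega>') else 0) \<partial>M) \<partial>M)"
      by (rule nn_integral_indep(1)[OF ind, of "\<lambda>a b. if k = fst a then f b else 0", unfolded fst_conv])
    also have "\<dots> = (\<integral>\<^sup>+\<omega>. indicator {k} (K \<omega>) * (\<integral>\<^sup>+\<omega>'. f (T k \<omega>') \<partial>M) \<partial>M)"
    proof (intro nn_integral_cong)
      fix \<omega>
      show "(\<integral>\<^sup>+\<omega>'. (if k = K \<omega> then f (T k \<omega>') else 0) \<partial>M) = indicator {k} (K \<omega>) * (\<integral>\<^sup>+\<omega>'. f (T k \<omega>') \<partial>M)"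
        by (cases "k = K \<omega>") auto
    qed
    also have "\<dots> = (\<integral>\<^sup>+x. indicator {k} x * (\<integral>\<^sup>+\<omega>'. f (T k \<omega>') \<partial>M) \<partial>measure_pmf P)"
      unfolding K [symmetric] by (subst nn_integral_distr) auto
    also have "\<dots> = ennreal (pmf P k) * (\<integral>\<^sup>+\<omega>. f (T k \<omega>) \<partial>M)"
      by (simp add: nn_integral_multc emeasure_pmf_single)
    finally show "(\<integral>\<^sup>+\<omega>. (if k = K \<omega> then f (T k \<omega>) else 0) \<partial>M) = ennreal (pmf P k) * (\<integral>\<^sup>+\<omega>. f (T k \<omega>) \<partial>M)" .
  qed
  also have "\<dots> = (\<integral>\<^sup>+k. (\<integral>\<^sup>+\<omega>. f (T k \<omega>) \<partial>M) \<partial>P)"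
    by (simp add: nn_integral_measure_pmf nn_integral_count_space_nat)
  finally show ?thesis .
qed

text \<open>Given K = k the left side is \<open>k * H (k - 1)\<close>; the Poisson identity
  E[K H(K - 1)] = R E[H(K)] then restores the original random number of points.\<close>

lemma mecke_compound_poisson:
  fixes Z :: "nat \<Rightarrow> 'a \<Rightarrow> nat \<times> nat"
  assumes ind: "\<And>k. indep_var (count_space UNIV) (\<lambda>\<omega>. \<Sum>i<k. Z i \<omega>) (count_space UNIV) (Z k)"
    and iid: "\<And>k l (g :: nat \<times> nat \<Rightarrow> ennreal). (\<integral>\<^sup>+\<omega>. g (Z k \<omega>) \<partial>M) = (\<integral>\<^sup>+\<omega>. g (Z l \<omega>) \<partial>M)"
    and law: "\<And>k g. (\<integral>\<^sup>+\<omega>. of_nat (fst (Z k \<omega>)) * g (Z k \<omega>) \<partial>M) = ennreal p * g (1, 0) + ennreal q * g (1, 1)"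
    and indK: "\<And>k. indep_var (count_space UNIV) (\<lambda>\<omega>. (K \<omega>, 0)) (count_space UNIV) (\<lambda>\<omega>. \<Sum>i<k. Z i \<omega>)"
    and K: "distr M (count_space UNIV) K = measure_pmf (poisson_pmf R)" and "R > 0" "p \<ge> 0" "q \<ge> 0"
  shows "mecke M (\<lambda>\<omega>. \<Sum>i<K \<omega>. Z i \<omega>) (R * p) (R * q)"
  unfolding mecke_def
proof
  fix h :: "nat \<times> nat \<Rightarrow> ennreal"
  define H where "H k = ennreal p * (\<integral>\<^sup>+\<omega>. h ((\<Sum>i<k. Z i \<omega>) + (1, 0)) \<partial>M) + ennreal q * (\<integral>\<^sup>+\<omega>. h ((\<Sum>i<k. Z i \<omega>) + (1, 1)) \<partial>M)" for k
  note RI = nn_integral_random_index[OF indK K]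
  have "(\<integral>\<^sup>+\<omega>. of_nat (fst (\<Sum>i<K \<omega>. Z i \<omega>)) * h (\<Sum>i<K \<omega>. Z i \<omega>) \<partial>M) =
     (\<integral>\<^sup>+k. (\<integral>\<^sup>+\<omega>. of_nat (fst (\<Sum>i<k. Z i \<omega>)) * h (\<Sum>i<k. Z i \<omega>) \<partial>M) \<partial>poisson_pmf R)"
    by (rule RI[of "\<lambda>x. of_nat (fst x) * h x"])
  also have "\<dots> = (\<integral>\<^sup>+k. of_nat k * H (k - 1) \<partial>poisson_pmf R)"
    unfolding nn_integral_partial_sum_mecke[OF ind iid law] H_def ..
  also have "\<dots> = ennreal R * (\<integral>\<^sup>+k. H k \<partial>poisson_pmf R)"
    using nn_integral_poisson_mecke[OF \<open>R > 0\<close>, of "\<lambda>k. H (k - 1)"] by simp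
  also have "\<dots> = ennreal R * (ennreal p * (\<integral>\<^sup>+\<omega>. h ((\<Sum>i<K \<omega>. Z i \<omega>) + (1, 0)) \<partial>M) + ennreal q * (\<integral>\<^sup>+\<omega>. h ((\<Sum>i<K \<omega>. Z i \<omega>) + (1, 1)) \<partial>M))"
  proof -
    have "(\<integral>\<^sup>+\<omega>. h ((\<Sum>i<K \<omega>. Z i \<omega>) + z) \<partial>M) = (\<integral>\<^sup>+k. (\<integral>\<^sup>+\<omega>. h ((\<Sum>i<k. Z i \<omega>) + z) \<partial>M) \<partial>poisson_pmf R)" for z
      by (rule RI[of "\<lambda>x. h (x + z)"])
    then show ?thesis unfolding H_def by (subst nn_integral_linear2) simp_all
  qed
  finally show "(\<integral>\<^sup>+\<omega>. of_nat (fst (\<Sum>i<K \<omega>. Z i \<omega>)) * h (\<Sum>i<K \<omega>. Z i \<omega>) \<partial>M) =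
    ennreal (R * p) * (\<integral>\<^sup>+\<omega>. h ((\<Sum>i<K \<omega>. Z i \<omega>) + (1, 0)) \<partial>M) + ennreal (R * q) * (\<integral>\<^sup>+\<omega>. h ((\<Sum>i<K \<omega>. Z i \<omega>) + (1, 1)) \<partial>M)"
    using assms by (simp add: distrib_left ennreal_mult mult.assoc)
qed

end

section \<open>Joint laws of a random walk\<close>

context prob_space
begin

lemma indep_var_blocks:
  assumes "indep_vars (\<lambda>_. count_space UNIV) U I" "A \<inter> B = {}" "A \<subseteq> I" "B \<subseteq> I"
    and "F \<in> (\<Pi>\<^sub>M i\<in>A. count_space UNIV) \<rightarrow>\<^sub>M L" "G \<in> (\<Pi>\<^sub>M i\<in>B. count_space UNIV) \<rightarrow>\<^sub>M L'"
  shows "indep_var L (\<lambda>\<omega>. F (\<lambda>i\<in>A. U i \<omega>)) L' (\<lambda>\<omega>. G (\<lambda>i\<in>B. U i \<omega>))"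
  using indep_var_compose[OF indep_var_restrict[OF assms(1-4)] assms(5,6)] by (simp add: comp_def)

context
  fixes x :: int and W :: "nat \<Rightarrow> 'a \<Rightarrow> int"
  assumes walk: "simple_random_walk x W"
begin

lemma walk_measurable [measurable]: "W n \<in> M \<rightarrow>\<^sub>M count_space UNIV"
  using walk by (simp add: simple_random_walk_def)

lemma walk_step_measurable: "(\<lambda>\<omega>. W (Suc n) \<omega> - W n \<omega>) \<in> M \<rightarrow>\<^sub>M count_space UNIV"
  by (rule measurable_compose_discrete2[OF walk_measurable walk_measurable]) simp

lemma walk_step_law: "distr M (count_space UNIV) (\<lambda>\<omega>. W (Suc n) \<omega> - W n \<omega>) = measure_pmf (pmf_of_set {- 1, 1})"
  using walk unfolding simple_random_walk_def by blast

lemma prob_walk_step: "prob {\<omega> \<in> space M. W (Suc n) \<omega> - W n \<omega> = d} = (if d \<in> {- 1, 1} then 1 / 2 else 0)"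
proof -
  have "prob {\<omega> \<in> space M. W (Suc n) \<omega> - W n \<omega> = d} = measure (distr M (count_space UNIV) (\<lambda>\<omega>. W (Suc n) \<omega> - W n \<omega>)) {d}"
    by (subst measure_distr[OF walk_step_measurable]) (auto intro!: arg_cong[of _ _ prob])
  also have "\<dots> = pmf (pmf_of_set {- 1, 1}) d"
    unfolding walk_step_law by (simp add: measure_pmf_single)
  finally show ?thesis by (auto simp: indicator_def)
qed

lemma AE_walk_step: "AE \<omega> in M. W (Suc n) \<omega> - W n \<omega> \<in> {- 1, 1}"
proof -
  have "AE d in distr M (count_space UNIV) (\<lambda>\<omega>. W (Suc n) \<omega> - W n \<omega>). d \<in> {- 1, 1}"
    unfolding walk_step_law using AE_measure_pmf[of "pmf_of_set {- 1, 1 :: int}"] by simp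
  then show ?thesis by (subst (asm) AE_distr_iff[OF walk_step_measurable]) auto
qed

lemma AE_walk_start: "AE \<omega> in M. W 0 \<omega> = x"
  using walk by (simp add: simple_random_walk_def)

lemma AE_walk_range: "AE \<omega> in M. \<bar>W n \<omega> - x\<bar> \<le> int n"
proof (induction n)
  case 0
  show ?case using AE_walk_start by eventually_elim simp
next
  case (Suc n)
  with AE_walk_step[of n] show ?case by eventually_elim auto
qed

text \<open>The last increment is independent of the first n, which determine both earlier
  positions. Keeping \<open>W m\<close> in the event is what later yields the two-time law.\<close>

lemma prob_walk_Suc:
  assumes "m \<le> n"
  shows "prob {\<omega> \<in> space M. W m \<omega> = a \<and> W n \<omega> = b - d \<and> W (Suc n) \<omega> - W n \<omega> = d}
    = prob {\<omega> \<in> space M. W m \<omega> = a \<and> W n \<omega> = b - d} * (if d \<in> {- 1, 1} then 1 / 2 else 0)"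
proof -
  define D where "D i \<omega> = W (Suc i) \<omega> - W i \<omega>" for i \<omega>
  \<comment> \<open>Positions are read off increments with the start fixed at x, which is right
    almost surely. The indicator is an integer to share its type with the last increment.\<close>
  define F where "F f = (of_bool (x + (\<Sum>i<m. f i) = a \<and> x + (\<Sum>i<n. f i) = b - d) :: int)" for f
  have tele: "W k \<omega> = W 0 \<omega> + (\<Sum>i<k. D i \<omega>)" for k \<omega>
    by (induction k) (simp_all add: D_def)
  have F: "F (\<lambda>i\<in>{..<n}. D i \<omega>) = of_bool (x + (\<Sum>i<m. D i \<omega>) = a \<and> x + (\<Sum>i<n. D i \<omega>) = b - d)" for \<omega>
    using assms by (simp add: F_def)
  have Fm: "F \<in> (\<Pi>\<^sub>M i\<in>{..<n}. count_space UNIV) \<rightarrow>\<^sub>M count_space UNIV"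
  proof -
    have "(\<lambda>f. \<Sum>i<k. f i :: int) \<in> (\<Pi>\<^sub>M i\<in>{..<n}. count_space UNIV) \<rightarrow>\<^sub>M count_space UNIV" if "k \<le> n" for k
      by (rule measurable_sum_discrete, rule measurable_component_singleton) (use that in auto)
    then show ?thesis unfolding F_def using assms
      by (intro measurable_compose_discrete2[where f = "\<lambda>u v. of_bool (x + u = a \<and> x + v = b - d)"]) auto
  qed
  have "indep_vars (\<lambda>_. count_space UNIV) D UNIV"
    using walk by (simp add: simple_random_walk_def D_def [abs_def])
  from indep_var_blocks[OF this, of "{..<n}" "{n}", OF _ _ _ Fm, of "\<lambda>f. f n" "count_space UNIV"]
  have ind: "indep_var (count_space UNIV) (\<lambda>\<omega>. F (\<lambda>i\<in>{..<n}. D i \<omega>)) (count_space UNIV) (D n)"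
    by (simp add: measurable_component_singleton)
  have [measurable]: "D i \<in> M \<rightarrow>\<^sub>M count_space UNIV" for i
    unfolding D_def by (rule walk_step_measurable)
  have [measurable]: "(\<lambda>\<omega>. F (\<lambda>i\<in>{..<n}. D i \<omega>)) \<in> M \<rightarrow>\<^sub>M count_space UNIV"
    using ind by (simp add: indep_var_distribution_eq)
  have s1: "{\<omega> \<in> space M. F (\<lambda>i\<in>{..<n}. D i \<omega>) = 1} \<in> events" by measurable
  have s2: "{\<omega> \<in> space M. F (\<lambda>i\<in>{..<n}. D i \<omega>) = 1 \<and> D n \<omega> = d} \<in> events" by measurable
  have "prob {\<omega> \<in> space M. W m \<omega> = a \<and> W n \<omega> = b - d \<and> W (Suc n) \<omega> - W n \<omega> = d}
     = prob {\<omega> \<in> space M. F (\<lambda>i\<in>{..<n}. D i \<omega>) = 1 \<and> D n \<omega> = d}"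
  proof (rule finite_measure_eq_AE[OF _ _ s2])
    show "AE \<omega> in M. \<omega> \<in> {\<omega> \<in> space M. W m \<omega> = a \<and> W n \<omega> = b - d \<and> W (Suc n) \<omega> - W n \<omega> = d} \<longleftrightarrow>
      \<omega> \<in> {\<omega> \<in> space M. F (\<lambda>i\<in>{..<n}. D i \<omega>) = 1 \<and> D n \<omega> = d}"
      using AE_walk_start
    proof eventually_elim
      case (elim \<omega>)
      then show ?case unfolding F using tele[of m \<omega>] tele[of n \<omega>] by (auto simp: D_def)
    qed
  qed measurable
  also have "\<dots> = prob {\<omega> \<in> space M. F (\<lambda>i\<in>{..<n}. D i \<omega>) = 1} * prob {\<omega> \<in> space M. D n \<omega> = d}"
  proof -
    have "{\<omega> \<in> space M. F (\<lambda>i\<in>{..<n}. D i \<omega>) = 1 \<and> D n \<omega> = d} = (\<lambda>\<omega>. (F (\<lambda>i\<in>{..<n}. D i \<omega>), D n \<omega>)) -` ({1} \<times> {d}) \<inter> space M"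
      "{\<omega> \<in> space M. F (\<lambda>i\<in>{..<n}. D i \<omega>) = 1} = (\<lambda>\<omega>. F (\<lambda>i\<in>{..<n}. D i \<omega>)) -` {1} \<inter> space M"
      "{\<omega> \<in> space M. D n \<omega> = d} = D n -` {d} \<inter> space M" by auto
    then show ?thesis using indep_varD[OF ind, of "{1}" "{d}"] by simp
  qed
  also have "prob {\<omega> \<in> space M. D n \<omega> = d} = (if d \<in> {- 1, 1} then 1 / 2 else 0)"
    unfolding D_def by (rule prob_walk_step)
  also have "prob {\<omega> \<in> space M. F (\<lambda>i\<in>{..<n}. D i \<omega>) = 1} = prob {\<omega> \<in> space M. W m \<omega> = a \<and> W n \<omega> = b - d}"
  proof (rule finite_measure_eq_AE[OF _ s1])
    show "AE \<omega> in M. \<omega> \<in> {\<omega> \<in> space M. F (\<lambda>i\<in>{..<n}. D i \<omega>) = 1} \<longleftrightarrow> \<omega> \<in> {\<omega> \<in> space M. W m \<omega> = a \<and> W n \<omega> = b - d}"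
      using AE_walk_start
    proof eventually_elim
      case (elim \<omega>)
      then show ?case unfolding F using tele[of m \<omega>] tele[of n \<omega>] by auto
    qed
  qed measurable
  finally show ?thesis .
qed

lemma prob_walk_joint_step:
  assumes "m \<le> n"
  shows "prob {\<omega> \<in> space M. W m \<omega> = a \<and> W (Suc n) \<omega> = b} =
    (prob {\<omega> \<in> space M. W m \<omega> = a \<and> W n \<omega> = b - 1} + prob {\<omega> \<in> space M. W m \<omega> = a \<and> W n \<omega> = b + 1}) / 2"
proof -
  let ?E = "\<lambda>d. {\<omega> \<in> space M. W m \<omega> = a \<and> W n \<omega> = b - d \<and> W (Suc n) \<omega> - W n \<omega> = d}"
  have "prob {\<omega> \<in> space M. W m \<omega> = a \<and> W (Suc n) \<omega> = b} = prob (?E 1 \<union> ?E (- 1))"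
  proof (rule finite_measure_eq_AE)
    show "AE \<omega> in M. \<omega> \<in> {\<omega> \<in> space M. W m \<omega> = a \<and> W (Suc n) \<omega> = b} \<longleftrightarrow> \<omega> \<in> ?E 1 \<union> ?E (- 1)"
      using AE_walk_step[of n] by eventually_elim auto
  qed measurable
  also have "\<dots> = prob (?E 1) + prob (?E (- 1))"
    by (rule finite_measure_Union) (measurable, auto)
  finally show ?thesis unfolding prob_walk_Suc[OF assms] by simp
qed

lemma prob_walk: "prob {\<omega> \<in> space M. W n \<omega> = a} = walk_prob n (a - x)"
proof (induction n arbitrary: a)
  case 0
  have "prob {\<omega> \<in> space M. W 0 \<omega> = a} = prob {\<omega> \<in> space M. x = a}"
  proof (rule finite_measure_eq_AE)
    show "AE \<omega> in M. \<omega> \<in> {\<omega> \<in> space M. W 0 \<omega> = a} \<longleftrightarrow> \<omega> \<in> {\<omega> \<in> space M. x = a}"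
      using AE_walk_start by eventually_elim auto
  qed measurable
  then show ?case by (auto simp: prob_space)
next
  case (Suc n)
  \<comment> \<open>Repeating the condition on \<open>W n\<close> gives the event of
    \<open>prob_walk_Suc\<close> with m = n.\<close>
  let ?E = "\<lambda>d. {\<omega> \<in> space M. W n \<omega> = a - d \<and> W n \<omega> = a - d \<and> W (Suc n) \<omega> - W n \<omega> = d}"
  have "prob {\<omega> \<in> space M. W (Suc n) \<omega> = a} = prob (?E 1 \<union> ?E (- 1))"
  proof (rule finite_measure_eq_AE)
    show "AE \<omega> in M. \<omega> \<in> {\<omega> \<in> space M. W (Suc n) \<omega> = a} \<longleftrightarrow> \<omega> \<in> ?E 1 \<union> ?E (- 1)"
      using AE_walk_step[of n] by eventually_elim auto
  qed measurable
  also have "\<dots> = prob (?E 1) + prob (?E (- 1))"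
    by (rule finite_measure_Union) (measurable, auto)
  also have "\<dots> = (prob {\<omega> \<in> space M. W n \<omega> = a - 1} + prob {\<omega> \<in> space M. W n \<omega> = a + 1}) / 2"
    unfolding prob_walk_Suc[OF order_refl] by simp
  finally show ?case unfolding Suc by (simp add: algebra_simps)
qed

text \<open>For fixed m both sides satisfy the one-step recursion in n and b, starting from n =
  m.\<close>

lemma prob_walk_joint:
  assumes "m \<le> n"
  shows "prob {\<omega> \<in> space M. W m \<omega> = a \<and> W n \<omega> = b} = walk_prob m (a - x) * walk_prob (n - m) (b - a)"
  using assms
proof (induction n arbitrary: b rule: dec_induct)
  case base
  have "{\<omega> \<in> space M. W m \<omega> = a \<and> W m \<omega> = b} = (if a = b then {\<omega> \<in> space M. W m \<omega> = a} else {})"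
    by auto
  then show ?case by (simp add: prob_walk)
next
  case (step n)
  then show ?case
    unfolding prob_walk_joint_step[OF step.hyps(1)] step.IH by (simp add: Suc_diff_le algebra_simps)
qed

end

end

section \<open>Occupation numbers\<close>

lemma vimage_algebra_compose:
  assumes "f \<in> \<Omega> \<rightarrow> space N" "g \<in> N \<rightarrow>\<^sub>M L" "A \<in> sets L"
  shows "(\<lambda>\<omega>. g (f \<omega>)) -` A \<inter> \<Omega> \<in> sets (vimage_algebra \<Omega> f N)"
  using measurable_sets[OF measurable_compose[OF measurable_vimage_algebra1[OF assms(1)] assms(2)] assms(3)] by simp

lemma measurable_pair_encode:
  "(\<lambda>p :: nat \<Rightarrow> int. (of_bool (p m = a), of_bool (p n = b)) :: nat \<times> nat)
     \<in> (\<Pi>\<^sub>M n\<in>UNIV. count_space UNIV) \<rightarrow>\<^sub>M count_space UNIV"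
  by (rule measurable_compose_discrete2[where f = "\<lambda>u v. (of_bool (u = a), of_bool (v = b))"])
     (auto intro: measurable_component_singleton)

context poisson_walks
begin

text \<open>All sources are reduced to variables of one type, as \<open>indep_vars\<close> requires; a walk is only tested for its
  presence in \<open>a\<close> at time \<open>m\<close> and in \<open>b\<close> at time \<open>n\<close>.\<close>

definition encode :: "nat \<Rightarrow> int \<Rightarrow> nat \<Rightarrow> int \<Rightarrow> source \<Rightarrow> 'a \<Rightarrow> nat \<times> nat" where
  "encode m a n b s \<omega> = (case s of
      Count y \<Rightarrow> (\<eta> y \<omega>, 0)
    | Particle y i \<Rightarrow> (of_bool (X y i m \<omega> = a), of_bool (X y i n \<omega> = b))
    | Walker \<Rightarrow> (of_bool (S m \<omega> = a), of_bool (S n \<omega> = b)))"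

lemma measurable_particle [measurable]: "X y i n \<in> M \<rightarrow>\<^sub>M count_space UNIV"
  by (rule walk_measurable[OF particle_walk])

lemma measurable_walker [measurable]: "S n \<in> M \<rightarrow>\<^sub>M count_space UNIV"
  by (rule walk_measurable[OF walker_walk])

lemma measurable_count [measurable]: "\<eta> y \<in> M \<rightarrow>\<^sub>M count_space UNIV"
  by (rule count_measurable)

lemma measurable_encode: "encode m a n b s \<in> M \<rightarrow>\<^sub>M count_space UNIV"
proof (cases s)
  case (Count y)
  have "(\<lambda>\<omega>. (\<eta> y \<omega>, 0 :: nat)) \<in> M \<rightarrow>\<^sub>M count_space UNIV"
    by (rule measurable_compose_discrete) auto
  then show ?thesis by (simp add: encode_def [abs_def] Count)
next
  case (Particle y i)
  have "(\<lambda>\<omega>. (of_bool (X y i m \<omega> = a), of_bool (X y i n \<omega> = b)) :: nat \<times> nat) \<in> M \<rightarrow>\<^sub>M count_space UNIV"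
    by (rule measurable_compose_discrete2[where f = "\<lambda>u v. (of_bool (u = a), of_bool (v = b))"]) auto
  then show ?thesis by (simp add: encode_def [abs_def] Particle)
next
  case Walker
  have "(\<lambda>\<omega>. (of_bool (S m \<omega> = a), of_bool (S n \<omega> = b)) :: nat \<times> nat) \<in> M \<rightarrow>\<^sub>M count_space UNIV"
    by (rule measurable_compose_discrete2[where f = "\<lambda>u v. (of_bool (u = a), of_bool (v = b))"]) auto
  then show ?thesis by (simp add: encode_def [abs_def] Walker)
qed

text \<open>Each coded variable is a measurable function of its source and so generates a smaller
  sigma-algebra.\<close>

lemma indep_encode: "indep_vars (\<lambda>_. count_space UNIV) (encode m a n b) UNIV"
  unfolding indep_vars_def2
proof (intro conjI ballI measurable_encode indep_sets_mono_sets[OF independent])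
  let ?P = "\<Pi>\<^sub>M n\<in>(UNIV :: nat set). count_space (UNIV :: int set)"
  let ?c = "\<lambda>p :: nat \<Rightarrow> int. (of_bool (p m = a), of_bool (p n = b)) :: nat \<times> nat"
  fix s :: source
  show "{encode m a n b s -` A \<inter> space M |A. A \<in> sets (count_space UNIV)} \<subseteq>
    (case s of Count y \<Rightarrow> sets (vimage_algebra (space M) (\<eta> y) (count_space UNIV))
      | Particle y i \<Rightarrow> sets (vimage_algebra (space M) (\<lambda>\<omega> n. X y i n \<omega>) ?P)
      | Walker \<Rightarrow> sets (vimage_algebra (space M) (\<lambda>\<omega> n. S n \<omega>) ?P))"
  proof (cases s)
    case (Count y)
    have "(\<lambda>\<omega>. (\<eta> y \<omega>, 0 :: nat)) -` A \<inter> space M \<in> sets (vimage_algebra (space M) (\<eta> y) (count_space UNIV))" for A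
      by (rule vimage_algebra_compose[where g = "\<lambda>k. (k, 0)" and L = "count_space UNIV"]) auto
    then show ?thesis by (auto simp: Count encode_def [abs_def])
  next
    case (Particle y i)
    have "(\<lambda>\<omega>. ?c (\<lambda>n. X y i n \<omega>)) -` A \<inter> space M \<in> sets (vimage_algebra (space M) (\<lambda>\<omega> n. X y i n \<omega>) ?P)" for A
      by (rule vimage_algebra_compose[OF _ measurable_pair_encode]) (auto simp: space_PiM)
    then show ?thesis by (auto simp: Particle encode_def [abs_def])
  next
    case Walker
    have "(\<lambda>\<omega>. ?c (\<lambda>n. S n \<omega>)) -` A \<inter> space M \<in> sets (vimage_algebra (space M) (\<lambda>\<omega> n. S n \<omega>) ?P)" for A
      by (rule vimage_algebra_compose[OF _ measurable_pair_encode]) (auto simp: space_PiM)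
    then show ?thesis by (auto simp: Walker encode_def [abs_def])
  qed
qed

section \<open>Contributions of the starting sites\<close>

definition site_pair :: "nat \<Rightarrow> int \<Rightarrow> nat \<Rightarrow> int \<Rightarrow> int \<Rightarrow> 'a \<Rightarrow> nat \<times> nat" where
  "site_pair m a n b y \<omega> = (\<Sum>i<\<eta> y \<omega>. encode m a n b (Particle y i) \<omega>)"

text \<open>All labels of a site belong to its block, because the number of occupied ones is itself
  random.\<close>

definition site_sources :: "int set \<Rightarrow> source set" where
  "site_sources Y = Count ` Y \<union> (\<Union>y\<in>Y. range (Particle y))"

text \<open>Rebuilds the site sums from the coded sources alone, the particle count being the first
  component at \<open>Count y\<close>. This exhibits them as functions of a block of independent
  variables.\<close>

definition site_fun :: "int set \<Rightarrow> (source \<Rightarrow> nat \<times> nat) \<Rightarrow> nat \<times> nat" where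
  "site_fun Y f = (\<Sum>y\<in>Y. \<Sum>i<fst (f (Count y)). f (Particle y i))"

lemma measurable_site_fun: "site_fun Y \<in> (\<Pi>\<^sub>M s\<in>site_sources Y. count_space UNIV) \<rightarrow>\<^sub>M count_space UNIV"
  unfolding site_fun_def
proof (rule measurable_sum_discrete)
  fix y assume y: "y \<in> Y"
  let ?P = "\<Pi>\<^sub>M s\<in>site_sources Y. count_space (UNIV :: (nat \<times> nat) set)"
  have 1: "(\<lambda>f. \<Sum>i<k. f (Particle y i)) \<in> ?P \<rightarrow>\<^sub>M count_space UNIV" for k
    by (rule measurable_sum_discrete, rule measurable_component_singleton) (use y in \<open>auto simp: site_sources_def\<close>)
  have "(\<lambda>f. f (Count y)) \<in> ?P \<rightarrow>\<^sub>M count_space UNIV"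
    by (rule measurable_component_singleton) (use y in \<open>auto simp: site_sources_def\<close>)
  then have 2: "(\<lambda>f. fst (f (Count y))) \<in> ?P \<rightarrow>\<^sub>M count_space UNIV"
    by (rule measurable_compose_discrete) simp
  show "(\<lambda>f. \<Sum>i<fst (f (Count y)). f (Particle y i)) \<in> ?P \<rightarrow>\<^sub>M count_space UNIV"
    by (rule measurable_compose_countable[OF 1 2])
qed

lemma site_fun_encode:
  "site_fun Y (\<lambda>s\<in>site_sources Y. encode m a n b s \<omega>) = (\<Sum>y\<in>Y. site_pair m a n b y \<omega>)"
proof -
  have "(\<Sum>i<fst (if Count y \<in> site_sources Y then encode m a n b (Count y) \<omega> else undefined). if Particle y i \<in> site_sources Y then encode m a n b (Particle y i) \<omega> else undefined)
    = site_pair m a n b y \<omega>" if "y \<in> Y" for y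
  proof -
    have "Count y \<in> site_sources Y" "Particle y i \<in> site_sources Y" for i
      using that by (auto simp: site_sources_def)
    then show ?thesis by (simp add: site_pair_def encode_def)
  qed
  then show ?thesis unfolding site_fun_def restrict_def by (intro sum.cong) auto
qed

lemma prob_particle_joint:
  assumes "m \<le> n"
  shows "prob {\<omega> \<in> space M. X y i m \<omega> = a \<and> X y i n \<omega> = b} = walk_prob m (a - y) * walk_prob (n - m) (b - a)"
  by (rule prob_walk_joint[OF particle_walk assms])

text \<open>The pair of visit indicators has four atoms; p, q and r are the probabilities of the
  first, the second and both visits, and inclusion-exclusion gives the masses.\<close>

lemma nn_integral_encode_particle:
  fixes a b y :: int
  assumes "m \<le> n"
  defines "p \<equiv> walk_prob m (a - y)" and "q \<equiv> walk_prob n (b - y)" and "r \<equiv> walk_prob m (a - y) * walk_prob (n - m) (b - a)"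
  shows "(\<integral>\<^sup>+\<omega>. g (encode m a n b (Particle y i) \<omega>) \<partial>M) =
    ennreal (p - r) * g (1, 0) + ennreal r * g (1, 1) + ennreal (q - r) * g (0, 1) + ennreal (1 - p - q + r) * g (0, 0)"
proof -
  let ?A = "{\<omega> \<in> space M. X y i m \<omega> = a}" and ?B = "{\<omega> \<in> space M. X y i n \<omega> = b}"
  have [measurable]: "?A \<in> events" "?B \<in> events" by measurable
  have AB: "prob ?A = p" "prob ?B = q"
    by (auto simp: p_def q_def prob_walk[OF particle_walk])
  have "?A \<inter> ?B = {\<omega> \<in> space M. X y i m \<omega> = a \<and> X y i n \<omega> = b}" by auto
  then have I: "prob (?A \<inter> ?B) = r" by (simp add: r_def prob_particle_joint[OF assms(1)])
  have d: "prob (?A - ?B) = p - r" "prob (?B - ?A) = q - r"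
    using finite_measure_Diff'[of ?A ?B] finite_measure_Diff'[of ?B ?A] by (simp_all add: AB I Int_commute)
  have u: "prob (space M - (?A \<union> ?B)) = 1 - p - q + r"
  proof -
    have "prob (?A \<union> ?B) = p + q - r"
      using finite_measure_Union'[of ?A ?B] d(2) by (simp add: AB)
    then show ?thesis by (subst prob_compl) auto
  qed
  have "(\<integral>\<^sup>+\<omega>. g (encode m a n b (Particle y i) \<omega>) \<partial>M) =
    (\<integral>\<^sup>+\<omega>. g (1, 0) * indicator (?A - ?B) \<omega> + g (1, 1) * indicator (?A \<inter> ?B) \<omega> + g (0, 1) * indicator (?B - ?A) \<omega> +
       g (0, 0) * indicator (space M - (?A \<union> ?B)) \<omega> \<partial>M)"
    by (intro nn_integral_cong) (auto simp: encode_def indicator_def)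
  also have "\<dots> = g (1, 0) * emeasure M (?A - ?B) + g (1, 1) * emeasure M (?A \<inter> ?B) + g (0, 1) * emeasure M (?B - ?A) +
       g (0, 0) * emeasure M (space M - (?A \<union> ?B))"
    by (simp add: nn_integral_add nn_integral_cmult_indicator)
  also have "\<dots> = ennreal (p - r) * g (1, 0) + ennreal r * g (1, 1) + ennreal (q - r) * g (0, 1) + ennreal (1 - p - q + r) * g (0, 0)"
    unfolding emeasure_eq_measure d I u by (simp add: mult.commute)
  finally show ?thesis .
qed

text \<open>The factor \<open>fst\<close> removes the atoms (0,1) and (0,0). The remaining masses
  times \<open>rate\<close> are the intensities of particles from y visiting only the first point or
  both.\<close>

lemma mecke_site_pair:
  assumes "m \<le> n" "rate > 0"
  shows "mecke M (site_pair m a n b y)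
    (rate * (walk_prob m (a - y) * (1 - walk_prob (n - m) (b - a)))) (rate * (walk_prob m (a - y) * walk_prob (n - m) (b - a)))"
  unfolding site_pair_def [abs_def]
proof (rule mecke_compound_poisson)
  let ?U = "encode m a n b"
  have sum: "(\<lambda>f. \<Sum>i<k. f (Particle y i)) \<in> (\<Pi>\<^sub>M s\<in>Particle y ` {..<k}. count_space (UNIV :: (nat \<times> nat) set)) \<rightarrow>\<^sub>M count_space UNIV" for k
    by (rule measurable_sum_discrete, rule measurable_component_singleton) auto
  show "indep_var (count_space UNIV) (\<lambda>\<omega>. \<Sum>i<k. ?U (Particle y i) \<omega>) (count_space UNIV) (?U (Particle y k))" for k
    using indep_var_blocks[OF indep_encode, of "Particle y ` {..<k}" "{Particle y k}" _ "count_space UNIV" "\<lambda>f. f (Particle y k)" "count_space UNIV", OF _ _ _ sum]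
    by (auto simp: measurable_component_singleton)
  have count: "(\<lambda>\<omega>. (\<eta> y \<omega>, 0)) = ?U (Count y)" by (auto simp: encode_def)
  show "indep_var (count_space UNIV) (\<lambda>\<omega>. (\<eta> y \<omega>, 0)) (count_space UNIV) (\<lambda>\<omega>. \<Sum>i<k. ?U (Particle y i) \<omega>)" for k
    unfolding count using indep_var_blocks[OF indep_encode[of m a n b], of "{Count y}" "Particle y ` {..<k}" "\<lambda>f. f (Count y)" "count_space UNIV" _ "count_space UNIV", OF _ _ _ _ sum]
    by (auto simp: measurable_component_singleton)
  show "(\<integral>\<^sup>+\<omega>. g (?U (Particle y k) \<omega>) \<partial>M) = (\<integral>\<^sup>+\<omega>. g (?U (Particle y l) \<omega>) \<partial>M)" for k l and g :: "nat \<times> nat \<Rightarrow> ennreal"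
    unfolding nn_integral_encode_particle[OF assms(1)] ..
  show "(\<integral>\<^sup>+\<omega>. of_nat (fst (?U (Particle y k) \<omega>)) * g (?U (Particle y k) \<omega>) \<partial>M) =
     ennreal (walk_prob m (a - y) * (1 - walk_prob (n - m) (b - a))) * g (1, 0) + ennreal (walk_prob m (a - y) * walk_prob (n - m) (b - a)) * g (1, 1)" for k g
    unfolding nn_integral_encode_particle[OF assms(1), of "\<lambda>z. of_nat (fst z) * g z"] by (simp add: right_diff_distrib)
  show "distr M (count_space UNIV) (\<eta> y) = measure_pmf (poisson_pmf rate)" by (rule count_poisson)
qed (use assms in \<open>auto simp: walk_prob_nonneg walk_prob_le_1\<close>)

lemma mecke_site_sum:
  assumes "m \<le> n" "rate > 0" "finite Y"
  shows "mecke M (\<lambda>\<omega>. \<Sum>y\<in>Y. site_pair m a n b y \<omega>)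
    (\<Sum>y\<in>Y. rate * (walk_prob m (a - y) * (1 - walk_prob (n - m) (b - a)))) (\<Sum>y\<in>Y. rate * (walk_prob m (a - y) * walk_prob (n - m) (b - a)))"
  using assms(3)
proof (induction Y)
  case empty
  show ?case by (simp add: mecke_def)
next
  case (insert y Y)
  have "indep_var (count_space UNIV) (\<lambda>\<omega>. site_fun {y} (\<lambda>s\<in>site_sources {y}. encode m a n b s \<omega>)) (count_space UNIV) (\<lambda>\<omega>. site_fun Y (\<lambda>s\<in>site_sources Y. encode m a n b s \<omega>))"
    by (rule indep_var_blocks[OF indep_encode _ _ _ measurable_site_fun measurable_site_fun])
       (use insert.hyps in \<open>auto simp: site_sources_def\<close>)
  then have "indep_var (count_space UNIV) (site_pair m a n b y) (count_space UNIV) (\<lambda>\<omega>. \<Sum>y\<in>Y. site_pair m a n b y \<omega>)"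
    unfolding site_fun_encode by simp
  from mecke_add[OF this mecke_site_pair[OF assms(1,2)] insert.IH] insert.hyps assms(2)
  show ?case by (simp add: walk_prob_nonneg walk_prob_le_1 sum_nonneg)
qed

section \<open>Joint behaviour of two occupation numbers\<close>

text \<open>Almost surely only sites within distance n reach x in n steps, so this agrees almost
  surely with \<open>occupation\<close>. It is a natural number for every \<omega>, as
  \<open>mecke\<close> demands.\<close>

definition occ :: "nat \<Rightarrow> int \<Rightarrow> 'a \<Rightarrow> nat" where
  "occ n x \<omega> = (\<Sum>y\<in>{x - int n..x + int n}. \<Sum>i<\<eta> y \<omega>. of_bool (X y i n \<omega> = x))"

lemma AE_particle_range: "AE \<omega> in M. \<forall>n y i. \<bar>X y i n \<omega> - y\<bar> \<le> int n"
  unfolding AE_all_countable by (intro allI AE_walk_range[OF particle_walk])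

lemma occ_eq_sum:
  assumes "\<forall>n y i. \<bar>X y i n \<omega> - y\<bar> \<le> int n" "finite Y" "{x - int n..x + int n} \<subseteq> Y"
  shows "occ n x \<omega> = (\<Sum>y\<in>Y. \<Sum>i<\<eta> y \<omega>. of_bool (X y i n \<omega> = x))"
  unfolding occ_def
proof (rule sum.mono_neutral_left[OF assms(2,3)], intro ballI sum.neutral)
  fix y i assume y: "y \<in> Y - {x - int n..x + int n}"
  have "\<bar>X y i n \<omega> - y\<bar> \<le> int n" using assms(1) by blast
  with y show "of_bool (X y i n \<omega> = x) = (0 :: nat)" by auto
qed

lemma AE_occupation: "AE \<omega> in M. \<forall>n x. occupation \<eta> X n x \<omega> = real (occ n x \<omega>)"
  using AE_particle_range
proof eventually_elim
  case (elim \<omega>)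
  show ?case
  proof (intro allI)
    fix n x
    let ?f = "\<lambda>y. \<Sum>i<\<eta> y \<omega>. of_bool (X y i n \<omega> = x) :: real"
    have "?f y = 0" if "y \<notin> {x - int n..x + int n}" for y
    proof (intro sum.neutral ballI)
      fix i
      have "\<bar>X y i n \<omega> - y\<bar> \<le> int n" using elim by blast
      with that show "of_bool (X y i n \<omega> = x) = (0 :: real)" by auto
    qed
    then have "occupation \<eta> X n x \<omega> = infsum ?f {x - int n..x + int n}"
      unfolding occupation_def by (intro infsum_cong_neutral) auto
    also have "\<dots> = real (occ n x \<omega>)" by (simp add: occ_def)
    finally show "occupation \<eta> X n x \<omega> = real (occ n x \<omega>)" .
  qed
qed

lemma AE_site_sum:
  assumes "finite Y" "{a - int m..a + int m} \<union> {b - int n..b + int n} \<subseteq> Y"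
  shows "AE \<omega> in M. (\<Sum>y\<in>Y. site_pair m a n b y \<omega>) = (occ m a \<omega>, occ n b \<omega>)"
  using AE_particle_range
proof eventually_elim
  case (elim \<omega>)
  have "occ m a \<omega> = fst (\<Sum>y\<in>Y. site_pair m a n b y \<omega>)" "occ n b \<omega> = snd (\<Sum>y\<in>Y. site_pair m a n b y \<omega>)"
    using assms by (subst occ_eq_sum[OF elim assms(1)]; simp add: site_pair_def encode_def fst_sum snd_sum)+
  then show ?case by simp
qed

lemma measurable_site_sum: "(\<lambda>\<omega>. \<Sum>y\<in>Y. site_pair m a n b y \<omega>) \<in> M \<rightarrow>\<^sub>M count_space UNIV"
proof -
  have "(\<lambda>\<omega>. \<Sum>i<\<eta> y \<omega>. encode m a n b (Particle y i) \<omega>) \<in> M \<rightarrow>\<^sub>M count_space UNIV" for y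
    by (rule measurable_compose_countable[OF measurable_sum_discrete measurable_count]) (rule measurable_encode)
  then show ?thesis unfolding site_pair_def by (intro measurable_sum_discrete)
qed

lemma measurable_occ [measurable]: "occ n x \<in> M \<rightarrow>\<^sub>M count_space UNIV"
proof -
  have "(\<lambda>\<omega>. of_bool (X y i n \<omega> = x) :: nat) \<in> M \<rightarrow>\<^sub>M count_space UNIV" for y i
    by (rule measurable_compose_discrete[OF measurable_particle]) simp
  then have "(\<lambda>\<omega>. \<Sum>i<k. of_bool (X y i n \<omega> = x) :: nat) \<in> M \<rightarrow>\<^sub>M count_space UNIV" for y k
    by (intro measurable_sum_discrete)
  then have "(\<lambda>\<omega>. \<Sum>i<\<eta> y \<omega>. of_bool (X y i n \<omega> = x) :: nat) \<in> M \<rightarrow>\<^sub>M count_space UNIV" for y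
    by (rule measurable_compose_countable) measurable
  then show ?thesis unfolding occ_def [abs_def] by (intro measurable_sum_discrete)
qed

lemma measurable_occ_pair: "(\<lambda>\<omega>. (occ m a \<omega>, occ n b \<omega>)) \<in> M \<rightarrow>\<^sub>M count_space UNIV"
  by (rule measurable_compose_discrete2[where f = Pair, OF measurable_occ measurable_occ]) simp

text \<open>The probabilities of reaching a from y in m steps sum to 1 over y, so the site
  intensities add up to expressions free of m and a separately. Y contains every site from which
  either point is reachable.\<close>

lemma mecke_occ:
  assumes "m \<le> n" "rate > 0"
  shows "mecke M (\<lambda>\<omega>. (occ m a \<omega>, occ n b \<omega>)) (rate * (1 - walk_prob (n - m) (b - a))) (rate * walk_prob (n - m) (b - a))"
proof -
  define Y where "Y = {a - int m..a + int m} \<union> {b - int n..b + int n}"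
  have "(\<Sum>y\<in>Y. walk_prob m (a - y)) = (\<Sum>z\<in>(\<lambda>y. a - y) ` Y. walk_prob m z)"
    by (subst sum.reindex) (auto simp: inj_on_def)
  also have "\<dots> = 1"
  proof (rule sum_walk_prob)
    show "{- int m..int m} \<subseteq> (\<lambda>y. a - y) ` Y"
    proof
      fix z assume "z \<in> {- int m..int m}"
      then have "z = a - (a - z)" "a - z \<in> Y" by (auto simp: Y_def)
      then show "z \<in> (\<lambda>y. a - y) ` Y" by blast
    qed
  qed (simp add: Y_def)
  finally have 1: "(\<Sum>y\<in>Y. walk_prob m (a - y)) = 1" .
  have 2: "(\<Sum>y\<in>Y. rate * (walk_prob m (a - y) * c)) = rate * c" for c
  proof -
    have "(\<Sum>y\<in>Y. rate * (walk_prob m (a - y) * c)) = rate * c * (\<Sum>y\<in>Y. walk_prob m (a - y))"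
      unfolding sum_distrib_left by (intro sum.cong) auto
    then show ?thesis by (simp add: 1)
  qed
  have "finite Y" by (simp add: Y_def)
  from mecke_site_sum[OF assms this, of a b]
  show ?thesis unfolding 2 by (rule mecke_cong_AE) (rule AE_site_sum, auto simp: Y_def)
qed

text \<open>For two equal space-time points \<open>walk_prob 0 0 = 1\<close>, so the intensities are
  0 and \<open>rate\<close>. This supplies the facts on the second coordinate that the covariance
  formula assumes.\<close>

lemma
  assumes "rate > 0"
  shows integrable_poly_occ: "integrable M (\<lambda>\<omega>. poly p (real (occ n x \<omega>)))"
    and charlier_occ_mean: "l \<ge> 1 \<Longrightarrow> (\<integral>\<omega>. poly (charlier rate l) (real (occ n x \<omega>)) \<partial>M) = 0"
proof -
  have m: "mecke M (\<lambda>\<omega>. (occ n x \<omega>, occ n x \<omega>)) 0 rate"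
    using mecke_occ[of n n x x] assms by simp
  show "integrable M (\<lambda>\<omega>. poly p (real (occ n x \<omega>)))"
    using mecke_integrable_poly[OF prob_space_axioms measurable_occ_pair m] assms by simp
  show "l \<ge> 1 \<Longrightarrow> (\<integral>\<omega>. poly (charlier rate l) (real (occ n x \<omega>)) \<partial>M) = 0"
    using mecke_charlier_mean[OF prob_space_axioms measurable_occ_pair m] assms by simp
qed

lemma
  assumes "m \<le> n" "rate > 0"
  shows integrable_poly_occ_mult: "integrable M (\<lambda>\<omega>. poly p (real (occ m a \<omega>)) * poly q (real (occ n b \<omega>)))"
    and charlier_occ_cov: "(\<integral>\<omega>. poly (charlier rate j) (real (occ m a \<omega>)) * poly (charlier rate l) (real (occ n b \<omega>)) \<partial>M)
      = (if j = l then fact l * (rate * walk_prob (n - m) (b - a)) ^ l else 0)"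
proof -
  note * = prob_space_axioms measurable_occ_pair mecke_occ[OF assms, of a b]
  show "integrable M (\<lambda>\<omega>. poly p (real (occ m a \<omega>)) * poly q (real (occ n b \<omega>)))"
    using mecke_integrable_poly_mult[OF *] integrable_poly_occ[OF assms(2)] assms(2)
    by (simp add: walk_prob_nonneg walk_prob_le_1)
  have "rate * (1 - walk_prob (n - m) (b - a)) + rate * walk_prob (n - m) (b - a) = rate"
    by (simp add: algebra_simps)
  then show "(\<integral>\<omega>. poly (charlier rate j) (real (occ m a \<omega>)) * poly (charlier rate l) (real (occ n b \<omega>)) \<partial>M)
      = (if j = l then fact l * (rate * walk_prob (n - m) (b - a)) ^ l else 0)"
    using mecke_charlier_cov[OF *, where j = j and l = l] integrable_poly_occ[OF assms(2)] charlier_occ_mean[OF assms(2)] assms(2)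
    by (simp add: walk_prob_nonneg walk_prob_le_1)
qed

text \<open>The walk is a source outside all site blocks, so with its positions fixed the
  expectation is its two-time law times the covariance at fixed points.\<close>

lemma walker_charlier_cov:
  assumes "m \<le> n" "rate > 0"
  shows "has_bochner_integral M (\<lambda>\<omega>. of_bool (S m \<omega> = a \<and> S n \<omega> = b) *
      (poly (charlier rate j) (real (occ m a \<omega>)) * poly (charlier rate l) (real (occ n b \<omega>))))
    (walk_prob m a * walk_prob (n - m) (b - a) * (if j = l then fact l * (rate * walk_prob (n - m) (b - a)) ^ l else 0))"
proof -
  define Y where "Y = {a - int m..a + int m} \<union> {b - int n..b + int n}"
  let ?g = "\<lambda>z. poly (charlier rate j) (real (fst z)) * poly (charlier rate l) (real (snd z))"
  let ?T = "\<lambda>\<omega>. \<Sum>y\<in>Y. site_pair m a n b y \<omega>"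
  \<comment> \<open>The product of the two coded visit indicators of the walk is the indicator of
    both visits.\<close>
  let ?w = "\<lambda>z. real (fst z * snd z)"
  have T: "AE \<omega> in M. ?T \<omega> = (occ m a \<omega>, occ n b \<omega>)"
    by (rule AE_site_sum) (auto simp: Y_def)
  have "indep_var (count_space UNIV) (\<lambda>\<omega>. (\<lambda>f. f Walker) (\<lambda>s\<in>{Walker}. encode m a n b s \<omega>))
      (count_space UNIV) (\<lambda>\<omega>. site_fun Y (\<lambda>s\<in>site_sources Y. encode m a n b s \<omega>))"
    by (rule indep_var_blocks[OF indep_encode _ _ _ _ measurable_site_fun])
       (auto simp: site_sources_def measurable_component_singleton)
  then have "indep_var (count_space UNIV) (encode m a n b Walker) (count_space UNIV) ?T"
    unfolding site_fun_encode by simp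
  from indep_var_compose[OF this, of ?w borel ?g borel]
  have ind: "indep_var borel (\<lambda>\<omega>. ?w (encode m a n b Walker \<omega>)) borel (\<lambda>\<omega>. ?g (?T \<omega>))"
    by (simp add: comp_def)
  have w: "?w (encode m a n b Walker \<omega>) = indicator {\<omega> \<in> space M. S m \<omega> = a \<and> S n \<omega> = b} \<omega>" if "\<omega> \<in> space M" for \<omega>
    using that by (auto simp: encode_def indicator_def)
  have ev: "{\<omega> \<in> space M. S m \<omega> = a \<and> S n \<omega> = b} \<in> events" by measurable
  have iw: "integrable M (\<lambda>\<omega>. ?w (encode m a n b Walker \<omega>))"
    by (subst Bochner_Integration.integrable_cong[OF refl w]) (simp_all add: ev emeasure_eq_measure integrable_real_indicator)
  have "prob {\<omega> \<in> space M. S m \<omega> = a \<and> S n \<omega> = b} = walk_prob m a * walk_prob (n - m) (b - a)"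
    using prob_walk_joint[OF walker_walk assms(1)] by simp
  then have ew: "(\<integral>\<omega>. ?w (encode m a n b Walker \<omega>) \<partial>M) = walk_prob m a * walk_prob (n - m) (b - a)"
    by (subst Bochner_Integration.integral_cong[OF refl w]) auto
  have gm: "(\<lambda>\<omega>. ?g (?T \<omega>)) \<in> borel_measurable M" "(\<lambda>\<omega>. ?g (occ m a \<omega>, occ n b \<omega>)) \<in> borel_measurable M"
    by (rule measurable_compose_discrete[OF measurable_site_sum] measurable_compose_discrete[OF measurable_occ_pair]; simp)+
  have gae: "AE \<omega> in M. ?g (?T \<omega>) = ?g (occ m a \<omega>, occ n b \<omega>)" using T by eventually_elim simp
  have ig: "integrable M (\<lambda>\<omega>. ?g (?T \<omega>))"
    using integrable_poly_occ_mult[OF assms] integrable_cong_AE[OF gm gae] by simp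
  have eg: "(\<integral>\<omega>. ?g (?T \<omega>) \<partial>M) = (if j = l then fact l * (rate * walk_prob (n - m) (b - a)) ^ l else 0)"
    using charlier_occ_cov[OF assms] integral_cong_AE[OF gm gae] by simp
  have "has_bochner_integral M (\<lambda>\<omega>. ?w (encode m a n b Walker \<omega>) * ?g (?T \<omega>))
    (walk_prob m a * walk_prob (n - m) (b - a) * (if j = l then fact l * (rate * walk_prob (n - m) (b - a)) ^ l else 0))"
    using indep_var_lebesgue_integral[OF ind iw ig] indep_var_integrable[OF ind iw ig]
    unfolding ew eg by (simp add: has_bochner_integral_iff)
  moreover have "AE \<omega> in M. ?w (encode m a n b Walker \<omega>) * ?g (?T \<omega>) = of_bool (S m \<omega> = a \<and> S n \<omega> = b) *
      (poly (charlier rate j) (real (occ m a \<omega>)) * poly (charlier rate l) (real (occ n b \<omega>)))"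
    using T by eventually_elim (simp add: encode_def)
  ultimately show ?thesis
    by (subst has_bochner_integral_cong_AE) (use gm(2) in \<open>auto simp: has_bochner_integral_iff\<close>)
qed

end

section \<open>The variance\<close>

lemma sum_atMost_split_0: "(\<Sum>l\<le>k. f l) = f 0 + (\<Sum>l=1..k. f l)" for f :: "nat \<Rightarrow> 'b::comm_monoid_add"
proof -
  have "{..k} = insert 0 {1..k}" by auto
  then show ?thesis by simp
qed

lemma expectation_poisson_charlier:
  assumes "R > 0"
  shows "integrable (poisson_pmf R) (\<lambda>j. poly p (real j))"
    and "l \<ge> 1 \<Longrightarrow> measure_pmf.expectation (poisson_pmf R) (\<lambda>j. poly (charlier R l) (real j)) = 0"
proof -
  have T: "(\<lambda>k. (k, k)) \<in> measure_pmf (poisson_pmf R) \<rightarrow>\<^sub>M count_space UNIV" by simp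
  note * = measure_pmf.prob_space_axioms T mecke_poisson[OF assms]
  show "integrable (poisson_pmf R) (\<lambda>j. poly p (real j))"
    using mecke_integrable_poly[OF *] assms by simp
  show "l \<ge> 1 \<Longrightarrow> measure_pmf.expectation (poisson_pmf R) (\<lambda>j. poly (charlier R l) (real j)) = 0"
    using mecke_charlier_mean[OF *] assms by simp
qed

text \<open>Shows that the description by \<open>THE\<close> has exactly one solution. The zero
  Charlier means identify the constant term with the Poisson mean. The top coefficient is the
  leading coefficient of \<phi>, so the rank is a minimum over a nonempty set.\<close>

lemma charlier_coeff_expansion:
  assumes R: "R > 0" and k: "degree \<phi> \<ge> 1"
  defines "c \<equiv> charlier_coeff R \<phi>"
  shows "\<exists>c0. \<forall>x. poly \<phi> x = c0 + (\<Sum>l=1..degree \<phi>. c l * poly (charlier R l) x)"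
    and "l \<notin> {1..degree \<phi>} \<Longrightarrow> c l = 0" and "c (degree \<phi>) \<noteq> 0"
proof -
  define k where "k = degree \<phi>"
  obtain d where d: "\<phi> = (\<Sum>l\<le>k. smult (d l) (charlier R l))"
    using charlier_expansion[of \<phi> k R] by (auto simp: k_def)
  have pd: "poly \<phi> x = d 0 + (\<Sum>l=1..k. d l * poly (charlier R l) x)" for x
    by (subst d) (simp add: poly_sum sum_atMost_split_0)
  have E: "measure_pmf.expectation (poisson_pmf R) (\<lambda>j. poly \<phi> (real j)) = d 0"
  proof -
    have "has_bochner_integral (poisson_pmf R) (\<lambda>j. d 0 + (\<Sum>l=1..k. d l * poly (charlier R l) (real j)))
        (d 0 + (\<Sum>l=1..k. d l * 0))"
      by (intro has_bochner_integral_add has_bochner_integral_sum has_bochner_integral_mult_right)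
         (use expectation_poisson_charlier[OF R] in \<open>auto simp: has_bochner_integral_iff\<close>)
    then show ?thesis unfolding pd by (simp add: has_bochner_integral_iff)
  qed
  define e where "e l = (if l \<in> {1..k} then d l else 0)" for l
  define P where "P c \<longleftrightarrow> (\<forall>l. l \<notin> {1..degree \<phi>} \<longrightarrow> c l = 0) \<and>
     (AE m in measure_pmf (poisson_pmf R).
        poly \<phi> (real m) - measure_pmf.expectation (poisson_pmf R) (\<lambda>j. poly \<phi> (real j))
          = (\<Sum>l=1..degree \<phi>. c l * poly (charlier R l) (real m)))" for c
  have de: "(\<Sum>l=1..k. d l * poly (charlier R l) x) = (\<Sum>l=1..k. e l * poly (charlier R l) x)" for x
    by (intro sum.cong) (auto simp: e_def)
  have Pe: "P e"
    unfolding P_def E unfolding pd de k_def [symmetric] by (auto simp: e_def)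
  have uniq: "c' = e" if "P c'" for c'
  proof
    fix l
    \<comment> \<open>Every natural number is an atom of the Poisson law, so the almost sure
      identity holds at all of them; a polynomial with that many zeros vanishes.\<close>
    have eq: "(\<Sum>l=1..k. c' l * poly (charlier R l) (real m)) = (\<Sum>l=1..k. e l * poly (charlier R l) (real m))" for m :: nat
      using that R unfolding P_def E unfolding pd de k_def [symmetric] by (auto simp: AE_measure_pmf_iff)
    define u where "u l = (if l = 0 then 0 else c' l - e l)" for l
    define q where "q = (\<Sum>l\<le>k. smult (u l) (charlier R l))"
    have "poly q (real m) = 0" for m
    proof -
      have "poly q (real m) = (\<Sum>l=1..k. u l * poly (charlier R l) (real m))"
        by (simp add: q_def poly_sum sum_atMost_split_0 u_def)
      also have "\<dots> = (\<Sum>l=1..k. c' l * poly (charlier R l) (real m)) - (\<Sum>l=1..k. e l * poly (charlier R l) (real m))"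
        unfolding sum_subtractf [symmetric] by (intro sum.cong) (auto simp: u_def algebra_simps)
      finally show ?thesis using eq[of m] by linarith
    qed
    then have "range real \<subseteq> {x. poly q x = 0}" by auto
    moreover have "infinite (range real)" by (simp add: finite_image_iff infinite_UNIV_nat inj_of_nat)
    ultimately have "q = 0" using poly_roots_finite finite_subset by blast
    show "c' l = e l"
    proof (cases "l \<in> {1..k}")
      case True
      then show ?thesis using charlier_lin_indep[where c = u and k = k and R = R and l = l] \<open>q = 0\<close> by (simp add: q_def u_def)
    next
      case False
      then have "c' l = 0" using that unfolding P_def k_def by blast
      then show ?thesis unfolding e_def if_not_P[OF False] .
    qed
  qed
  have ce: "c = e"
    unfolding c_def charlier_coeff_def P_def [symmetric] by (rule the_equality) (use Pe uniq in blast)+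
  show "\<exists>c0. \<forall>x. poly \<phi> x = c0 + (\<Sum>l=1..degree \<phi>. c l * poly (charlier R l) x)"
    unfolding ce k_def [symmetric] using pd de by auto
  show "l \<notin> {1..degree \<phi>} \<Longrightarrow> c l = 0"
    unfolding ce e_def k_def by (rule if_not_P)
  show "c (degree \<phi>) \<noteq> 0"
  proof -
    have "coeff \<phi> k = (\<Sum>l\<le>k. d l * coeff (charlier R l) k)"
      by (subst d) (simp add: coeff_sum)
    also have "\<dots> = (\<Sum>l\<le>k. if l = k then d l else 0)"
      using coeff_charlier by (intro sum.cong) auto
    finally have "coeff \<phi> k = d k" by simp
    moreover have "coeff \<phi> k \<noteq> 0" using assms(2) by (auto simp: k_def)
    ultimately show ?thesis using k unfolding ce by (simp add: e_def k_def)
  qed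
qed

text \<open>An explicit form of the infinite sum in \<open>occupation\<close>, to get its measurability: it is only almost
  surely finite, and the underlying space need not be complete.\<close>

lemma infsum_nat_valued:
  fixes f :: "int \<Rightarrow> nat"
  shows "(\<Sum>\<^sub>\<infinity>y. real (f y)) =
    (if \<exists>N::nat. \<forall>y. int N < \<bar>y\<bar> \<longrightarrow> f y = 0 then \<Sum>y\<in>{- int (LEAST N. \<forall>y. int N < \<bar>y\<bar> \<longrightarrow> f y = 0)..int (LEAST N. \<forall>y. int N < \<bar>y\<bar> \<longrightarrow> f y = 0)}. real (f y) else 0)"
proof (cases "\<exists>N::nat. \<forall>y. int N < \<bar>y\<bar> \<longrightarrow> f y = 0")
  case True
  define L where "L = (LEAST N::nat. \<forall>y. int N < \<bar>y\<bar> \<longrightarrow> f y = 0)"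
  have L: "\<forall>y. int L < \<bar>y\<bar> \<longrightarrow> f y = 0" unfolding L_def by (rule LeastI_ex[OF True])
  have "(\<Sum>\<^sub>\<infinity>y. real (f y)) = infsum (\<lambda>y. real (f y)) {- int L..int L}"
    using L by (intro infsum_cong_neutral) auto
  then show ?thesis using True by (simp add: L_def)
next
  case False
  have "infinite {y. f y \<noteq> 0}"
  proof
    assume fin: "finite {y. f y \<noteq> 0}"
    define N where "N = nat (Max (insert 0 ((\<lambda>y. \<bar>y\<bar>) ` {y. f y \<noteq> 0})))"
    have "\<bar>y\<bar> \<le> int N" if "f y \<noteq> 0" for y
      using that fin Max_ge[of "insert 0 ((\<lambda>y. \<bar>y\<bar>) ` {y. f y \<noteq> 0})" "\<bar>y\<bar>"] by (auto simp: N_def)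
    then have "\<forall>y. int N < \<bar>y\<bar> \<longrightarrow> f y = 0" by (meson not_less)
    with False show False by blast
  qed
  \<comment> \<open>Infinitely many values of at least 1 exclude summability, and
    \<open>infsum\<close> then has its default value 0.\<close>
  have "\<not> (\<lambda>y. real (f y)) summable_on UNIV"
  proof
    assume s: "(\<lambda>y. real (f y)) summable_on UNIV"
    obtain n :: nat where n: "(\<Sum>\<^sub>\<infinity>y. real (f y)) < real n" using reals_Archimedean2 by blast
    obtain B where B: "finite B" "card B = n" "B \<subseteq> {y. f y \<noteq> 0}"
      using infinite_arbitrarily_large[OF \<open>infinite {y. f y \<noteq> 0}\<close>] by blast
    have "real n = (\<Sum>y\<in>B. 1)" using B by simp
    also have "\<dots> \<le> (\<Sum>y\<in>B. real (f y))" using B by (intro sum_mono) (auto simp: Suc_le_eq)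
    also have "\<dots> \<le> (\<Sum>\<^sub>\<infinity>y. real (f y))" by (rule finite_sum_le_infsum[OF s B(1)]) auto
    finally show False using n by simp
  qed
  then have "(\<Sum>\<^sub>\<infinity>y. real (f y)) = 0" by (rule infsum_not_exists)
  then show ?thesis by (simp only: False if_False)
qed

context poisson_walks
begin

lemma measurable_occupation [measurable]: "occupation \<eta> X n x \<in> borel_measurable M"
proof -
  define f where "f y \<omega> = (\<Sum>i<\<eta> y \<omega>. of_bool (X y i n \<omega> = x) :: nat)" for y \<omega>
  have [measurable]: "f y \<in> M \<rightarrow>\<^sub>M count_space UNIV" for y
  proof -
    have "(\<lambda>\<omega>. of_bool (X y i n \<omega> = x) :: nat) \<in> M \<rightarrow>\<^sub>M count_space UNIV" for i
      by (rule measurable_compose_discrete[OF measurable_particle]) simp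
    then have "(\<lambda>\<omega>. \<Sum>i<k. of_bool (X y i n \<omega> = x) :: nat) \<in> M \<rightarrow>\<^sub>M count_space UNIV" for k
      by (intro measurable_sum_discrete)
    then show ?thesis unfolding f_def [abs_def] by (rule measurable_compose_countable) measurable
  qed
  define P where "P N \<omega> \<longleftrightarrow> (\<forall>y. int N < \<bar>y\<bar> \<longrightarrow> f y \<omega> = 0)" for N :: nat and \<omega>
  have [measurable]: "Measurable.pred M (P N)" for N unfolding P_def [abs_def] by measurable
  have [measurable]: "(\<lambda>\<omega>. LEAST N. P N \<omega>) \<in> M \<rightarrow>\<^sub>M count_space UNIV" by measurable
  have "(\<lambda>\<omega>. \<Sum>y\<in>{- int (LEAST N. P N \<omega>)..int (LEAST N. P N \<omega>)}. real (f y \<omega>)) \<in> borel_measurable M"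
    by (rule measurable_compose_countable[of "\<lambda>L \<omega>. \<Sum>y\<in>{- int L..int L}. real (f y \<omega>)"]) measurable
  then have "(\<lambda>\<omega>. if \<exists>N. P N \<omega> then \<Sum>y\<in>{- int (LEAST N. P N \<omega>)..int (LEAST N. P N \<omega>)}. real (f y \<omega>) else 0) \<in> borel_measurable M"
    by measurable
  also have "(\<lambda>\<omega>. if \<exists>N. P N \<omega> then \<Sum>y\<in>{- int (LEAST N. P N \<omega>)..int (LEAST N. P N \<omega>)}. real (f y \<omega>) else 0) = occupation \<eta> X n x"
  proof
    fix \<omega>
    have "occupation \<eta> X n x \<omega> = (\<Sum>\<^sub>\<infinity>y. real (f y \<omega>))"
      by (simp add: occupation_def f_def)
    then show "(if \<exists>N. P N \<omega> then \<Sum>y\<in>{- int (LEAST N. P N \<omega>)..int (LEAST N. P N \<omega>)}. real (f y \<omega>) else 0) = occupation \<eta> X n x \<omega>"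
      unfolding infsum_nat_valued P_def by simp
  qed
  finally show ?thesis .
qed

section \<open>Charlier polynomials observed along the walk\<close>

definition charlier_obs :: "nat \<Rightarrow> nat \<Rightarrow> 'a \<Rightarrow> real" where
  "charlier_obs l n \<omega> = poly (charlier rate l) (occupation \<eta> X n (S n \<omega>) \<omega>)"

lemma measurable_charlier_obs [measurable]: "charlier_obs l n \<in> borel_measurable M"
proof -
  have "(\<lambda>\<omega>. occupation \<eta> X n (S n \<omega>) \<omega>) \<in> borel_measurable M"
    by (rule measurable_compose_countable[OF measurable_occupation measurable_walker])
  then show ?thesis unfolding charlier_obs_def [abs_def] poly_altdef by measurable
qed

text \<open>The covariance formula concerns deterministic sites, so the random position is resolved
  into a finite sum over its almost sure range.\<close>

lemma AE_charlier_obs: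
  "AE \<omega> in M. charlier_obs l n \<omega> = (\<Sum>a\<in>{- int n..int n}. of_bool (S n \<omega> = a) * poly (charlier rate l) (real (occ n a \<omega>)))"
  using AE_walk_range[OF walker_walk, of n] AE_occupation
proof eventually_elim
  case (elim \<omega>)
  have "(\<Sum>a\<in>{- int n..int n}. of_bool (S n \<omega> = a) * poly (charlier rate l) (real (occ n a \<omega>)))
    = (\<Sum>a\<in>{- int n..int n}. if a = S n \<omega> then poly (charlier rate l) (real (occ n a \<omega>)) else 0)"
    by (intro sum.cong) auto
  also have "\<dots> = poly (charlier rate l) (real (occ n (S n \<omega>) \<omega>))"
    using elim(1) by (subst sum.delta) auto
  finally show ?case using elim(2) by (simp add: charlier_obs_def)
qed

text \<open>The walk contributes one more factor p to the l-th power in the covariance, so the sum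
  over b is a walk moment, the same for every a; the sum over a is then 1.\<close>

lemma charlier_obs_cov_le:
  assumes "m \<le> n" "rate > 0"
  shows "has_bochner_integral M (\<lambda>\<omega>. charlier_obs j m \<omega> * charlier_obs l n \<omega>)
    (if j = l then fact l * rate ^ l * walk_moment l (n - m) else 0)"
proof -
  let ?C = "\<lambda>l. poly (charlier rate l)"
  have "AE \<omega> in M. charlier_obs j m \<omega> * charlier_obs l n \<omega> = (\<Sum>a\<in>{- int m..int m}. \<Sum>b\<in>{- int n..int n}.
      of_bool (S m \<omega> = a \<and> S n \<omega> = b) * (?C j (real (occ m a \<omega>)) * ?C l (real (occ n b \<omega>))))" (is "AE \<omega> in M. _ = ?F \<omega>")
    using AE_charlier_obs[of j m] AE_charlier_obs[of l n]
    by eventually_elim (simp only: sum_product of_bool_conj mult_ac)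
  moreover have "has_bochner_integral M ?F (\<Sum>a\<in>{- int m..int m}. \<Sum>b\<in>{- int n..int n}.
     walk_prob m a * walk_prob (n - m) (b - a) * (if j = l then fact l * (rate * walk_prob (n - m) (b - a)) ^ l else 0))"
    by (intro has_bochner_integral_sum walker_charlier_cov[OF assms])
  ultimately have *: "has_bochner_integral M (\<lambda>\<omega>. charlier_obs j m \<omega> * charlier_obs l n \<omega>) (\<Sum>a\<in>{- int m..int m}. \<Sum>b\<in>{- int n..int n}.
     walk_prob m a * walk_prob (n - m) (b - a) * (if j = l then fact l * (rate * walk_prob (n - m) (b - a)) ^ l else 0))"
    by (subst has_bochner_integral_cong_AE[of _ _ ?F]) (auto dest: has_bochner_integral_integrable borel_measurable_has_bochner_integral)
  have "(\<Sum>a\<in>{- int m..int m}. \<Sum>b\<in>{- int n..int n}.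
     walk_prob m a * walk_prob (n - m) (b - a) * (if j = l then fact l * (rate * walk_prob (n - m) (b - a)) ^ l else 0))
    = (\<Sum>a\<in>{- int m..int m}. walk_prob m a * (if j = l then fact l * rate ^ l * walk_moment l (n - m) else 0))"
  proof (intro sum.cong refl)
    fix a assume a: "a \<in> {- int m..int m}"
    have "walk_moment l (n - m) = (\<Sum>z\<in>(\<lambda>b. b - a) ` {- int n..int n}. walk_prob (n - m) z ^ Suc l)"
    proof (rule sum_walk_prob_power [symmetric])
      \<comment> \<open>As \<open>\<bar>a\<bar> \<le> m\<close>, a displacement of at most n - m
        from a ends within distance n of the origin.\<close>
      show "{- int (n - m)..int (n - m)} \<subseteq> (\<lambda>b. b - a) ` {- int n..int n}"
      proof
        fix z assume "z \<in> {- int (n - m)..int (n - m)}"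
        then have "z = (z + a) - a" "z + a \<in> {- int n..int n}" using a assms(1) by auto
        then show "z \<in> (\<lambda>b. b - a) ` {- int n..int n}" by blast
      qed
    qed simp
    also have "\<dots> = (\<Sum>b\<in>{- int n..int n}. walk_prob (n - m) (b - a) ^ Suc l)"
      by (subst sum.reindex) (auto simp: inj_on_def)
    finally have w: "walk_moment l (n - m) = (\<Sum>b\<in>{- int n..int n}. walk_prob (n - m) (b - a) ^ Suc l)" .
    show "(\<Sum>b\<in>{- int n..int n}. walk_prob m a * walk_prob (n - m) (b - a) * (if j = l then fact l * (rate * walk_prob (n - m) (b - a)) ^ l else 0))
      = walk_prob m a * (if j = l then fact l * rate ^ l * walk_moment l (n - m) else 0)"
      unfolding w sum_distrib_left by (auto simp: sum_distrib_left power_mult_distrib mult_ac intro!: sum.cong)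
  qed
  also have "\<dots> = (\<Sum>a\<in>{- int m..int m}. walk_prob m a) * (if j = l then fact l * rate ^ l * walk_moment l (n - m) else 0)"
    by (rule sum_distrib_right [symmetric])
  also have "(\<Sum>a\<in>{- int m..int m}. walk_prob m a) = 1" by (rule sum_walk_prob) auto
  finally show ?thesis using * by simp
qed

lemma charlier_obs_cov:
  assumes "rate > 0"
  shows "has_bochner_integral M (\<lambda>\<omega>. charlier_obs j m \<omega> * charlier_obs l n \<omega>)
    (if j = l then fact l * rate ^ l * walk_moment l (nat \<bar>int m - int n\<bar>) else 0)"
proof (cases "m \<le> n")
  case True
  then have e: "nat \<bar>int m - int n\<bar> = n - m" by auto
  show ?thesis using charlier_obs_cov_le[OF True assms, of j l] by (simp only: e)
next
  case False
  then have e: "nat \<bar>int m - int n\<bar> = m - n" and le: "n \<le> m" by auto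
  show ?thesis using charlier_obs_cov_le[OF le assms, of l j] unfolding e
    by (cases "j = l") (auto simp: mult.commute)
qed

text \<open>This is the covariance with the constant polynomial of degree 0.\<close>

lemma charlier_obs_mean:
  assumes "rate > 0" "l \<ge> 1"
  shows "has_bochner_integral M (charlier_obs l n) 0"
  using charlier_obs_cov[OF assms(1), of 0 n l n] assms(2) by (simp add: charlier_obs_def [of 0] cong: if_cong)

text \<open>Different degrees are uncorrelated at all pairs of times, so after centring only equal
  degrees survive.\<close>

lemma variance_observed_sum:
  assumes "rate > 0" and \<phi>: "\<And>x. poly \<phi> x = c0 + (\<Sum>l=1..k. c l * poly (charlier rate l) x)"
  shows "variance (observed_sum \<phi> \<eta> X S N) = (\<Sum>l=1..k. ((c l)\<^sup>2 * fact l * rate ^ l) * toeplitz_sum (walk_moment l) N)"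
proof -
  define Z where "Z \<omega> = (\<Sum>n=1..N. \<Sum>l=1..k. c l * charlier_obs l n \<omega>)" for \<omega>
  have Y: "observed_sum \<phi> \<eta> X S N \<omega> = real N * c0 + Z \<omega>" for \<omega>
    by (simp add: observed_sum_def Z_def \<phi> charlier_obs_def sum.distrib)
  have "has_bochner_integral M Z (\<Sum>n=1..N. \<Sum>l=1..k. c l * 0)"
    unfolding Z_def by (intro has_bochner_integral_sum has_bochner_integral_mult_right charlier_obs_mean assms) auto
  then have Z: "integrable M Z" "expectation Z = 0" by (auto simp: has_bochner_integral_iff)
  have EY: "expectation (observed_sum \<phi> \<eta> X S N) = real N * c0"
    unfolding Y [abs_def] using Z by (simp add: prob_space)
  have Z2: "(Z \<omega>)\<^sup>2 = (\<Sum>m=1..N. \<Sum>n=1..N. \<Sum>j=1..k. \<Sum>l=1..k. c j * c l * (charlier_obs j m \<omega> * charlier_obs l n \<omega>))" for \<omega>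
    unfolding Z_def power2_eq_square sum_product by (simp add: mult_ac)
  have "has_bochner_integral M (\<lambda>\<omega>. (Z \<omega>)\<^sup>2) (\<Sum>m=1..N. \<Sum>n=1..N. \<Sum>j=1..k. \<Sum>l=1..k. c j * c l *
     (if j = l then fact l * rate ^ l * walk_moment l (nat \<bar>int m - int n\<bar>) else 0))"
    unfolding Z2 by (intro has_bochner_integral_sum has_bochner_integral_mult_right charlier_obs_cov assms)
  also have "(\<Sum>m=1..N. \<Sum>n=1..N. \<Sum>j=1..k. \<Sum>l=1..k. c j * c l *
     (if j = l then fact l * rate ^ l * walk_moment l (nat \<bar>int m - int n\<bar>) else 0))
    = (\<Sum>m=1..N. \<Sum>n=1..N. \<Sum>j=1..k. ((c j)\<^sup>2 * fact j * rate ^ j) * walk_moment j (nat \<bar>int m - int n\<bar>))"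
  proof (intro sum.cong refl)
    fix m n j :: nat assume j: "j \<in> {1..k}"
    have "(\<Sum>l=1..k. c j * c l * (if j = l then fact l * rate ^ l * walk_moment l (nat \<bar>int m - int n\<bar>) else 0))
      = (\<Sum>l=1..k. if j = l then ((c j)\<^sup>2 * fact j * rate ^ j) * walk_moment j (nat \<bar>int m - int n\<bar>) else 0)"
      by (intro sum.cong) (auto simp: power2_eq_square)
    also have "\<dots> = ((c j)\<^sup>2 * fact j * rate ^ j) * walk_moment j (nat \<bar>int m - int n\<bar>)"
      using j by (subst sum.delta') auto
    finally show "(\<Sum>l=1..k. c j * c l * (if j = l then fact l * rate ^ l * walk_moment l (nat \<bar>int m - int n\<bar>) else 0))
      = ((c j)\<^sup>2 * fact j * rate ^ j) * walk_moment j (nat \<bar>int m - int n\<bar>)" .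
  qed
  also have "\<dots> = (\<Sum>m=1..N. \<Sum>j=1..k. \<Sum>n=1..N. ((c j)\<^sup>2 * fact j * rate ^ j) * walk_moment j (nat \<bar>int m - int n\<bar>))"
    by (intro sum.cong refl sum.swap)
  also have "\<dots> = (\<Sum>l=1..k. ((c l)\<^sup>2 * fact l * rate ^ l) * toeplitz_sum (walk_moment l) N)"
    unfolding toeplitz_sum_def sum_distrib_left by (rule sum.swap)
  finally have "expectation (\<lambda>\<omega>. (Z \<omega>)\<^sup>2) = (\<Sum>l=1..k. ((c l)\<^sup>2 * fact l * rate ^ l) * toeplitz_sum (walk_moment l) N)"
    by (rule has_bochner_integral_integral_eq)
  then show ?thesis unfolding EY by (simp add: Y)
qed

end

theorem lemmaA3:
  fixes M :: "'a measure" and rate :: real and \<phi> :: "real poly"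
    and \<eta> :: "int \<Rightarrow> 'a \<Rightarrow> nat"
    and X :: "int \<Rightarrow> nat \<Rightarrow> nat \<Rightarrow> 'a \<Rightarrow> int"
    and S :: "nat \<Rightarrow> 'a \<Rightarrow> int"
  assumes "rate > 0"
    and "degree \<phi> \<ge> 1"
    and "poisson_walks M rate \<eta> X S"
  shows "(charlier_rank rate \<phi> = 1 \<longrightarrow>
        (\<lambda>N. prob_space.variance M (observed_sum \<phi> \<eta> X S N)) \<sim>[at_top]
        (\<lambda>N. 8 * (charlier_coeff rate \<phi> 1)\<^sup>2 * rate / (3 * sqrt pi) * real N powr (3 / 2)))
    \<and> (charlier_rank rate \<phi> = 2 \<longrightarrow>
        (\<lambda>N. prob_space.variance M (observed_sum \<phi> \<eta> X S N)) \<sim>[at_top]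
        (\<lambda>N. 8 * (charlier_coeff rate \<phi> 2)\<^sup>2 * rate\<^sup>2 / (pi * sqrt 3) * (real N * ln (real N))))
    \<and> (charlier_rank rate \<phi> \<ge> 3 \<longrightarrow>
        (\<lambda>N. prob_space.variance M (observed_sum \<phi> \<eta> X S N)) \<in> \<Theta>(\<lambda>N. real N))"
proof -
  interpret poisson_walks M rate \<eta> X S by fact
  define c where "c = charlier_coeff rate \<phi>"
  define k where "k = degree \<phi>"
  define w where "w l = (c l)\<^sup>2 * fact l * rate ^ l" for l
  note exp = charlier_coeff_expansion[OF assms(1,2), folded c_def k_def]
  obtain c0 where c0: "\<And>x. poly \<phi> x = c0 + (\<Sum>l=1..k. c l * poly (charlier rate l) x)"
    using exp(1) by blast
  have V: "variance (observed_sum \<phi> \<eta> X S N) = (\<Sum>l=1..k. w l * toeplitz_sum (walk_moment l) N)" for N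
    unfolding w_def by (rule variance_observed_sum[OF assms(1) c0])
  have k: "k \<ge> 1" using assms(2) by (simp add: k_def)
  define A where "A = {l \<in> {1..k}. c l \<noteq> 0}"
  \<comment> \<open>The top Charlier coefficient is nonzero, so A is nonempty and \<open>Min\<close>
    is meaningful.\<close>
  have A: "finite A" "k \<in> A" using k exp(3) by (auto simp: A_def)
  have r: "charlier_rank rate \<phi> = Min A" by (simp add: charlier_rank_def A_def c_def k_def)
  have rA: "Min A \<in> A" using A by (intro Min_in) auto
  have below: "c l = 0" if "l < Min A" for l
  proof (cases "l \<in> {1..k}")
    case True
    show ?thesis
    proof (rule ccontr)
      assume "c l \<noteq> 0"
      with True have "l \<in> A" by (simp add: A_def)
      from Min_le[OF A(1) this] that show False by simp
    qed
  qed (rule exp(2))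
  have w0: "w l = 0" if "l < Min A" for l using below[OF that] by (simp add: w_def)
  show ?thesis
    unfolding r V c_def [symmetric]
  proof (intro conjI impI)
    assume 1: "Min A = 1"
    then have "c 1 \<noteq> 0" using rA by (simp add: A_def)
    have e: "w 1 * (8 / (3 * sqrt pi)) = 8 * (c 1)\<^sup>2 * rate / (3 * sqrt pi)" by (simp add: w_def)
    show "(\<lambda>N. \<Sum>l=1..k. w l * toeplitz_sum (walk_moment l) N) \<sim>[at_top]
        (\<lambda>N. 8 * (c 1)\<^sup>2 * rate / (3 * sqrt pi) * real N powr (3 / 2))"
      by (rule asymp_equivI'_const[OF variance_series_asymp(1)[OF k, of w, unfolded e]])
         (use \<open>c 1 \<noteq> 0\<close> assms(1) in simp)
  next
    assume 2: "Min A = 2"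
    then have "c 2 \<noteq> 0" "k \<ge> 2" "w 1 = 0" using rA w0[of 1] by (auto simp: A_def)
    \<comment> \<open>The factor \<open>fact 2\<close> in \<open>w 2\<close> turns the 4 of the
      double sum into 8.\<close>
    have e: "w 2 * (4 / (pi * sqrt 3)) = 8 * (c 2)\<^sup>2 * rate\<^sup>2 / (pi * sqrt 3)" by (simp add: w_def)
    show "(\<lambda>N. \<Sum>l=1..k. w l * toeplitz_sum (walk_moment l) N) \<sim>[at_top]
        (\<lambda>N. 8 * (c 2)\<^sup>2 * rate\<^sup>2 / (pi * sqrt 3) * (real N * ln (real N)))"
      by (rule asymp_equivI'_const[OF variance_series_asymp(2)[OF k, of w, OF \<open>w 1 = 0\<close> \<open>k \<ge> 2\<close>, unfolded e]])
         (use \<open>c 2 \<noteq> 0\<close> assms(1) in simp)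
  next
    assume 3: "3 \<le> Min A"
    have "c (Min A) \<noteq> 0" "Min A \<in> {1..k}" using rA by (auto simp: A_def)
    then show "(\<lambda>N. \<Sum>l=1..k. w l * toeplitz_sum (walk_moment l) N) \<in> \<Theta>(\<lambda>N. real N)"
      using assms(1) 3 w0 by (intro variance_series_asymp(3)[OF k, of w "Min A"]) (auto simp: w_def)
  qed
qed

end
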